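(* Let $X$ be a compact metric space. The following are equivalent: (i) $X$ is almost chainable. (ii) $X$ is a generalized arc-like space. (iii) $X$ is (homeomorphic to) an inverse limit of finite disjoint copies of unit intervals. (iv) $C(X)$ is an AI-algebra.
   Context: Let $X$ be a compact metric space. An almost chain in $X$ is a finite non-empty indexed collection $C=\{C_1,\dots,C_k\}$ of open subsets of $X$ such that $C_i\cap C_j=\emptyset$ whenever $|i-j|\geq 2$. Its mesh is $\max_i \operatorname{diam}(C_i)$, where $\operatorname{diam}(\emptyset)=0$; an almost chain of mesh less than $\epsilon$ is an $\epsilon$-almost chain. $X$ is almost chainable if for every $\epsilon>0$ there is an $\epsilon$-almost chain covering $X$. Given $\epsilon,\delta>0$, a continuous map $f\colon X\to Y$ between metric spaces is an $(\epsilon,\delta)$-map if $\operatorname{diam}(f^{-1}(Z))<\epsilon$ for every $Z\subset Y$ with $\operatorname{diam}(Z)<\delta$. $X$ is a generalized arc-like space if for every $\epsilon>0$ there exist $\delta>0$ and an $(\epsilon,\delta)$-map $f\colon X\to I_1\sqcup\cdots\sqcup I_n$ (for some $n$) with $I_j=[0,1]$ for each $j$. The metric on $I_1\sqcup\cdots\sqcup I_n$ is the usual distance for two points of the same component and $2$ for two points in different components. In (iii), an inverse limit means the limit of a sequence $Y_1\leftarrow Y_2\leftarrow Y_3\leftarrow\cdots$ of spaces and continuous maps where each $Y_i$ is a finite disjoint union of copies of $[0,1]$ (the number of copies may vary with $i$). A $C^*$-algebra $A$ is an AI-algebra if it is $*$-isomorphic to the inductive limit of a sequence of $C^*$-algebras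 of the form $C[0,1]\otimes F_n$ with each $F_n$ finite dimensional. *)

theory Defs
  imports "HOL-Analysis.Analysis" "HOL-Algebra.Module"
begin

section \<open>Almost chainable and generalized arc-like spaces\<close>

text \<open>The library's \<^term>\<open>diameter\<close> lives on the type class of metric spaces; this is the same
  definition for \<^typ>\<open>'a metric\<close>.  As there, the value is only meaningful for bounded sets, which
  is the only case needed below (all spaces involved are bounded).\<close>

definition mdiameter :: "'a metric \<Rightarrow> 'a set \<Rightarrow> real" where
  "mdiameter X S = (if S = {} then 0 else SUP (x,y)\<in>S\<times>S. mdist X x y)"

definition almost_chain :: "'a metric \<Rightarrow> nat \<Rightarrow> (nat \<Rightarrow> 'a set) \<Rightarrow> bool" where
  "almost_chain X k C \<longleftrightarrow>
     k \<ge> 1 \<and>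
     (\<forall>i\<in>{1..k}. openin (mtopology_of X) (C i)) \<and>
     (\<forall>i\<in>{1..k}. \<forall>j\<in>{1..k}. \<bar>int i - int j\<bar> \<ge> 2 \<longrightarrow> C i \<inter> C j = {})"

definition mesh :: "'a metric \<Rightarrow> nat \<Rightarrow> (nat \<Rightarrow> 'a set) \<Rightarrow> real" where
  "mesh X k C = Max ((\<lambda>i. mdiameter X (C i)) ` {1..k})"

definition almost_chainable :: "'a metric \<Rightarrow> bool" where
  "almost_chainable X \<longleftrightarrow>
     (\<forall>\<epsilon>>0. \<exists>k C. almost_chain X k C \<and> mesh X k C < \<epsilon> \<and> (\<Union>i\<in>{1..k}. C i) = mspace X)"

definition eps_delta_map ::
  "'a metric \<Rightarrow> 'b metric \<Rightarrow> real \<Rightarrow> real \<Rightarrow> ('a \<Rightarrow> 'b) \<Rightarrow> bool" where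
  "eps_delta_map X Y \<epsilon> \<delta> f \<longleftrightarrow>
     continuous_map (mtopology_of X) (mtopology_of Y) f \<and>
     (\<forall>Z\<subseteq>mspace Y. mdiameter Y Z < \<delta> \<longrightarrow> mdiameter X {x \<in> mspace X. f x \<in> Z} < \<epsilon>)"

definition intervals_dist :: "nat \<times> real \<Rightarrow> nat \<times> real \<Rightarrow> real" where
  "intervals_dist p q = (if fst p = fst q then \<bar>snd p - snd q\<bar> else 2)"

definition intervals_metric :: "nat \<Rightarrow> (nat \<times> real) metric" where
  "intervals_metric n = metric ({1..n} \<times> {0..1}, intervals_dist)"

lemma Metric_space_intervals: "Metric_space ({1..n} \<times> {0..1}) intervals_dist"
  by unfold_locales (auto simp: intervals_dist_def split: if_splits)

lemma mspace_intervals_metric: "mspace (intervals_metric n) = {1..n} \<times> {0..1}"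
  and mdist_intervals_metric: "mdist (intervals_metric n) = intervals_dist"
  using Metric_space.mspace_metric[OF Metric_space_intervals]
    Metric_space.mdist_metric[OF Metric_space_intervals]
  by (simp_all add: intervals_metric_def)

definition generalized_arc_like :: "'a metric \<Rightarrow> bool" where
  "generalized_arc_like X \<longleftrightarrow>
     (\<forall>\<epsilon>>0. \<exists>\<delta>>0. \<exists>n f. eps_delta_map X (intervals_metric n) \<epsilon> \<delta> f)"


section \<open>Inverse limits of finite disjoint unions of intervals\<close>

definition inverse_limit :: "(nat \<Rightarrow> 'b topology) \<Rightarrow> (nat \<Rightarrow> 'b \<Rightarrow> 'b) \<Rightarrow> (nat \<Rightarrow> 'b) topology" where
  "inverse_limit Y f =
     subtopology (product_topology Y UNIV) {x. \<forall>i. f i (x (Suc i)) = x i}"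

definition intervals_top :: "nat \<Rightarrow> (nat \<times> real) topology" where
  "intervals_top n = sum_topology (\<lambda>_. top_of_set {0..1}) {1..n}"

text \<open>The number of copies may be \<open>0\<close>, which only matters for the empty space: an inverse limit of
  non-empty compact spaces is non-empty.\<close>

definition inverse_limit_of_intervals :: "'a topology \<Rightarrow> bool" where
  "inverse_limit_of_intervals X \<longleftrightarrow>
     (\<exists>(n :: nat \<Rightarrow> nat) f.
        (\<forall>i. continuous_map (intervals_top (n (Suc i))) (intervals_top (n i)) (f i)) \<and>
        X homeomorphic_space inverse_limit (\<lambda>i. intervals_top (n i)) f)"


section \<open>C*-algebras\<close>

text \<open>C*-algebras with explicit carriers, on top of the ring and module records of HOL-Algebra.
  They are not required to be unital: the record field \<^const>\<open>one\<close> is inherited from the ring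
  record but is never referred to.  The zero algebra is allowed.\<close>

record 'a cstar = "(complex, 'a) module" +
  star :: "'a \<Rightarrow> 'a"
  nrm :: "'a \<Rightarrow> real"

locale cstar_algebra = abelian_group A for A :: "('a, 'm) cstar_scheme" (structure) +
  assumes smult_closed: "x \<in> carrier A \<Longrightarrow> c \<odot> x \<in> carrier A"
    and smult_l_distr: "x \<in> carrier A \<Longrightarrow> (c + d) \<odot> x = c \<odot> x \<oplus> d \<odot> x"
    and smult_r_distr: "\<lbrakk>x \<in> carrier A; y \<in> carrier A\<rbrakk> \<Longrightarrow> c \<odot> (x \<oplus> y) = c \<odot> x \<oplus> c \<odot> y"
    and smult_assoc: "x \<in> carrier A \<Longrightarrow> (c * d) \<odot> x = c \<odot> (d \<odot> x)"
    and smult_one: "x \<in> carrier A \<Longrightarrow> 1 \<odot> x = x"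
    and mult_closed: "\<lbrakk>x \<in> carrier A; y \<in> carrier A\<rbrakk> \<Longrightarrow> x \<otimes> y \<in> carrier A"
    and mult_assoc: "\<lbrakk>x \<in> carrier A; y \<in> carrier A; z \<in> carrier A\<rbrakk>
      \<Longrightarrow> (x \<otimes> y) \<otimes> z = x \<otimes> (y \<otimes> z)"
    and l_distr: "\<lbrakk>x \<in> carrier A; y \<in> carrier A; z \<in> carrier A\<rbrakk>
      \<Longrightarrow> (x \<oplus> y) \<otimes> z = x \<otimes> z \<oplus> y \<otimes> z"
    and r_distr: "\<lbrakk>x \<in> carrier A; y \<in> carrier A; z \<in> carrier A\<rbrakk>
      \<Longrightarrow> x \<otimes> (y \<oplus> z) = x \<otimes> y \<oplus> x \<otimes> z"
    and smult_mult_l: "\<lbrakk>x \<in> carrier A; y \<in> carrier A\<rbrakk> \<Longrightarrow> (c \<odot> x) \<otimes> y = c \<odot> (x \<otimes> y)"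
    and smult_mult_r: "\<lbrakk>x \<in> carrier A; y \<in> carrier A\<rbrakk> \<Longrightarrow> x \<otimes> (c \<odot> y) = c \<odot> (x \<otimes> y)"
    and star_closed: "x \<in> carrier A \<Longrightarrow> star A x \<in> carrier A"
    and star_star: "x \<in> carrier A \<Longrightarrow> star A (star A x) = x"
    and star_add: "\<lbrakk>x \<in> carrier A; y \<in> carrier A\<rbrakk> \<Longrightarrow> star A (x \<oplus> y) = star A x \<oplus> star A y"
    and star_smult: "x \<in> carrier A \<Longrightarrow> star A (c \<odot> x) = cnj c \<odot> star A x"
    and star_mult: "\<lbrakk>x \<in> carrier A; y \<in> carrier A\<rbrakk> \<Longrightarrow> star A (x \<otimes> y) = star A y \<otimes> star A x"
    and nrm_nonneg: "x \<in> carrier A \<Longrightarrow> nrm A x \<ge> 0"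
    and nrm_eq_0: "x \<in> carrier A \<Longrightarrow> nrm A x = 0 \<longleftrightarrow> x = \<zero>"
    and nrm_triangle: "\<lbrakk>x \<in> carrier A; y \<in> carrier A\<rbrakk> \<Longrightarrow> nrm A (x \<oplus> y) \<le> nrm A x + nrm A y"
    and nrm_smult: "x \<in> carrier A \<Longrightarrow> nrm A (c \<odot> x) = cmod c * nrm A x"
    and nrm_mult: "\<lbrakk>x \<in> carrier A; y \<in> carrier A\<rbrakk> \<Longrightarrow> nrm A (x \<otimes> y) \<le> nrm A x * nrm A y"
    and cstar_identity: "x \<in> carrier A \<Longrightarrow> nrm A (star A x \<otimes> x) = (nrm A x)\<^sup>2"
    and complete: "\<lbrakk>\<And>n :: nat. s n \<in> carrier A;
        \<forall>e>0. \<exists>N. \<forall>m\<ge>N. \<forall>n\<ge>N. nrm A (s m \<ominus> s n) < e\<rbrakk>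
      \<Longrightarrow> \<exists>l\<in>carrier A. (\<lambda>n. nrm A (s n \<ominus> l)) \<longlonglongrightarrow> 0"

definition star_hom :: "'a cstar \<Rightarrow> 'b cstar \<Rightarrow> ('a \<Rightarrow> 'b) \<Rightarrow> bool" where
  "star_hom A B h \<longleftrightarrow>
     (\<forall>x\<in>carrier A. h x \<in> carrier B) \<and>
     (\<forall>x\<in>carrier A. \<forall>y\<in>carrier A. h (x \<oplus>\<^bsub>A\<^esub> y) = h x \<oplus>\<^bsub>B\<^esub> h y) \<and>
     (\<forall>c. \<forall>x\<in>carrier A. h (c \<odot>\<^bsub>A\<^esub> x) = c \<odot>\<^bsub>B\<^esub> h x) \<and>
     (\<forall>x\<in>carrier A. \<forall>y\<in>carrier A. h (x \<otimes>\<^bsub>A\<^esub> y) = h x \<otimes>\<^bsub>B\<^esub> h y) \<and>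
     (\<forall>x\<in>carrier A. h (star A x) = star B (h x))"

definition star_isomorphic :: "'a cstar \<Rightarrow> 'b cstar \<Rightarrow> bool" where
  "star_isomorphic A B \<longleftrightarrow> (\<exists>h. star_hom A B h \<and> bij_betw h (carrier A) (carrier B))"

definition finite_dimensional :: "'a cstar \<Rightarrow> bool" where
  "finite_dimensional A \<longleftrightarrow>
     (\<exists>S. finite S \<and> S \<subseteq> carrier A \<and>
        (\<forall>x\<in>carrier A. \<exists>c. x = (\<Oplus>\<^bsub>A\<^esub>s\<in>S. c s \<odot>\<^bsub>A\<^esub> s)))"

text \<open>\<open>C(K)\<close>.  Functions are normalised to be \<^const>\<open>undefined\<close> off \<open>K\<close>; the \<open>0\<close> inserted under
  the supremum gives the zero algebra its norm when \<open>K\<close> is empty.\<close>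

definition C_alg :: "'p topology \<Rightarrow> ('p \<Rightarrow> complex) cstar" where
  "C_alg K = \<lparr>
     carrier = {f \<in> extensional (topspace K). continuous_map K euclidean f},
     mult = \<lambda>f g. \<lambda>x\<in>topspace K. f x * g x,
     one = \<lambda>x\<in>topspace K. 1,
     zero = \<lambda>x\<in>topspace K. 0,
     add = \<lambda>f g. \<lambda>x\<in>topspace K. f x + g x,
     smult = \<lambda>c f. \<lambda>x\<in>topspace K. c * f x,
     star = \<lambda>f. \<lambda>x\<in>topspace K. cnj (f x),
     nrm = \<lambda>f. Sup (insert 0 ((\<lambda>x. cmod (f x)) ` topspace K)) \<rparr>"

lemma continuous_map_complex_mult:
  fixes f g :: "'p \<Rightarrow> complex"
  assumes "continuous_map K euclidean f" "continuous_map K euclidean g"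
  shows "continuous_map K euclidean (\<lambda>x. f x * g x)"
  using assms unfolding continuous_map_atin by (auto simp: tendsto_mult)

lemma cmod_le_nrm_C_alg:
  assumes "compact_space K" "f \<in> carrier (C_alg K)" "x \<in> topspace K"
  shows "cmod (f x) \<le> nrm (C_alg K) f"
proof -
  have "continuous_map K euclideanreal (\<lambda>x. cmod (f x))"
    using assms(2) by (auto simp: C_alg_def intro: continuous_map_norm)
  then have "compact ((\<lambda>x. cmod (f x)) ` topspace K)"
    using assms(1) image_compactin[of K "topspace K"] by (fastforce simp: compact_space_def)
  then have "bdd_above ((\<lambda>x. cmod (f x)) ` topspace K)"
    by (simp add: bounded_imp_bdd_above compact_imp_bounded)
  then show ?thesis using assms(3) by (auto simp: C_alg_def intro!: cSup_upper)
qed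

lemma nrm_C_alg_le:
  assumes "0 \<le> B" "\<And>x. x \<in> topspace K \<Longrightarrow> cmod (f x) \<le> B"
  shows "nrm (C_alg K) f \<le> B"
  using assms by (auto simp: C_alg_def intro!: cSup_least)

lemma C_alg_minus:
  assumes "abelian_group (C_alg K)" "f \<in> carrier (C_alg K)" "g \<in> carrier (C_alg K)"
  shows "f \<ominus>\<^bsub>C_alg K\<^esub> g = (\<lambda>x\<in>topspace K. f x - g x)"
proof -
  interpret abelian_group "C_alg K" by fact
  have "(\<lambda>x\<in>topspace K. - g x) \<in> carrier (C_alg K)"
    using assms(3) by (auto simp: C_alg_def intro: continuous_map_eq[of _ _ "\<lambda>x. - g x"] continuous_map_minus)
  moreover have "(\<lambda>x\<in>topspace K. - g x) \<oplus>\<^bsub>C_alg K\<^esub> g = \<zero>\<^bsub>C_alg K\<^esub>"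
    by (auto simp: C_alg_def)
  ultimately have "\<ominus>\<^bsub>C_alg K\<^esub> g = (\<lambda>x\<in>topspace K. - g x)"
    using assms(3) by (intro minus_equality)
  then show ?thesis unfolding a_minus_def by (simp only:) (auto simp: C_alg_def)
qed

lemma abelian_group_C_alg: "abelian_group (C_alg K)"
proof (rule abelian_groupI)
  fix f assume f: "f \<in> carrier (C_alg K)"
  have "(\<lambda>x\<in>topspace K. - f x) \<in> carrier (C_alg K)"
    using f by (auto simp: C_alg_def intro: continuous_map_eq[of _ _ "\<lambda>x. - f x"] continuous_map_minus)
  moreover have "(\<lambda>x\<in>topspace K. - f x) \<oplus>\<^bsub>C_alg K\<^esub> f = \<zero>\<^bsub>C_alg K\<^esub>"
    by (auto simp: C_alg_def)
  ultimately show "\<exists>g\<in>carrier (C_alg K). g \<oplus>\<^bsub>C_alg K\<^esub> f = \<zero>\<^bsub>C_alg K\<^esub>" by blast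
next
  fix f g assume "f \<in> carrier (C_alg K)" "g \<in> carrier (C_alg K)"
  then show "f \<oplus>\<^bsub>C_alg K\<^esub> g \<in> carrier (C_alg K)"
    by (auto simp: C_alg_def intro: continuous_map_eq[of _ _ "\<lambda>x. f x + g x"] continuous_map_add)
qed (auto simp: C_alg_def fun_eq_iff extensional_def algebra_simps)

lemma cstar_algebra_C_alg:
  assumes K: "compact_space K"
  shows "cstar_algebra (C_alg K)"
proof -
  interpret abelian_group "C_alg K" by (rule abelian_group_C_alg)
  note le = cmod_le_nrm_C_alg[OF K]
  have bound0: "0 \<le> nrm (C_alg K) f" if "f \<in> carrier (C_alg K)" for f
  proof -
    have "bdd_above ((\<lambda>x. cmod (f x)) ` topspace K)"
      using le[OF that] by (intro bdd_aboveI) auto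
    then show ?thesis by (auto simp: C_alg_def intro: cSup_upper)
  qed
  have smult: "c \<odot>\<^bsub>C_alg K\<^esub> f \<in> carrier (C_alg K)" if "f \<in> carrier (C_alg K)" for c f
    using that by (auto simp: C_alg_def intro: continuous_map_eq[of _ _ "\<lambda>x. c * f x"]
        continuous_map_complex_mult continuous_map_const[THEN iffD2])
  have mult: "f \<otimes>\<^bsub>C_alg K\<^esub> g \<in> carrier (C_alg K)"
    if "f \<in> carrier (C_alg K)" "g \<in> carrier (C_alg K)" for f g
    using that by (auto simp: C_alg_def intro: continuous_map_eq[of _ _ "\<lambda>x. f x * g x"]
        continuous_map_complex_mult)
  have star: "star (C_alg K) f \<in> carrier (C_alg K)" if "f \<in> carrier (C_alg K)" for f
  proof -
    have "continuous_map K euclidean (cnj \<circ> f)"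
      using that by (intro continuous_map_compose[of _ euclidean])
        (auto simp: C_alg_def intro: continuous_intros)
    then show ?thesis by (auto simp: C_alg_def intro: continuous_map_eq[of _ _ "cnj \<circ> f"])
  qed
  have scale_le: "nrm (C_alg K) (c \<odot>\<^bsub>C_alg K\<^esub> f) \<le> cmod c * nrm (C_alg K) f"
    if "f \<in> carrier (C_alg K)" for c f
    by (rule nrm_C_alg_le)
      (use that bound0 le[OF that] in \<open>auto simp: norm_mult C_alg_def intro!: mult_left_mono\<close>)
  show ?thesis
  proof (intro cstar_algebra.intro cstar_algebra_axioms.intro)
    show "abelian_group (C_alg K)" by (rule abelian_group_C_alg)
  next
    fix f assume f: "f \<in> carrier (C_alg K)"
    show "(nrm (C_alg K) f = 0) = (f = \<zero>\<^bsub>C_alg K\<^esub>)"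
    proof
      assume "nrm (C_alg K) f = 0"
      then have "f x = 0" if "x \<in> topspace K" for x using le[OF f that] by simp
      then show "f = \<zero>\<^bsub>C_alg K\<^esub>" using f by (auto simp: C_alg_def fun_eq_iff extensional_def)
    next
      assume f0: "f = \<zero>\<^bsub>C_alg K\<^esub>"
      have "nrm (C_alg K) f \<le> 0" by (rule nrm_C_alg_le) (auto simp: f0 C_alg_def)
      with bound0[OF f] show "nrm (C_alg K) f = 0" by simp
    qed
  next
    fix f c assume f: "f \<in> carrier (C_alg K)"
    show "nrm (C_alg K) (c \<odot>\<^bsub>C_alg K\<^esub> f) = cmod c * nrm (C_alg K) f"
    proof (cases "c = 0")
      case True
      then show ?thesis using scale_le[OF f, of 0] bound0[OF smult[OF f], of 0] by simp
    next
      case False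
      then have "inverse c \<odot>\<^bsub>C_alg K\<^esub> (c \<odot>\<^bsub>C_alg K\<^esub> f) = f"
        using f by (auto simp: C_alg_def fun_eq_iff extensional_def)
      then have "nrm (C_alg K) f \<le> cmod (inverse c) * nrm (C_alg K) (c \<odot>\<^bsub>C_alg K\<^esub> f)"
        using scale_le[OF smult[OF f], of "inverse c" c] by simp
      then have "cmod c * nrm (C_alg K) f \<le> nrm (C_alg K) (c \<odot>\<^bsub>C_alg K\<^esub> f)"
        using False by (simp add: norm_divide field_simps)
      with scale_le[OF f, of c] show ?thesis by simp
    qed
  next
    fix f g assume fg: "f \<in> carrier (C_alg K)" "g \<in> carrier (C_alg K)"
    show "nrm (C_alg K) (f \<oplus>\<^bsub>C_alg K\<^esub> g) \<le> nrm (C_alg K) f + nrm (C_alg K) g"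
    proof (rule nrm_C_alg_le)
      show "0 \<le> nrm (C_alg K) f + nrm (C_alg K) g" using bound0 fg by simp
      fix x assume x: "x \<in> topspace K"
      have "cmod (f x + g x) \<le> nrm (C_alg K) f + nrm (C_alg K) g"
        using norm_triangle_ineq[of "f x" "g x"] le[OF fg(1) x] le[OF fg(2) x] by linarith
      then show "cmod ((f \<oplus>\<^bsub>C_alg K\<^esub> g) x) \<le> nrm (C_alg K) f + nrm (C_alg K) g"
        using x by (simp add: C_alg_def)
    qed
    show "nrm (C_alg K) (f \<otimes>\<^bsub>C_alg K\<^esub> g) \<le> nrm (C_alg K) f * nrm (C_alg K) g"
    proof (rule nrm_C_alg_le)
      show "0 \<le> nrm (C_alg K) f * nrm (C_alg K) g" using bound0 fg by simp
      fix x assume x: "x \<in> topspace K"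
      have "cmod (f x) * cmod (g x) \<le> nrm (C_alg K) f * nrm (C_alg K) g"
        using le[OF fg(1) x] le[OF fg(2) x] bound0[OF fg(1)] by (intro mult_mono) auto
      then show "cmod ((f \<otimes>\<^bsub>C_alg K\<^esub> g) x) \<le> nrm (C_alg K) f * nrm (C_alg K) g"
        using x by (simp add: C_alg_def norm_mult)
    qed
  next
    fix f assume f: "f \<in> carrier (C_alg K)"
    let ?h = "star (C_alg K) f \<otimes>\<^bsub>C_alg K\<^esub> f"
    have h: "?h \<in> carrier (C_alg K)" by (rule mult[OF star[OF f] f])
    have hx: "cmod (?h x) = (cmod (f x))\<^sup>2" if "x \<in> topspace K" for x
      using that by (simp add: C_alg_def norm_mult power2_eq_square)
    show "nrm (C_alg K) ?h = (nrm (C_alg K) f)\<^sup>2"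
    proof (rule antisym)
      show "nrm (C_alg K) ?h \<le> (nrm (C_alg K) f)\<^sup>2"
        by (rule nrm_C_alg_le) (auto simp: hx intro: power_mono le[OF f])
      have "nrm (C_alg K) f \<le> sqrt (nrm (C_alg K) ?h)"
        by (rule nrm_C_alg_le) (use le[OF h] bound0[OF h] hx in \<open>auto intro: real_le_rsqrt\<close>)
      then have "(nrm (C_alg K) f)\<^sup>2 \<le> (sqrt (nrm (C_alg K) ?h))\<^sup>2"
        by (rule power_mono) (rule bound0[OF f])
      also have "\<dots> = nrm (C_alg K) ?h" by (rule real_sqrt_pow2) (rule bound0[OF h])
      finally show "(nrm (C_alg K) f)\<^sup>2 \<le> nrm (C_alg K) ?h" .
    qed
  next
    fix s :: "nat \<Rightarrow> 'a \<Rightarrow> complex"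
    assume s: "\<And>n. s n \<in> carrier (C_alg K)"
      and Cau: "\<forall>e>0. \<exists>N. \<forall>m\<ge>N. \<forall>n\<ge>N. nrm (C_alg K) (s m \<ominus>\<^bsub>C_alg K\<^esub> s n) < e"
    have dist_le: "cmod (s m x - s n x) \<le> nrm (C_alg K) (s m \<ominus>\<^bsub>C_alg K\<^esub> s n)"
      if "x \<in> topspace K" for m n x
      using le[OF minus_closed[OF s s] that, of m n] that
      by (simp add: C_alg_minus[OF abelian_group_C_alg s s])
    have ucau: "uniformly_Cauchy_on (topspace K) s"
      unfolding uniformly_Cauchy_on_def dist_norm using Cau dist_le by (meson le_less_trans)
    then obtain l where l: "uniform_limit (topspace K) s l sequentially"
      using Cauchy_uniformly_convergent unfolding uniformly_convergent_on_def by blast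
    define l' where "l' = restrict l (topspace K)"
    have lim: "\<forall>\<^sub>F n in sequentially. \<forall>x\<in>topspace K. dist (s n x) (l' x) < e" if "e > 0" for e
      using uniform_limitD[OF l that] by (simp add: l'_def)
    have "continuous_map K Met_TC.mtopology l'"
      by (rule Met_TC.continuous_map_uniform_limit[where F = sequentially and f = s])
        (use s lim in \<open>auto simp: C_alg_def dist_commute\<close>)
    then have l'C: "l' \<in> carrier (C_alg K)" by (simp add: C_alg_def l'_def)
    have "(\<lambda>n. nrm (C_alg K) (s n \<ominus>\<^bsub>C_alg K\<^esub> l')) \<longlonglongrightarrow> 0"
    proof (rule tendstoI)
      fix e :: real assume "e > 0"
      then have "\<forall>\<^sub>F n in sequentially. \<forall>x\<in>topspace K. dist (s n x) (l' x) < e/2"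
        by (intro lim) simp
      then show "\<forall>\<^sub>F n in sequentially. dist (nrm (C_alg K) (s n \<ominus>\<^bsub>C_alg K\<^esub> l')) 0 < e"
      proof eventually_elim
        case (elim n)
        have "nrm (C_alg K) (s n \<ominus>\<^bsub>C_alg K\<^esub> l') \<le> e/2"
          by (rule nrm_C_alg_le)
            (use \<open>e > 0\<close> elim in \<open>auto simp: C_alg_minus[OF abelian_group_C_alg s l'C] dist_norm intro: less_imp_le\<close>)
        with bound0[OF minus_closed[OF s l'C], of n] \<open>e > 0\<close> show ?case by simp
      qed
    qed
    with l'C show "\<exists>l\<in>carrier (C_alg K). (\<lambda>n. nrm (C_alg K) (s n \<ominus>\<^bsub>C_alg K\<^esub> l)) \<longlonglongrightarrow> 0"
      by blast
  qed (use smult mult star bound0 in \<open>auto simp: C_alg_def fun_eq_iff extensional_def algebra_simps\<close>)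
qed


section \<open>Tensor products and inductive limits\<close>

definition lin_indep :: "'a cstar \<Rightarrow> nat \<Rightarrow> (nat \<Rightarrow> 'a) \<Rightarrow> bool" where
  "lin_indep A n b \<longleftrightarrow>
     (\<forall>c. (\<Oplus>\<^bsub>A\<^esub>i\<in>{..<n}. c i \<odot>\<^bsub>A\<^esub> b i) = \<zero>\<^bsub>A\<^esub> \<longrightarrow> (\<forall>i<n. c i = 0))"

text \<open>\<open>T\<close>, with elementary tensors \<open>\<tau> a b\<close>, is the completion of the algebraic tensor product of
  \<open>A\<close> and \<open>B\<close> (with its *-algebra structure) in a C*-norm: \<open>\<tau>\<close> is bilinear, the induced
  *-homomorphism from the algebraic tensor product is injective (\<open>inj\<close>), and its range is dense
  (\<open>dense\<close>).  If \<open>B\<close> is finite dimensional, the only case used, the C*-norm is unique, so that this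
  determines \<open>A \<otimes> B\<close> up to isomorphism.\<close>

locale cstar_tensor =
  fixes A :: "'a cstar" and B :: "'b cstar" and T :: "'t cstar" and \<tau> :: "'a \<Rightarrow> 'b \<Rightarrow> 't"
  assumes cstar: "cstar_algebra T"
    and closed: "\<lbrakk>a \<in> carrier A; b \<in> carrier B\<rbrakk> \<Longrightarrow> \<tau> a b \<in> carrier T"
    and add_left: "\<lbrakk>a \<in> carrier A; a' \<in> carrier A; b \<in> carrier B\<rbrakk>
      \<Longrightarrow> \<tau> (a \<oplus>\<^bsub>A\<^esub> a') b = \<tau> a b \<oplus>\<^bsub>T\<^esub> \<tau> a' b"
    and add_right: "\<lbrakk>a \<in> carrier A; b \<in> carrier B; b' \<in> carrier B\<rbrakk>
      \<Longrightarrow> \<tau> a (b \<oplus>\<^bsub>B\<^esub> b') = \<tau> a b \<oplus>\<^bsub>T\<^esub> \<tau> a b'"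
    and smult_left: "\<lbrakk>a \<in> carrier A; b \<in> carrier B\<rbrakk> \<Longrightarrow> \<tau> (c \<odot>\<^bsub>A\<^esub> a) b = c \<odot>\<^bsub>T\<^esub> \<tau> a b"
    and smult_right: "\<lbrakk>a \<in> carrier A; b \<in> carrier B\<rbrakk> \<Longrightarrow> \<tau> a (c \<odot>\<^bsub>B\<^esub> b) = c \<odot>\<^bsub>T\<^esub> \<tau> a b"
    and mult: "\<lbrakk>a \<in> carrier A; a' \<in> carrier A; b \<in> carrier B; b' \<in> carrier B\<rbrakk>
      \<Longrightarrow> \<tau> a b \<otimes>\<^bsub>T\<^esub> \<tau> a' b' = \<tau> (a \<otimes>\<^bsub>A\<^esub> a') (b \<otimes>\<^bsub>B\<^esub> b')"
    and star: "\<lbrakk>a \<in> carrier A; b \<in> carrier B\<rbrakk> \<Longrightarrow> star T (\<tau> a b) = \<tau> (star A a) (star B b)"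
    and inj: "\<lbrakk>\<forall>i<n. u i \<in> carrier A; \<forall>i<n. v i \<in> carrier B; lin_indep B n v;
        (\<Oplus>\<^bsub>T\<^esub>i\<in>{..<n}. \<tau> (u i) (v i)) = \<zero>\<^bsub>T\<^esub>\<rbrakk> \<Longrightarrow> \<forall>i<n. u i = \<zero>\<^bsub>A\<^esub>"
    and dense: "\<lbrakk>t \<in> carrier T; 0 < e\<rbrakk>
      \<Longrightarrow> \<exists>(n :: nat) u v. (\<forall>i<n. u i \<in> carrier A) \<and> (\<forall>i<n. v i \<in> carrier B) \<and>
            nrm T (t \<ominus>\<^bsub>T\<^esub> (\<Oplus>\<^bsub>T\<^esub>i\<in>{..<n}. \<tau> (u i) (v i))) < e"

text \<open>The composite \<open>A\<^sub>n \<rightarrow> A\<^sub>n\<^sub>+\<^sub>k\<close> of the connecting maps \<open>\<phi>\<^sub>i : A\<^sub>i \<rightarrow> A\<^sub>i\<^sub>+\<^sub>1\<close>.\<close>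

primrec connecting :: "(nat \<Rightarrow> 'a \<Rightarrow> 'a) \<Rightarrow> nat \<Rightarrow> nat \<Rightarrow> 'a \<Rightarrow> 'a" where
  "connecting \<phi> n 0 x = x"
| "connecting \<phi> n (Suc k) x = \<phi> (n + k) (connecting \<phi> n k x)"

text \<open>\<open>L\<close>, with canonical maps \<open>\<mu>\<^sub>n : A\<^sub>n \<rightarrow> L\<close>, is the inductive limit of
  \<open>A\<^sub>0 \<rightarrow> A\<^sub>1 \<rightarrow> \<dots>\<close>: the completion of the algebraic direct limit (modulo null
  vectors) in its C*-seminorm, which is \<open>lim\<^sub>k \<parallel>\<phi>\<^sub>n\<^sub>,\<^sub>n\<^sub>+\<^sub>k(x)\<parallel>\<close> on the class of \<open>x \<in> A\<^sub>n\<close>.\<close>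

locale cstar_inductive_limit =
  fixes A :: "nat \<Rightarrow> 'a cstar" and \<phi> :: "nat \<Rightarrow> 'a \<Rightarrow> 'a"
    and L :: "'l cstar" and \<mu> :: "nat \<Rightarrow> 'a \<Rightarrow> 'l"
  assumes cstar_A: "cstar_algebra (A n)"
    and hom_\<phi>: "star_hom (A n) (A (Suc n)) (\<phi> n)"
    and cstar_L: "cstar_algebra L"
    and hom_\<mu>: "star_hom (A n) L (\<mu> n)"
    and compatible: "x \<in> carrier (A n) \<Longrightarrow> \<mu> (Suc n) (\<phi> n x) = \<mu> n x"
    and isometric: "x \<in> carrier (A n)
      \<Longrightarrow> (\<lambda>k. nrm (A (n + k)) (connecting \<phi> n k x)) \<longlonglongrightarrow> nrm L (\<mu> n x)"
    and dense: "\<lbrakk>y \<in> carrier L; 0 < e\<rbrakk>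
      \<Longrightarrow> \<exists>n. \<exists>x\<in>carrier (A n). nrm L (y \<ominus>\<^bsub>L\<^esub> \<mu> n x) < e"

text \<open>HOL cannot quantify over types inside a formula, so the carriers are taken in fixed types that
  are large enough: every finite-dimensional C*-algebra \<open>F\<close> has an isomorphic copy on a set of
  functions \<^typ>\<open>nat \<Rightarrow> complex\<close> (coordinates in a basis), and \<open>C[0,1] \<otimes> F\<close>, being isomorphic
  to \<open>C([0,1], F)\<close>, has one on a set of functions \<^typ>\<open>real \<Rightarrow> nat \<Rightarrow> complex\<close>.  Similarly the limit
  \<open>L\<close>, being isomorphic to \<open>A\<close>, may be taken in the carrier type of \<open>A\<close>.\<close>

definition AI_algebra :: "'a cstar \<Rightarrow> bool" where
  "AI_algebra A \<longleftrightarrow> cstar_algebra A \<and>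
     (\<exists>(F :: nat \<Rightarrow> (nat \<Rightarrow> complex) cstar) (T :: nat \<Rightarrow> (real \<Rightarrow> nat \<Rightarrow> complex) cstar) \<tau> \<phi>
        (L :: 'a cstar) \<mu>.
        (\<forall>n. cstar_algebra (F n) \<and> finite_dimensional (F n) \<and>
             cstar_tensor (C_alg (top_of_set {0..1::real})) (F n) (T n) (\<tau> n)) \<and>
        cstar_inductive_limit T \<phi> L \<mu> \<and>
        star_isomorphic A L)"

end

theory Submission
  imports Defs
begin

text \<open>
  The pivot is the condition that for every \<open>e > 0\<close> there is a continuous \<open>f : X \<rightarrow> \<real>\<close> all of whose
  fibres have diameter less than \<open>e\<close>; since a finite disjoint union of intervals embeds in \<open>\<real>\<close>, real
  values suffice.  By compactness such an \<open>f\<close> also has small preimages of small sets, which links the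
  condition to (i), by pulling back intervals one way and by averaging indices with a partition of
  unity the other way, and to (ii).

  Given functions \<open>P\<^sub>n\<close> with ever smaller fibres, \<open>P\<^sub>n\<close> factors approximately through a rescaled
  \<open>P\<^sub>n\<^sub>+\<^sub>1\<close> via a 1-Lipschitz map \<open>F\<^sub>n : \<real> \<rightarrow> \<real>\<close>; the limits \<open>q\<^sub>n\<close> of \<open>F\<^sub>n \<dots> F\<^sub>n\<^sub>+\<^sub>k\<^sub>-\<^sub>1 P\<^sub>n\<^sub>+\<^sub>k\<close> identify \<open>X\<close>
  with the inverse limit of small closed neighbourhoods of the sets \<open>P\<^sub>n(X)\<close>, which are finite unions of
  intervals.  This gives (iii), and dualising gives (iv), where density is again approximate
  factorisation.  Conversely, a point of an inverse limit, up to a small error, is determined by one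
  coordinate.

  For (iv), each \<open>x \<in> X\<close> induces a character of every \<open>C[0,1] \<otimes> F\<close> in the inductive system.
  It is a point evaluation times a character of \<open>F\<close>, and \<open>F\<close> has only finitely many characters, so it is
  determined by a real parameter depending continuously on \<open>x\<close>.  At a late stage of the system these
  characters separate points at distance at least \<open>e\<close>.
\<close>

section \<open>Functions with small fibres\<close>

text \<open>Exact fibres are easy to produce, while the arguments use uniform estimates;
  \<open>compact_relations_small\<close> bridges the two every time, applied to the relations of
  nearly equal values, of equal coordinates at stage i and of equal characters at stage n. Two
  obstacles shape the way to (iii). The image of \<open>P n\<close> can have infinitely many
  components (it may be a Cantor set), which forces the thickening. And \<open>P n\<close> agrees
  with \<open>F n\<close> after \<open>P (Suc n)\<close> only up to \<open>\<eta> n\<close>; since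
  \<open>\<eta>\<close> at least halves at each stage, making the system exact moves
  \<open>P n\<close> by at most \<open>2 * \<eta> n\<close>. The other constants follow: radius
  \<open>4 * \<eta> n\<close> for the thickening, and separation at \<open>6 * \<eta> n\<close>,
  safely above the \<open>4 * \<eta> n\<close> that two corrections can cost. Two more shape (iv).
  The projections of X to the stages need not be onto, so a function at one stage gets its norm in
  C(X) only in the limit.\<close>

lemma Hausdorff_space_top_of_set: "Hausdorff_space (top_of_set (S :: 'a::t2_space set))"
  by (rule Hausdorff_space_subtopology) (simp add: Hausdorff_space_def disjnt_def separation_t2)

text \<open>The identity is a continuous bijection from a compact space to a Hausdorff space, hence
  a homeomorphism, which for the identity means equality of topologies. Continuity on the sum can
  then be checked with \<open>continuous_on\<close>.\<close>

lemma intervals_top_eq: "intervals_top n = top_of_set ({1..n} \<times> {0..1})"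
proof -
  have comp: "compact_space (intervals_top n)"
  proof -
    have "compactin (intervals_top n) (\<Union>i\<in>{1..n}. Pair i ` {0..1})"
    proof (rule compactin_Union)
      fix S assume "S \<in> (\<lambda>i. Pair i ` {0..1::real}) ` {1..n}"
      then obtain i where i: "i \<in> {1..n}" "S = Pair i ` {0..1}" by auto
      show "compactin (intervals_top n) S"
        unfolding i(2) intervals_top_def
        by (rule image_compactin[OF _ continuous_map_component_injection[OF i(1)]])
          (simp add: compactin_subtopology)
    qed simp
    moreover have "(\<Union>i\<in>{1..n}. Pair i ` {0..1::real}) = topspace (intervals_top n)"
      by (auto simp: intervals_top_def)
    ultimately show ?thesis by (simp add: compact_space_def)
  qed
  have cont: "continuous_map (intervals_top n) (top_of_set ({1..n} \<times> {0..1})) (\<lambda>x. x)"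
    unfolding continuous_map_def
  proof (intro conjI allI impI)
    fix U assume U: "openin (top_of_set ({1..n} \<times> {0..1::real})) U"
    then have sub: "U \<subseteq> {1..n} \<times> {0..1}" using openin_imp_subset by blast
    then have eq: "{x \<in> topspace (intervals_top n). x \<in> U} = U"
      by (auto simp: intervals_top_def)
    have "openin (top_of_set {0..1}) {t. (i, t) \<in> U}" if "i \<in> {1..n}" for i
    proof -
      obtain V where V: "open V" "U = ({1..n} \<times> {0..1}) \<inter> V"
        using U by (auto simp: openin_open)
      have "open (Pair i -` V)"
        by (intro open_vimage V) (auto intro: continuous_intros)
      moreover have "{t. (i, t) \<in> U} = {0..1} \<inter> (Pair i -` V)"
        using V that by auto
      ultimately show ?thesis by (auto simp: openin_open)
    qed
    with sub show "openin (intervals_top n) {x \<in> topspace (intervals_top n). x \<in> U}"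
      unfolding eq by (auto simp: intervals_top_def openin_sum_topology)
  qed (auto simp: intervals_top_def)
  have "homeomorphic_map (intervals_top n) (top_of_set ({1..n} \<times> {0..1})) (\<lambda>x. x)"
    by (rule continuous_imp_homeomorphic_map[OF cont comp])
      (auto simp: intervals_top_def Hausdorff_space_top_of_set)
  then show ?thesis
    using homeomorphic_map_id unfolding id_def by metis
qed

lemma compact_space_intervals_top [simp]: "compact_space (intervals_top n)"
  unfolding intervals_top_eq
  by (rule compact_space_subtopology) (simp add: compact_Times finite_imp_compact)

lemma Hausdorff_space_intervals_top [simp]: "Hausdorff_space (intervals_top n)"
  unfolding intervals_top_eq by (rule Hausdorff_space_top_of_set)

lemma topspace_intervals_top [simp]: "topspace (intervals_top n) = {1..n} \<times> {0..1}"
  by (simp add: intervals_top_eq)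

text \<open>The factor 2 puts copy i onto [2i, 2i + 1], so distinct copies keep a gap of length at
  least 1 in the line.\<close>

definition interval_code :: "nat \<times> real \<Rightarrow> real" where
  "interval_code p = 2 * real (fst p) + snd p"

lemma interval_code_inj: "inj_on interval_code (A \<times> {0..1})"
proof (rule inj_onI)
  fix p q :: "nat \<times> real"
  assume pq: "p \<in> A \<times> {0..1}" "q \<in> A \<times> {0..1}" "interval_code p = interval_code q"
  obtain i s j t where eq: "p = (i, s)" "q = (j, t)" by (cases p, cases q) auto
  have *: "0 \<le> s" "s \<le> 1" "0 \<le> t" "t \<le> 1" "2 * real i + s = 2 * real j + t"
    using pq by (auto simp: eq interval_code_def)
  have "\<not> real i + 1 \<le> real j" "\<not> real j + 1 \<le> real i" using * by auto
  then have "i = j" by linarith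
  with * show "p = q" by (simp add: eq)
qed

lemma continuous_on_fst_nat:
  fixes c :: "nat \<Rightarrow> 'b::topological_space" and S :: "(nat \<times> 'c::topological_space) set"
  shows "continuous_on S (\<lambda>p. c (fst p))"
proof -
  have "continuous_on UNIV c" by (simp add: continuous_on_discrete)
  then show ?thesis by (rule continuous_on_compose2) (auto intro: continuous_intros)
qed

lemma continuous_interval_code: "continuous_map (intervals_top n) euclideanreal interval_code"
  unfolding intervals_top_eq interval_code_def
  by (auto intro!: continuous_intros continuous_on_fst_nat)

section \<open>Compactness: from exact fibres to uniform estimates\<close>

lemma mdist_eq_0_iff: "\<lbrakk>x \<in> mspace X; y \<in> mspace X\<rbrakk> \<Longrightarrow> mdist X x y = 0 \<longleftrightarrow> x = y"
  by (rule Metric_space.zero[OF Metric_space_mspace_mdist])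

text \<open>The pairs at distance at least e form a closed set \<open>D\<close> in the compact
  square. If every \<open>R n\<close> met \<open>D\<close>, the nested closed sets
  \<open>R n \<inter> D\<close> would have a common point, contradicting
  \<open>small\<close>.\<close>

lemma compact_relations_small:
  fixes X :: "'a metric"
  assumes X: "compact_space (mtopology_of X)"
    and closed: "\<And>n. closedin (prod_topology (mtopology_of X) (mtopology_of X)) (R n)"
    and dec: "\<And>n :: nat. R (Suc n) \<subseteq> R n"
    and small: "\<And>x y. (\<And>n. (x, y) \<in> R n) \<Longrightarrow> mdist X x y < e"
  obtains n where "\<And>x y. (x, y) \<in> R n \<Longrightarrow> mdist X x y < e"
proof -
  let ?XX = "prod_topology (mtopology_of X) (mtopology_of X)"
  define D where "D = {p \<in> topspace ?XX. mdist X (fst p) (snd p) \<in> {e..}}"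
  have D: "closedin ?XX D"
    unfolding D_def
    by (rule closedin_continuous_map_preimage[where Y = euclideanreal])
      (auto intro!: continuous_map_mdist continuous_map_fst continuous_map_snd)
  have "\<exists>n. R n \<inter> D = {}"
  proof (rule ccontr)
    assume ne: "\<nexists>n. R n \<inter> D = {}"
    have "(\<Inter>n. R n \<inter> D) \<noteq> {}"
    proof (rule compact_space_imp_nest[of ?XX])
      show "compact_space ?XX" using X by (simp add: compact_space_prod_topology)
      show "decseq (\<lambda>n. R n \<inter> D)" using dec by (intro decseq_SucI) auto
    qed (use ne D closed in auto)
    then obtain p where "\<And>n. p \<in> R n" "p \<in> D" by auto
    with small[of "fst p" "snd p"] show False by (auto simp: D_def)
  qed
  then obtain n where n: "R n \<inter> D = {}" by blast
  have "mdist X x y < e" if "(x, y) \<in> R n" for x y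
    using n that closedin_subset[OF closed[of n]] by (auto simp: D_def)
  then show ?thesis using that by blast
qed

definition real_embeddable_up_to :: "'a metric \<Rightarrow> real \<Rightarrow> ('a \<Rightarrow> real) \<Rightarrow> bool" where
  "real_embeddable_up_to X e f \<longleftrightarrow> continuous_map (mtopology_of X) euclideanreal f \<and>
     (\<forall>x\<in>mspace X. \<forall>y\<in>mspace X. f x = f y \<longrightarrow> mdist X x y < e)"

text \<open>The relations \<bar>f x - f y\<bar> \<le> 1 / (n + 1) are closed, decrease, and
  intersect in the relation f x = f y, whose pairs are e-close by assumption.\<close>

lemma small_fibres_uniform:
  fixes X :: "'a metric"
  assumes X: "compact_space (mtopology_of X)" and f: "real_embeddable_up_to X e f"
  obtains d where "d > 0"
    "\<And>x y. \<lbrakk>x \<in> mspace X; y \<in> mspace X; \<bar>f x - f y\<bar> < d\<rbrakk> \<Longrightarrow> mdist X x y < e"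
proof -
  let ?XX = "prod_topology (mtopology_of X) (mtopology_of X)"
  have cf: "continuous_map (mtopology_of X) euclideanreal f"
    using f by (simp add: real_embeddable_up_to_def)
  define R where "R n = {p \<in> topspace ?XX. \<bar>f (fst p) - f (snd p)\<bar> \<in> {..1 / real (Suc n)}}" for n
  obtain n where n: "\<And>x y. (x, y) \<in> R n \<Longrightarrow> mdist X x y < e"
  proof (rule compact_relations_small[OF X, of R e])
    fix n
    show "closedin ?XX (R n)"
      unfolding R_def
    proof (rule closedin_continuous_map_preimage[where Y = euclideanreal])
      have "continuous_map ?XX euclideanreal (\<lambda>p. f (fst p))" "continuous_map ?XX euclideanreal (\<lambda>p. f (snd p))"
        using cf continuous_map_compose[OF continuous_map_fst cf] continuous_map_compose[OF continuous_map_snd cf]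
        by (auto simp: o_def)
      then show "continuous_map ?XX euclideanreal (\<lambda>p. \<bar>f (fst p) - f (snd p)\<bar>)"
        by (intro continuous_map_real_abs continuous_map_diff)
    qed simp
    have "1 / (2 + real n) \<le> 1 / (1 + real n)" by (simp add: field_simps)
    then show "R (Suc n) \<subseteq> R n" unfolding R_def by (auto simp: add_ac)
  next
    fix x y assume *: "\<And>n. (x, y) \<in> R n"
    then have le: "\<bar>f x - f y\<bar> \<le> 1 / real (Suc n)" for n by (simp add: R_def)
    have "f x = f y"
    proof (rule ccontr)
      assume "f x \<noteq> f y"
      then have "0 < \<bar>f x - f y\<bar>" by simp
      then obtain n where "inverse (real (Suc n)) < \<bar>f x - f y\<bar>" using reals_Archimedean by blast
      with le[of n] show False by (simp add: inverse_eq_divide)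
    qed
    with *[of 0] f show "mdist X x y < e" by (auto simp: R_def real_embeddable_up_to_def)
  qed blast
  show ?thesis
    by (rule that[of "1 / real (Suc n)"]) (auto intro!: n simp: R_def)
qed

section \<open>Diameters, bounds and cozero functions\<close>

lemma mdist_le_mdiameter:
  assumes "\<And>x y. \<lbrakk>x \<in> S; y \<in> S\<rbrakk> \<Longrightarrow> mdist X x y \<le> c" "x \<in> S" "y \<in> S"
  shows "mdist X x y \<le> mdiameter X S"
proof -
  have "bdd_above ((\<lambda>(x, y). mdist X x y) ` (S \<times> S))"
    using assms(1) by (intro bdd_aboveI[of _ c]) auto
  then have "(\<lambda>(x, y). mdist X x y) (x, y) \<le> (SUP (x,y)\<in>S\<times>S. mdist X x y)"
    using assms(2,3) by (intro cSUP_upper) auto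
  with assms(2) show ?thesis by (auto simp: mdiameter_def)
qed

lemma mdiameter_le:
  assumes "0 \<le> c" "\<And>x y. \<lbrakk>x \<in> S; y \<in> S\<rbrakk> \<Longrightarrow> mdist X x y \<le> c"
  shows "mdiameter X S \<le> c"
  using assms by (auto simp: mdiameter_def intro!: cSUP_least)

lemma compact_space_mdist_bounded:
  assumes X: "compact_space (mtopology_of X)"
  obtains c where "\<And>x y. \<lbrakk>x \<in> mspace X; y \<in> mspace X\<rbrakk> \<Longrightarrow> mdist X x y \<le> c"
proof -
  let ?XX = "prod_topology (mtopology_of X) (mtopology_of X)"
  have 1: "continuous_map ?XX euclideanreal (\<lambda>p. mdist X (fst p) (snd p))"
    by (intro continuous_map_mdist continuous_map_fst continuous_map_snd)
  have 2: "compactin ?XX (topspace ?XX)"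
    using X by (simp only: compact_space_def[symmetric] compact_space_prod_topology) simp
  have "compact ((\<lambda>p. mdist X (fst p) (snd p)) ` topspace ?XX)"
    using image_compactin[OF 2 1] by simp
  then have "bdd_above ((\<lambda>p. mdist X (fst p) (snd p)) ` topspace ?XX)"
    by (intro bounded_imp_bdd_above compact_imp_bounded)
  then obtain c where c: "\<forall>p\<in>topspace ?XX. mdist X (fst p) (snd p) \<le> c"
    unfolding bdd_above_def by auto
  show ?thesis by (rule that[of c]) (use c in auto)
qed

lemma compact_space_real_bounded:
  assumes "compact_space X" "continuous_map X euclideanreal f"
  obtains M where "M > 0" "\<And>x. x \<in> topspace X \<Longrightarrow> \<bar>f x\<bar> < M"
proof -
  have "compact (f ` topspace X)"
    using image_compactin[OF assms(1)[unfolded compact_space_def] assms(2)] by simp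
  then obtain c where c: "\<forall>x\<in>topspace X. \<bar>f x\<bar> \<le> c"
    by (auto dest!: compact_imp_bounded simp: bounded_iff)
  show ?thesis
  proof (rule that[of "\<bar>c\<bar> + 1"])
    fix x assume "x \<in> topspace X"
    with c have "\<bar>f x\<bar> \<le> c" by blast
    then show "\<bar>f x\<bar> < \<bar>c\<bar> + 1" by linarith
  qed simp
qed

text \<open>The distance to the complement is 1-Lipschitz and positive exactly on \<open>U\<close>.
  The case where the complement is empty is separate, because an infimum over the empty set is
  unspecified.\<close>

lemma open_set_cozero:
  fixes X :: "'a metric"
  assumes U: "openin (mtopology_of X) U"
  obtains \<phi> where "continuous_map (mtopology_of X) euclideanreal \<phi>"
    "\<And>x. x \<in> mspace X \<Longrightarrow> 0 \<le> \<phi> x" "\<And>x. x \<in> mspace X \<Longrightarrow> 0 < \<phi> x \<longleftrightarrow> x \<in> U"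
proof (cases "mspace X \<subseteq> U")
  case True
  show ?thesis by (rule that[of "\<lambda>x. 1"]) (use True in auto)
next
  case False
  interpret Metric_space "mspace X" "mdist X" by (rule Metric_space_mspace_mdist)
  define D where "D = mspace X - U"
  define \<phi> where "\<phi> x = (INF y\<in>D. mdist X x y)" for x
  have D: "D \<noteq> {}" "D \<subseteq> mspace X" using False by (auto simp: D_def)
  have bdd: "bdd_below ((\<lambda>y. mdist X x y) ` D)" for x
    by (intro bdd_belowI[of _ 0]) auto
  have lip: "\<phi> x \<le> \<phi> y + mdist X x y" if "x \<in> mspace X" "y \<in> mspace X" for x y
  proof -
    have "\<phi> x - mdist X x y \<le> mdist X y z" if "z \<in> D" for z
    proof -
      have "\<phi> x \<le> mdist X x z" unfolding \<phi>_def by (rule cINF_lower[OF bdd that])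
      also have "\<dots> \<le> mdist X x y + mdist X y z"
        using D that \<open>x \<in> mspace X\<close> \<open>y \<in> mspace X\<close> by (intro triangle) auto
      finally show ?thesis by simp
    qed
    then have "\<phi> x - mdist X x y \<le> \<phi> y"
      unfolding \<phi>_def[of y] by (intro cINF_greatest D)
    then show ?thesis by simp
  qed
  have nonneg: "0 \<le> \<phi> x" for x unfolding \<phi>_def by (intro cINF_greatest D) auto
  show ?thesis
  proof (rule that[of \<phi>])
    have "continuous_map (mtopology_of X) (mtopology_of euclidean_metric) \<phi>"
      unfolding mtopology_of_def
    proof (subst metric_continuous_map[OF Metric_space_mspace_mdist], intro conjI ballI allI impI)
      fix a and e :: real assume a: "a \<in> mspace X" and e: "0 < e"
      have "dist (\<phi> a) (\<phi> x) < e" if "x \<in> mspace X" "mdist X a x < e" for x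
        using lip[of a x] lip[of x a] a that commute[of a x] by (simp add: dist_real_def)
      then show "\<exists>d>0. \<forall>x. x \<in> mspace X \<and> mdist X a x < d \<longrightarrow> mdist euclidean_metric (\<phi> a) (\<phi> x) < e"
        using e by auto
    qed auto
    then show "continuous_map (mtopology_of X) euclideanreal \<phi>" by simp
    show "0 < \<phi> x \<longleftrightarrow> x \<in> U" if x: "x \<in> mspace X" for x
    proof
      assume "0 < \<phi> x"
      show "x \<in> U"
      proof (rule ccontr)
        assume "x \<notin> U"
        with x have "x \<in> D" by (simp add: D_def)
        then have "\<phi> x \<le> mdist X x x" unfolding \<phi>_def by (rule cINF_lower[OF bdd])
        with \<open>0 < \<phi> x\<close> x show False by simp
      qed
    next
      assume "x \<in> U"
      then obtain r where r: "r > 0" "mball x r \<subseteq> U"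
        using U by (auto simp: mtopology_of_def openin_mtopology)
      have "r \<le> mdist X x y" if "y \<in> D" for y
      proof (rule ccontr)
        assume "\<not> r \<le> mdist X x y"
        then have "y \<in> mball x r" using x that D by (auto simp: in_mball)
        with r(2) that show False by (auto simp: D_def)
      qed
      then have "r \<le> \<phi> x" unfolding \<phi>_def by (intro cINF_greatest D)
      with r show "0 < \<phi> x" by simp
    qed
  qed (rule nonneg)
qed

section \<open>Almost chains and real functions with small fibres\<close>

lemma real_embeddable_if_almost_chainable:
  fixes X :: "'a metric"
  assumes X: "compact_space (mtopology_of X)" and "almost_chainable X" "e > 0"
  shows "\<exists>f. real_embeddable_up_to X e f"
proof -
  obtain k C where chain: "almost_chain X k C" and mesh: "mesh X k C < e"
    and cover: "(\<Union>i\<in>{1..k}. C i) = mspace X"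
    using assms(2)[unfolded almost_chainable_def, rule_format, OF assms(3)] by blast
  have op: "openin (mtopology_of X) (C i)" if "i \<in> {1..k}" for i
    using chain that by (auto simp: almost_chain_def)
  have disj: "C i \<inter> C j = {}" if "i \<in> {1..k}" "j \<in> {1..k}" "i + 2 \<le> j" for i j
  proof -
    have "\<bar>int i - int j\<bar> \<ge> 2" using that(3) by simp
    with chain that(1,2) show ?thesis unfolding almost_chain_def by blast
  qed
  have "\<exists>\<phi>. continuous_map (mtopology_of X) euclideanreal \<phi> \<and>
      (\<forall>x\<in>mspace X. 0 \<le> \<phi> x \<and> (0 < \<phi> x \<longleftrightarrow> x \<in> C i))" if "i \<in> {1..k}" for i
    using open_set_cozero[OF op[OF that]] by metis
  then obtain \<phi> where \<phi>: "\<And>i. i \<in> {1..k} \<Longrightarrow> continuous_map (mtopology_of X) euclideanreal (\<phi> i)"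
    "\<And>i x. i \<in> {1..k} \<Longrightarrow> x \<in> mspace X \<Longrightarrow> 0 \<le> \<phi> i x"
    "\<And>i x. i \<in> {1..k} \<Longrightarrow> x \<in> mspace X \<Longrightarrow> 0 < \<phi> i x \<longleftrightarrow> x \<in> C i"
    by metis
  define s where "s x = (\<Sum>i\<in>{1..k}. \<phi> i x)" for x
  define f where "f x = (\<Sum>i\<in>{1..k}. real i * \<phi> i x) / s x" for x
  have s_pos: "s x > 0" if x: "x \<in> mspace X" for x
  proof -
    obtain i where "i \<in> {1..k}" "x \<in> C i" using cover x by blast
    then show ?thesis unfolding s_def using \<phi> x by (intro sum_pos2[of _ i]) auto
  qed
  \<comment> \<open>Let i be the least index with x in \<open>C i\<close>. Only i and i + 1 can
    carry weight at x, and i does, so the average index satisfies i \<le> f x < i + 1 and its floor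
    recovers i. Points with equal values thus share a link.\<close>
  have key: "nat \<lfloor>f x\<rfloor> \<in> {1..k} \<and> x \<in> C (nat \<lfloor>f x\<rfloor>)" if x: "x \<in> mspace X" for x
  proof -
    have zero: "\<phi> j x = 0" if "j \<in> {1..k}" "x \<notin> C j" for j
      using \<phi>(2)[OF that(1) x] \<phi>(3)[OF that(1) x] that(2) by linarith
    have ex: "\<exists>i. i \<in> {1..k} \<and> x \<in> C i" using cover x by blast
    define i where "i = (LEAST i. i \<in> {1..k} \<and> x \<in> C i)"
    have i: "i \<in> {1..k}" "x \<in> C i" unfolding i_def using LeastI_ex[OF ex] by auto
    have least: "i \<le> j" if "j \<in> {1..k}" "x \<in> C j" for j
      unfolding i_def using that by (intro Least_le) auto
    have near: "j = i \<or> j = Suc i" if "j \<in> {1..k}" "\<phi> j x \<noteq> 0" for j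
    proof -
      have "x \<in> C j" using zero that by blast
      with disj[OF i(1) that(1)] i(2) have "\<not> i + 2 \<le> j" by blast
      with least[OF that(1) \<open>x \<in> C j\<close>] show ?thesis by auto
    qed
    have pos: "0 < \<phi> i x" using \<phi>(3) i x by blast
    have "(\<Sum>j\<in>{1..k}. real i * \<phi> j x) \<le> (\<Sum>j\<in>{1..k}. real j * \<phi> j x)"
    proof (intro sum_mono)
      fix j assume j: "j \<in> {1..k}"
      show "real i * \<phi> j x \<le> real j * \<phi> j x"
        using near[OF j] \<phi>(2)[OF j x] by (cases "\<phi> j x = 0") (auto simp: mult_right_mono)
    qed
    then have 1: "real i \<le> f x"
      using s_pos[OF x] by (simp add: f_def s_def le_divide_eq flip: sum_distrib_left)
    have "(\<Sum>j\<in>{1..k}. real j * \<phi> j x) < (\<Sum>j\<in>{1..k}. (real i + 1) * \<phi> j x)"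
    proof (intro sum_strict_mono_ex1 ballI bexI[of _ i])
      fix j assume j: "j \<in> {1..k}"
      show "real j * \<phi> j x \<le> (real i + 1) * \<phi> j x"
        using near[OF j] \<phi>(2)[OF j x] by (cases "\<phi> j x = 0") (auto intro: mult_right_mono)
    qed (use i pos in auto)
    then have 2: "f x < real i + 1"
      using s_pos[OF x] by (simp add: f_def s_def divide_less_eq flip: sum_distrib_left)
    have "\<lfloor>f x\<rfloor> = int i" using 1 2 by linarith
    then show ?thesis using i by simp
  qed
  obtain c where c: "\<And>x y. \<lbrakk>x \<in> mspace X; y \<in> mspace X\<rbrakk> \<Longrightarrow> mdist X x y \<le> c"
    using compact_space_mdist_bounded[OF X] by blast
  have "real_embeddable_up_to X e f"
    unfolding real_embeddable_up_to_def
  proof (intro conjI ballI impI)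
    show "continuous_map (mtopology_of X) euclideanreal f"
      unfolding f_def
    proof (rule continuous_map_real_divide)
      show "continuous_map (mtopology_of X) euclideanreal s"
        unfolding s_def by (intro continuous_map_sum \<phi>(1)) simp
      show "continuous_map (mtopology_of X) euclideanreal (\<lambda>x. \<Sum>i\<in>{1..k}. real i * \<phi> i x)"
        by (intro continuous_map_sum continuous_map_real_mult_left \<phi>(1)) simp
      show "s x \<noteq> 0" if "x \<in> topspace (mtopology_of X)" for x using s_pos[of x] that by simp
    qed
    fix x y assume xy: "x \<in> mspace X" "y \<in> mspace X" "f x = f y"
    define i where "i = nat \<lfloor>f x\<rfloor>"
    have i: "i \<in> {1..k}" "x \<in> C i" "y \<in> C i" using key[OF xy(1)] key[OF xy(2)] xy(3) by (auto simp: i_def)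
    have "mdist X x y \<le> mdiameter X (C i)"
      using i cover by (intro mdist_le_mdiameter[of _ _ c] c) auto
    also have "\<dots> \<le> mesh X k C" unfolding mesh_def using i(1) by (intro Max_ge) auto
    finally show "mdist X x y < e" using mesh by simp
  qed
  then show ?thesis by blast
qed

lemma almost_chainable_if_real_embeddable:
  fixes X :: "'a metric"
  assumes X: "compact_space (mtopology_of X)"
    and emb: "\<And>e. e > 0 \<Longrightarrow> \<exists>f. real_embeddable_up_to X e f"
  shows "almost_chainable X"
  unfolding almost_chainable_def
proof (intro allI impI)
  fix e :: real assume "e > 0"
  then obtain f where f: "real_embeddable_up_to X (e/2) f" using emb[of "e/2"] by auto
  then have cf: "continuous_map (mtopology_of X) euclideanreal f" by (simp add: real_embeddable_up_to_def)
  obtain M where M: "M > 0" "\<And>x. x \<in> mspace X \<Longrightarrow> \<bar>f x\<bar> < M"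
    using compact_space_real_bounded[OF X cf] by auto
  obtain d where d: "d > 0"
    "\<And>x y. \<lbrakk>x \<in> mspace X; y \<in> mspace X; \<bar>f x - f y\<bar> < d\<rbrakk> \<Longrightarrow> mdist X x y < e/2"
    using small_fibres_uniform[OF X f] by blast
  \<comment> \<open>One unit of \<open>v\<close> is d / 2 units of \<open>f\<close>, so a window of
    length 2 in \<open>v\<close> has length d in \<open>f\<close>. The summand 1 makes v \<ge> 1, so
    that floors are legal indices.\<close>
  define v where "v x = 2 * (f x + M) / d + 1" for x
  define C where "C i = {x \<in> topspace (mtopology_of X). v x \<in> {real i - 1<..<real i + 1}}" for i :: nat
  \<comment> \<open>Since f + M < 2 M, \<open>v\<close> stays below 4 M / d + 1, so \<open>k\<close>
    exceeds every floor of \<open>v\<close>.\<close>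
  define k where "k = nat \<lfloor>4 * M / d\<rfloor> + 2"
  have cv: "continuous_map (mtopology_of X) euclideanreal v"
    unfolding v_def using d(1) by (intro continuous_intros cf) auto
  have "almost_chain X k C"
    unfolding almost_chain_def
  proof (intro conjI ballI impI)
    show "openin (mtopology_of X) (C i)" for i
      unfolding C_def by (rule openin_continuous_map_preimage[OF cv]) simp
    fix i j assume "\<bar>int i - int j\<bar> \<ge> 2"
    then have "real i + 2 \<le> real j \<or> real j + 2 \<le> real i" by linarith
    then show "C i \<inter> C j = {}" by (auto simp: C_def)
  qed (simp add: k_def)
  moreover have "mesh X k C < e"
  proof -
    have "mdiameter X (C i) \<le> e/2" for i
    proof (rule mdiameter_le)
      fix x y assume xy: "x \<in> C i" "y \<in> C i"
      then have "\<bar>v x - v y\<bar> < 2" by (auto simp: C_def)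
      moreover have "v x - v y = 2 * (f x - f y) / d" by (simp add: v_def diff_divide_distrib add_divide_distrib algebra_simps)
      ultimately have "\<bar>f x - f y\<bar> < d" using d(1) by (auto simp: abs_mult field_simps)
      with d(2)[of x y] xy show "mdist X x y \<le> e/2" by (simp add: C_def)
    qed (use \<open>e > 0\<close> in simp)
    then have "mesh X k C \<le> e/2" unfolding mesh_def by (subst Max_le_iff) (auto simp: k_def)
    with \<open>e > 0\<close> show ?thesis by simp
  qed
  moreover have "(\<Union>i\<in>{1..k}. C i) = mspace X"
  proof (intro subset_antisym subsetI)
    fix x assume x: "x \<in> mspace X"
    have fx: "0 < f x + M" "f x + M < 2 * M" using M(2)[OF x] by auto
    have v1: "1 \<le> v x" using fx d(1) by (simp add: v_def)
    have v2: "v x < 4 * M / d + 1" using fx d(1) by (simp add: v_def field_simps)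
    define i where "i = nat \<lfloor>v x\<rfloor>"
    have i: "int i = \<lfloor>v x\<rfloor>" using v1 by (simp add: i_def)
    then have ri: "real i = of_int \<lfloor>v x\<rfloor>" by (metis of_int_of_nat_eq)
    have "x \<in> C i" unfolding C_def using x ri by (auto; linarith)
    moreover have "i \<in> {1..k}"
    proof -
      have "1 \<le> \<lfloor>v x\<rfloor>" using v1 by simp
      moreover have "\<lfloor>v x\<rfloor> \<le> \<lfloor>4 * M / d\<rfloor> + 1" using v2 by linarith
      ultimately have "1 \<le> int i" "int i \<le> \<lfloor>4 * M / d\<rfloor> + 1" using i by simp_all
      then show ?thesis unfolding k_def atLeastAtMost_iff by linarith
    qed
    ultimately show "x \<in> (\<Union>i\<in>{1..k}. C i)" by blast
  qed (auto simp: C_def)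
  ultimately show "\<exists>k C. almost_chain X k C \<and> mesh X k C < e \<and> (\<Union>i\<in>{1..k}. C i) = mspace X"
    by blast
qed

section \<open>Generalized arc-like spaces and real functions with small fibres\<close>

lemma continuous_map_into_intervals_metric:
  assumes "continuous_map X euclideanreal g" "\<And>x. x \<in> topspace X \<Longrightarrow> g x \<in> {0..1}"
  shows "continuous_map X (mtopology_of (intervals_metric 1)) (\<lambda>x. (1, g x))"
proof -
  have *: "Metric_space ({1..1} \<times> {0..1}) intervals_dist" by (rule Metric_space_intervals)
  interpret Metric_space "{1..1::nat} \<times> {0..1::real}" intervals_dist by (rule *)
  have "continuous_map X mtopology (\<lambda>x. (1, g x))"
    unfolding continuous_map_to_metric
  proof (intro ballI allI impI)
    fix x and e :: real assume x: "x \<in> topspace X" and e: "e > 0"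
    have "openin X {y \<in> topspace X. g y \<in> {g x - e<..<g x + e}}"
      by (rule openin_continuous_map_preimage[OF assms(1)]) simp
    then show "\<exists>U. openin X U \<and> x \<in> U \<and> (\<forall>y\<in>U. (1, g y) \<in> mball (1, g x) e)"
      by (intro exI[of _ "{y \<in> topspace X. g y \<in> {g x - e<..<g x + e}}"] conjI) (use x e assms(2) in \<open>auto simp: Metric_space.in_mball[OF *, simplified] intervals_dist_def\<close>)
  qed
  then show ?thesis by (simp add: mtopology_of_def mspace_intervals_metric mdist_intervals_metric)
qed

lemma intervals_dist_le_2:
  assumes "p \<in> {1..n} \<times> {0..1}" "q \<in> {1..n} \<times> {0..1}"
  shows "intervals_dist p q \<le> 2"
proof -
  have "\<bar>snd p - snd q\<bar> \<le> 2" using assms by (auto simp: abs_le_iff)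
  then show ?thesis by (simp add: intervals_dist_def)
qed

text \<open>A single copy of [0,1] suffices: \<open>arctan\<close> moves the line injectively into
  (0,1), so fibres do not change. Working with e/2 absorbs the loss of strictness when passing to a
  supremum.\<close>

lemma generalized_arc_like_if_real_embeddable:
  fixes X :: "'a metric"
  assumes X: "compact_space (mtopology_of X)"
    and emb: "\<And>e. e > 0 \<Longrightarrow> \<exists>f. real_embeddable_up_to X e f"
  shows "generalized_arc_like X"
  unfolding generalized_arc_like_def
proof (intro allI impI)
  fix e :: real assume "e > 0"
  then obtain f where f: "real_embeddable_up_to X (e/2) f" using emb[of "e/2"] by auto
  define g where "g x = arctan (f x) / pi + 1/2" for x
  have cf: "continuous_map (mtopology_of X) euclideanreal f" using f by (simp add: real_embeddable_up_to_def)
  have "continuous_map (mtopology_of X) euclideanreal (arctan \<circ> f)"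
    by (rule continuous_map_compose[OF cf]) (auto intro: continuous_intros)
  then have cg: "continuous_map (mtopology_of X) euclideanreal g"
    unfolding g_def by (intro continuous_map_add continuous_map_real_divide) (auto simp: o_def)
  have inj: "f x = f y" if "g x = g y" for x y
    using that by (simp add: g_def arctan_eq_iff)
  have g01: "g x \<in> {0..1}" for x
  proof -
    have "- (1/2) < arctan (f x) / pi" "arctan (f x) / pi < 1/2"
      using arctan_lbound[of "f x"] arctan_ubound[of "f x"]
      by (simp_all add: less_divide_eq divide_less_eq)
    then show ?thesis unfolding g_def atLeastAtMost_iff by linarith
  qed
  have "real_embeddable_up_to X (e/2) g"
    using f cg inj unfolding real_embeddable_up_to_def by blast
  then obtain d where d: "d > 0"
    "\<And>x y. \<lbrakk>x \<in> mspace X; y \<in> mspace X; \<bar>g x - g y\<bar> < d\<rbrakk> \<Longrightarrow> mdist X x y < e/2"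
    using small_fibres_uniform[OF X] by blast
  have "eps_delta_map X (intervals_metric 1) e d (\<lambda>x. (1, g x))"
    unfolding eps_delta_map_def
  proof (intro conjI allI impI)
    show "continuous_map (mtopology_of X) (mtopology_of (intervals_metric 1)) (\<lambda>x. (1, g x))"
      by (rule continuous_map_into_intervals_metric[OF cg]) (rule g01)
    fix Z assume Z: "Z \<subseteq> mspace (intervals_metric 1)" "mdiameter (intervals_metric 1) Z < d"
    have "mdiameter X {x \<in> mspace X. (1, g x) \<in> Z} \<le> e/2"
    proof (rule mdiameter_le)
      fix x y assume xy: "x \<in> {x \<in> mspace X. (1, g x) \<in> Z}" "y \<in> {x \<in> mspace X. (1, g x) \<in> Z}"
      \<comment> \<open>A bound on distances makes the supremum defining the diameter of
        \<open>Z\<close> a genuine upper bound.\<close>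
      have "mdist (intervals_metric 1) p q \<le> 2" if "p \<in> Z" "q \<in> Z" for p q
        using that Z(1) unfolding mspace_intervals_metric mdist_intervals_metric
        by (intro intervals_dist_le_2) auto
      then have "mdist (intervals_metric 1) (1, g x) (1, g y) \<le> mdiameter (intervals_metric 1) Z"
        using xy by (intro mdist_le_mdiameter[of _ _ 2]) auto
      with Z(2) have "\<bar>g x - g y\<bar> < d" by (simp add: mdist_intervals_metric intervals_dist_def)
      with d(2)[of x y] xy show "mdist X x y \<le> e/2" by simp
    qed (use \<open>e > 0\<close> in simp)
    with \<open>e > 0\<close> show "mdiameter X {x \<in> mspace X. (1, g x) \<in> Z} < e" by simp
  qed
  with d(1) show "\<exists>d>0. \<exists>n f. eps_delta_map X (intervals_metric n) e d f" by blast
qed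

lemma continuous_interval_code_metric:
  "continuous_map (mtopology_of (intervals_metric n)) euclideanreal interval_code"
proof -
  have "continuous_map (mtopology_of (intervals_metric n)) (mtopology_of euclidean_metric) interval_code"
    unfolding mtopology_of_def mspace_intervals_metric mdist_intervals_metric
  proof (subst Metric_space.metric_continuous_map[OF Metric_space_intervals Metric_space_mspace_mdist],
      intro conjI ballI allI impI)
    fix p and e :: real assume e: "e > 0"
    \<comment> \<open>Points at distance less than 1 lie in the same copy, and there the code is an
      isometry.\<close>
    show "\<exists>d>0. \<forall>q. q \<in> {1..n} \<times> {0..1} \<and> intervals_dist p q < d \<longrightarrow>
        mdist euclidean_metric (interval_code p) (interval_code q) < e"
      by (rule exI[of _ "min e 1"])
        (use e in \<open>auto simp: intervals_dist_def interval_code_def dist_real_def split: if_splits\<close>)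
  qed auto
  then show ?thesis by simp
qed

text \<open>A one-point set has diameter 0, below any \<delta>, so the fibres of the
  (\<epsilon>,\<delta>)-map are small; composing with the injective \<open>interval_code\<close>
  keeps them.\<close>

lemma real_embeddable_if_generalized_arc_like:
  fixes X :: "'a metric"
  assumes X: "compact_space (mtopology_of X)" and "generalized_arc_like X" "e > 0"
  shows "\<exists>f. real_embeddable_up_to X e f"
proof -
  obtain d n g where d: "d > 0" and g: "eps_delta_map X (intervals_metric n) e d g"
    using assms(2,3) unfolding generalized_arc_like_def by blast
  have cg: "continuous_map (mtopology_of X) (mtopology_of (intervals_metric n)) g"
    and sm: "\<And>Z. \<lbrakk>Z \<subseteq> mspace (intervals_metric n); mdiameter (intervals_metric n) Z < d\<rbrakk>
        \<Longrightarrow> mdiameter X {x \<in> mspace X. g x \<in> Z} < e"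
    using g unfolding eps_delta_map_def by blast+
  have gX: "g x \<in> {1..n} \<times> {0..1}" if "x \<in> mspace X" for x
    using continuous_map_image_subset_topspace[OF cg] that by (simp add: mspace_intervals_metric image_subset_iff)
  obtain c where c: "\<And>x y. \<lbrakk>x \<in> mspace X; y \<in> mspace X\<rbrakk> \<Longrightarrow> mdist X x y \<le> c"
    using compact_space_mdist_bounded[OF X] by blast
  have "real_embeddable_up_to X e (interval_code \<circ> g)"
    unfolding real_embeddable_up_to_def
  proof (intro conjI ballI impI)
    show "continuous_map (mtopology_of X) euclideanreal (interval_code \<circ> g)"
      by (rule continuous_map_compose[OF cg continuous_interval_code_metric])
    fix x y assume xy: "x \<in> mspace X" "y \<in> mspace X" "(interval_code \<circ> g) x = (interval_code \<circ> g) y"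
    then have gxy: "g x = g y" using inj_onD[OF interval_code_inj _ gX gX] by simp
    have "mdiameter (intervals_metric n) {g x} = 0" using gX[OF xy(1)]
      by (simp add: mdiameter_def mdist_intervals_metric intervals_dist_def)
    then have "mdiameter X {z \<in> mspace X. g z \<in> {g x}} < e"
      using gX[OF xy(1)] d by (intro sm) (auto simp: mspace_intervals_metric)
    moreover have "mdist X x y \<le> mdiameter X {z \<in> mspace X. g z \<in> {g x}}"
      by (rule mdist_le_mdiameter[of _ _ c]) (use c xy gxy in auto)
    ultimately show "mdist X x y < e" by simp
  qed
  then show ?thesis by blast
qed

section \<open>Inverse limits of intervals\<close>

text \<open>Later arguments work with coordinates only, so the homeomorphism is traded for the maps
  \<open>p i\<close>; the third conclusion is its injectivity and the fourth its surjectivity onto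
  threads.\<close>

lemma homeomorphic_inverse_limit_projections:
  assumes "T homeomorphic_space inverse_limit Y f"
  obtains p where "\<And>i. continuous_map T (Y i) (p i)"
    and "\<And>i x. x \<in> topspace T \<Longrightarrow> f i (p (Suc i) x) = p i x"
    and "\<And>x y. \<lbrakk>x \<in> topspace T; y \<in> topspace T; \<And>i. p i x = p i y\<rbrakk> \<Longrightarrow> x = y"
    and "\<And>z. \<lbrakk>\<And>i. z i \<in> topspace (Y i); \<And>i. f i (z (Suc i)) = z i\<rbrakk>
      \<Longrightarrow> \<exists>x\<in>topspace T. \<forall>i. p i x = z i"
proof -
  obtain h where h: "homeomorphic_map T (inverse_limit Y f) h"
    using assms homeomorphic_space by blast
  have ch: "continuous_map T (inverse_limit Y f) h" by (rule homeomorphic_imp_continuous_map[OF h])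
  have im: "h ` topspace T = topspace (inverse_limit Y f)" by (rule homeomorphic_imp_surjective_map[OF h])
  have inj: "inj_on h (topspace T)" by (rule homeomorphic_imp_injective_map[OF h])
  have top: "topspace (inverse_limit Y f) = {x. (\<forall>i. x i \<in> topspace (Y i)) \<and> (\<forall>i. f i (x (Suc i)) = x i)}"
    by (auto simp: inverse_limit_def)
  have hx: "h x \<in> topspace (inverse_limit Y f)" if "x \<in> topspace T" for x using im that by blast
  show ?thesis
  proof (rule that[of "\<lambda>i x. h x i"])
    show "continuous_map T (Y i) (\<lambda>x. h x i)" for i
      using ch unfolding inverse_limit_def continuous_map_in_subtopology continuous_map_componentwise_UNIV
      by blast
    show "f i (h x (Suc i)) = h x i" if "x \<in> topspace T" for i x
      using hx[OF that] by (simp add: top)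
    show "x = y" if "x \<in> topspace T" "y \<in> topspace T" "\<And>i. h x i = h y i" for x y
      using inj_onD[OF inj, of x y] that by blast
    show "\<exists>x\<in>topspace T. \<forall>i. h x i = z i"
      if "\<And>i. z i \<in> topspace (Y i)" "\<And>i. f i (z (Suc i)) = z i" for z
    proof -
      have "z \<in> h ` topspace T" using that by (simp add: im top)
      then show ?thesis by blast
    qed
  qed
qed

text \<open>Agreement of the i-th coordinates is a closed relation because the stages are Hausdorff.
  It shrinks with i because coordinate i + 1 determines coordinate i, and the relations for all i
  meet in the diagonal.\<close>

lemma projection_real_embeddable:
  fixes X :: "'a metric"
  assumes X: "compact_space (mtopology_of X)" and e: "e > 0"
    and cp: "\<And>i. continuous_map (mtopology_of X) (intervals_top (n i)) (p i)"
    and fp: "\<And>i x. x \<in> mspace X \<Longrightarrow> f i (p (Suc i) x) = p i x"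
    and inj: "\<And>x y. \<lbrakk>x \<in> mspace X; y \<in> mspace X; \<And>i. p i x = p i y\<rbrakk> \<Longrightarrow> x = y"
  obtains i where "real_embeddable_up_to X e (interval_code \<circ> p i)"
proof -
  let ?XX = "prod_topology (mtopology_of X) (mtopology_of X)"
  have cfst: "continuous_map ?XX (intervals_top (n i)) (\<lambda>q. p i (fst q))" for i
    using continuous_map_compose[OF continuous_map_fst cp] by (simp add: o_def)
  have csnd: "continuous_map ?XX (intervals_top (n i)) (\<lambda>q. p i (snd q))" for i
    using continuous_map_compose[OF continuous_map_snd cp] by (simp add: o_def)
  define R where "R i = {q \<in> topspace ?XX. p i (fst q) = p i (snd q)}" for i
  obtain i where i: "\<And>x y. (x, y) \<in> R i \<Longrightarrow> mdist X x y < e"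
  proof (rule compact_relations_small[OF X, of R e])
    show "closedin ?XX (R i)" for i
      unfolding R_def
      by (rule closedin_continuous_maps_eq[OF Hausdorff_space_intervals_top cfst csnd])
    show "R (Suc i) \<subseteq> R i" for i
    proof
      fix q assume q: "q \<in> R (Suc i)"
      then have q': "fst q \<in> mspace X" "snd q \<in> mspace X" "p (Suc i) (fst q) = p (Suc i) (snd q)"
        by (auto simp: R_def)
      with fp[of "fst q" i] fp[of "snd q" i] have "p i (fst q) = p i (snd q)" by simp
      with q show "q \<in> R i" by (simp add: R_def)
    qed
    fix x y assume xy: "\<And>i. (x, y) \<in> R i"
    then have "x = y" "x \<in> mspace X" "y \<in> mspace X" using inj[of x y] by (simp_all add: R_def)
    then have "mdist X x y = 0" using mdist_eq_0_iff[of x X y] by blast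
    with e show "mdist X x y < e" by simp
  qed blast
  have "real_embeddable_up_to X e (interval_code \<circ> p i)"
    unfolding real_embeddable_up_to_def
  proof (intro conjI ballI impI)
    show "continuous_map (mtopology_of X) euclideanreal (interval_code \<circ> p i)"
      by (rule continuous_map_compose[OF cp continuous_interval_code])
    fix x y assume xy: "x \<in> mspace X" "y \<in> mspace X" "(interval_code \<circ> p i) x = (interval_code \<circ> p i) y"
    have pX: "p i z \<in> {1..n i} \<times> {0..1}" if "z \<in> mspace X" for z
      using continuous_map_image_subset_topspace[OF cp[of i]] that
      by (simp add: image_subset_iff topspace_mtopology_of)
    have "p i x = p i y"
      by (rule inj_onD[OF interval_code_inj _ pX pX]) (use xy in auto)
    with xy show "mdist X x y < e" by (intro i) (simp add: R_def)
  qed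
  then show ?thesis by (rule that)
qed

lemma real_embeddable_if_inverse_limit:
  fixes X :: "'a metric"
  assumes X: "compact_space (mtopology_of X)"
    and lim: "inverse_limit_of_intervals (mtopology_of X)" and e: "e > 0"
  shows "\<exists>f. real_embeddable_up_to X e f"
proof -
  obtain n f where hom: "mtopology_of X homeomorphic_space inverse_limit (\<lambda>i. intervals_top (n i)) f"
    using lim unfolding inverse_limit_of_intervals_def by blast
  obtain p where p: "\<And>i. continuous_map (mtopology_of X) (intervals_top (n i)) (p i)"
    "\<And>i x. x \<in> mspace X \<Longrightarrow> f i (p (Suc i) x) = p i x"
    "\<And>x y. \<lbrakk>x \<in> mspace X; y \<in> mspace X; \<And>i. p i x = p i y\<rbrakk> \<Longrightarrow> x = y"
    using homeomorphic_inverse_limit_projections[OF hom] by (metis topspace_mtopology_of)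
  show ?thesis using projection_real_embeddable[of X e n p f, OF X e p] by blast
qed

text \<open>A McShane extension: \<open>F s = inf\<^sub>y u y + \<bar>s - K p y\<bar>\<close>.\<close>

lemma lipschitz_factor:
  fixes p u :: "'a \<Rightarrow> real"
  assumes d: "d > 0" and e: "e \<ge> 0" and bound: "\<And>x. x \<in> S \<Longrightarrow> \<bar>u x\<bar> \<le> M"
    and near: "\<And>x y. \<lbrakk>x \<in> S; y \<in> S; \<bar>p x - p y\<bar> < d\<rbrakk> \<Longrightarrow> \<bar>u x - u y\<bar> \<le> e"
    and K: "2 * M / d \<le> K" "0 \<le> K"
  obtains F where "\<And>s t. \<bar>F s - F t :: real\<bar> \<le> \<bar>s - t\<bar>" "\<And>x. x \<in> S \<Longrightarrow> \<bar>F (K * p x) - u x\<bar> \<le> e"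
proof (cases "S = {}")
  case True
  then show ?thesis by (intro that[of "\<lambda>s. 0"]) auto
next
  case False
  define F where "F s = (INF y\<in>S. u y + \<bar>s - K * p y\<bar>)" for s
  have bdd: "bdd_below ((\<lambda>y. u y + \<bar>s - K * p y\<bar>) ` S)" for s
  proof (rule bdd_belowI[of _ "- M"])
    fix v assume "v \<in> (\<lambda>y. u y + \<bar>s - K * p y\<bar>) ` S"
    then obtain y where "y \<in> S" "v = u y + \<bar>s - K * p y\<bar>" by blast
    with bound[of y] show "- M \<le> v" by linarith
  qed
  have lip: "F s \<le> F t + \<bar>s - t\<bar>" for s t
  proof -
    have "F s - \<bar>s - t\<bar> \<le> u y + \<bar>t - K * p y\<bar>" if "y \<in> S" for y
    proof -
      have "F s \<le> u y + \<bar>s - K * p y\<bar>" unfolding F_def by (rule cINF_lower[OF bdd that])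
      then show ?thesis by linarith
    qed
    then have "F s - \<bar>s - t\<bar> \<le> F t" unfolding F_def[of t] by (intro cINF_greatest False)
    then show ?thesis by simp
  qed
  show ?thesis
  proof (rule that[of F])
    show "\<bar>F s - F t\<bar> \<le> \<bar>s - t\<bar>" for s t using lip[of s t] lip[of t s] by linarith
    fix x assume x: "x \<in> S"
    have "F (K * p x) \<le> u x + \<bar>K * p x - K * p x\<bar>" unfolding F_def by (rule cINF_lower[OF bdd x])
    then have 1: "F (K * p x) \<le> u x" by simp
    \<comment> \<open>A competitor y with p y near p x gains at most e by \<open>near\<close>. For
      any other y the penalty is at least K d \<ge> 2 M, which already covers the largest possible
      drop of \<open>u\<close>.\<close>
    have "u x - e \<le> u y + \<bar>K * p x - K * p y\<bar>" if y: "y \<in> S" for y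
    proof (cases "\<bar>p x - p y\<bar> < d")
      case True
      with near[OF x y] show ?thesis by linarith
    next
      case False
      have "2 * M \<le> K * d" using K d by (simp add: field_simps)
      also have "\<dots> \<le> K * \<bar>p x - p y\<bar>" using False K by (intro mult_left_mono) auto
      also have "\<dots> = \<bar>K * p x - K * p y\<bar>" using K by (simp add: abs_mult flip: right_diff_distrib)
      finally show ?thesis using bound[OF x] bound[OF y] e by linarith
    qed
    then have "u x - e \<le> F (K * p x)" unfolding F_def by (intro cINF_greatest False)
    with 1 show "\<bar>F (K * p x) - u x\<bar> \<le> e" using e by linarith
  qed
qed

section \<open>Inverse systems of real functions\<close>

lemma compact_space_uniformly_continuous:
  fixes X :: "'a metric" and f :: "'a \<Rightarrow> real"
  assumes X: "compact_space (mtopology_of X)" and f: "continuous_map (mtopology_of X) euclideanreal f"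
    and e: "e > 0"
  obtains d where "d > 0" "\<And>x y. \<lbrakk>x \<in> mspace X; y \<in> mspace X; mdist X x y < d\<rbrakk> \<Longrightarrow> \<bar>f x - f y\<bar> < e"
proof -
  have "uniformly_continuous_map X euclidean_metric f"
    using continuous_imp_uniformly_continuous_map[of X euclidean_metric f] X f by simp
  then obtain d where d: "d > 0" "\<forall>x\<in>mspace X. \<forall>y\<in>mspace X. mdist X y x < d \<longrightarrow> \<bar>f y - f x\<bar> < e"
    using e unfolding uniformly_continuous_map_def mdist_euclidean_metric dist_real_def by blast
  show ?thesis by (rule that[OF d(1)]) (use d(2) in blast)
qed

text \<open>Rescaling \<open>P (Suc n)\<close> makes \<open>F n\<close> 1-Lipschitz, so that errors do not grow under composition.\<close>

lemma approximate_inverse_system: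
  fixes X :: "'a metric"
  assumes X: "compact_space (mtopology_of X)"
    and emb: "\<And>e. e > 0 \<Longrightarrow> \<exists>f. real_embeddable_up_to X e f"
  obtains P :: "nat \<Rightarrow> 'a \<Rightarrow> real" and \<eta> :: "nat \<Rightarrow> real" and F :: "nat \<Rightarrow> real \<Rightarrow> real"
  where "\<And>n. continuous_map (mtopology_of X) euclideanreal (P n)"
    and "\<And>n. \<eta> n > 0" and "\<And>n. \<eta> (Suc n) \<le> \<eta> n / 2"
    and "\<And>n x y. \<lbrakk>x \<in> mspace X; y \<in> mspace X; \<bar>P n x - P n y\<bar> < 6 * \<eta> n\<rbrakk> \<Longrightarrow> mdist X x y < (1/2)^n"
    and "\<And>n s t. \<bar>F n s - F n t\<bar> \<le> \<bar>s - t\<bar>"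
    and "\<And>n x. x \<in> mspace X \<Longrightarrow> \<bar>F n (P (Suc n) x) - P n x\<bar> \<le> \<eta> n"
proof -
  \<comment> \<open>A state is a pair (P n, \<eta> n). The map \<open>F n\<close> depends on two
    consecutive states, so its existence is part of \<open>step\<close> and it is chosen at the
    end.\<close>
  define good where "good n = (\<lambda>(p, h). continuous_map (mtopology_of X) euclideanreal p \<and> h > 0 \<and>
      (\<forall>x\<in>mspace X. \<forall>y\<in>mspace X. \<bar>p x - p y\<bar> < 6 * h \<longrightarrow> mdist X x y < (1/2)^n))"
    for n :: nat
  define step where "step = (\<lambda>(p, h :: real) (p', h'). h' \<le> h / 2 \<and> (\<exists>F. (\<forall>s t. \<bar>F s - F t\<bar> \<le> \<bar>s - t\<bar>) \<and>
      (\<forall>x\<in>mspace X. \<bar>F (p' x :: real) - p x :: real\<bar> \<le> h)))"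
  have "\<exists>g. \<forall>n. good n (g n) \<and> step (g n) (g (Suc n))"
  proof (rule dependent_nat_choice)
    obtain f where f: "real_embeddable_up_to X 1 f" using emb[of 1] by auto
    obtain d where d: "d > 0" "\<And>x y. \<lbrakk>x \<in> mspace X; y \<in> mspace X; \<bar>f x - f y\<bar> < d\<rbrakk> \<Longrightarrow> mdist X x y < 1"
      using small_fibres_uniform[OF X f] by blast
    have "good 0 (f, d / 6)"
      using f d by (simp add: good_def real_embeddable_up_to_def)
    then show "\<exists>g. good 0 g" by blast
  next
    fix g n assume "good n g"
    then obtain p h where g: "g = (p, h)" and p: "continuous_map (mtopology_of X) euclideanreal p" and h: "h > 0"
      by (cases g) (auto simp: good_def)
    obtain d1 where d1: "d1 > 0"
      "\<And>x y. \<lbrakk>x \<in> mspace X; y \<in> mspace X; mdist X x y < d1\<rbrakk> \<Longrightarrow> \<bar>p x - p y\<bar> < h"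
      using compact_space_uniformly_continuous[OF X p h] by blast
    obtain M where M: "M > 0" "\<And>x. x \<in> mspace X \<Longrightarrow> \<bar>p x\<bar> < M"
      using compact_space_real_bounded[OF X p] by auto
    \<comment> \<open>The tolerance has two tasks: below d1, the old function \<open>p\<close>
      varies by less than h wherever \<open>f\<close> nearly agrees, so \<open>p\<close> factors
      through \<open>f\<close> up to h; below (1/2)^(n+1), the new stage separates points well
      enough.\<close>
    obtain f where f: "real_embeddable_up_to X (min d1 ((1/2)^Suc n)) f"
      using emb[of "min d1 ((1/2)^Suc n)"] d1 by auto
    obtain d where d: "d > 0" "\<And>x y. \<lbrakk>x \<in> mspace X; y \<in> mspace X; \<bar>f x - f y\<bar> < d\<rbrakk>
        \<Longrightarrow> mdist X x y < min d1 ((1/2)^Suc n)"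
      using small_fibres_uniform[OF X f] by blast
    define K where "K = 2 * M / d + 1"
    have K: "2 * M / d \<le> K" "0 < K" using M(1) d(1) by (auto simp: K_def intro: add_pos_pos)
    obtain F where F: "\<And>s t. \<bar>F s - F t\<bar> \<le> \<bar>s - t\<bar>" "\<And>x. x \<in> mspace X \<Longrightarrow> \<bar>F (K * f x) - p x\<bar> \<le> h"
    proof (rule lipschitz_factor[of d h "mspace X" p M f K])
      show "\<bar>p x - p y\<bar> \<le> h" if "x \<in> mspace X" "y \<in> mspace X" "\<bar>f x - f y\<bar> < d" for x y
        using d1(2)[of x y] d(2)[of x y] that by simp
    qed (use d h M K in \<open>auto simp: less_imp_le\<close>)
    \<comment> \<open>The new tolerance is at most h / 2 to give the halving, and at most K d / 6 so
      that a gap below 6 times the tolerance in K f is a gap below d in \<open>f\<close>.\<close>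
    have "good (Suc n) (\<lambda>x. K * f x, min (h / 2) (K * d / 6))"
      unfolding good_def prod.case
    proof (intro conjI ballI impI)
      show "continuous_map (mtopology_of X) euclideanreal (\<lambda>x. K * f x)"
        using f by (auto simp: real_embeddable_up_to_def intro: continuous_map_real_mult_left)
      fix x y assume xy: "x \<in> mspace X" "y \<in> mspace X" "\<bar>K * f x - K * f y\<bar> < 6 * min (h / 2) (K * d / 6)"
      then have "\<bar>K * f x - K * f y\<bar> < K * d" by linarith
      then have "K * \<bar>f x - f y\<bar> < K * d" using K by (simp add: abs_mult flip: right_diff_distrib)
      with d(2)[OF xy(1,2)] K show "mdist X x y < (1/2)^Suc n" by simp
    qed (use h K d in simp)
    moreover have "step g (\<lambda>x. K * f x, min (h / 2) (K * d / 6))"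
      unfolding step_def g prod.case using F by auto
    ultimately show "\<exists>g'. good (Suc n) g' \<and> step g g'" by blast
  qed
  then obtain g where g: "\<And>n. good n (g n)" "\<And>n. step (g n) (g (Suc n))" by blast
  have "\<exists>F. (\<forall>s t. \<bar>F s - F t\<bar> \<le> \<bar>s - t\<bar>) \<and>
      (\<forall>x\<in>mspace X. \<bar>F (fst (g (Suc n)) x) - fst (g n) x\<bar> \<le> snd (g n))" for n
    using g(2)[of n] by (simp add: step_def split_beta)
  then obtain F where F: "\<And>n s t. \<bar>F n s - F n t :: real\<bar> \<le> \<bar>s - t\<bar>"
      "\<And>n x. x \<in> mspace X \<Longrightarrow> \<bar>F n (fst (g (Suc n)) x) - fst (g n) x\<bar> \<le> snd (g n)"
    by metis
  show ?thesis
    by (rule that[of "\<lambda>n. fst (g n)" "\<lambda>n. snd (g n)" F])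
      (use g F in \<open>auto simp: good_def step_def split_beta\<close>)
qed

text \<open>Every component contains an integer multiple of \<open>r\<close>, so there are finitely many.\<close>

lemma homeomorphic_intervals_top:
  fixes S :: "real set"
  assumes S: "compact S" and r: "r > 0"
    and thick: "\<And>s. s \<in> S \<Longrightarrow> \<exists>c. s \<in> {c - r..c + r} \<and> {c - r..c + r} \<subseteq> S"
  obtains n h where "homeomorphic_map (intervals_top n) (top_of_set S) h"
proof -
  have thickC: "\<exists>c. {c - r..c + r} \<subseteq> C" if C: "C \<in> components S" for C
  proof -
    obtain s where s: "s \<in> C" using in_components_nonempty[OF C] by blast
    then obtain c where c: "s \<in> {c - r..c + r}" "{c - r..c + r} \<subseteq> S"
      using thick in_components_subset[OF C] by blast
    have "{c - r..c + r} \<subseteq> C" using s c by (intro components_maximal[OF C]) auto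
    then show ?thesis ..
  qed
  have "finite (components S)"
  proof -
    obtain B where B: "\<And>s. s \<in> S \<Longrightarrow> \<bar>s\<bar> \<le> B"
      using compact_imp_bounded[OF S] by (auto simp: bounded_iff)
    let ?G = "{\<lfloor>- B / r\<rfloor>..\<lceil>B / r\<rceil>}"
    have "components S \<subseteq> (\<lambda>m. connected_component_set S (r * of_int m)) ` ?G"
    proof
      fix C assume C: "C \<in> components S"
      obtain c where c: "{c - r..c + r} \<subseteq> C" using thickC[OF C] by blast
      define m where "m = \<lceil>(c - r) / r\<rceil>"
      have "(c - r) / r \<le> of_int m" "of_int m \<le> (c - r) / r + 1"
        unfolding m_def by linarith+
      then have "r * of_int m \<in> {c - r..c + r}" using r by (auto simp: field_simps)
      with c have m: "r * of_int m \<in> C" by blast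
      then have "r * of_int m \<in> S" using in_components_subset[OF C] by blast
      from B[OF this] have "- B \<le> r * of_int m" "r * of_int m \<le> B" by linarith+
      then have "- B / r \<le> of_int m" "of_int m \<le> B / r" using r by (simp_all add: field_simps)
      then have "m \<in> ?G" unfolding atLeastAtMost_iff by linarith
      moreover have "C = connected_component_set S (r * of_int m)"
        using C m by (metis components_iff connected_component_eq)
      ultimately show "C \<in> (\<lambda>m. connected_component_set S (r * of_int m)) ` ?G" by blast
    qed
    then show ?thesis by (rule finite_subset) simp
  qed
  then obtain C where C: "bij_betw C {1..card (components S)} (components S)"
    using ex_bij_betw_nat_finite_1 by blast
  define n where "n = card (components S)"
  have Ccomp: "C i \<in> components S" if "i \<in> {1..n}" for i
    using bij_betwE[OF C] that by (simp add: n_def)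
  \<comment> \<open>Each component contains an interval of length 2 r, so it is not a single point
    and [0,1] maps onto it by a non-constant affine map.\<close>
  have "\<exists>a b. C i = {a..b} \<and> a < b" if i: "i \<in> {1..n}" for i
  proof -
    have "connected (C i)" "compact (C i)"
      using in_components_connected[OF Ccomp[OF i]] compact_components[OF S Ccomp[OF i]] by auto
    then obtain a b where ab: "C i = {a..b}" using connected_compact_interval_1 by blast
    obtain c where "{c - r..c + r} \<subseteq> {a..b}" using thickC[OF Ccomp[OF i]] ab by auto
    then have "a < b" using r by auto
    with ab show ?thesis by blast
  qed
  then obtain a b where ab: "\<And>i. i \<in> {1..n} \<Longrightarrow> C i = {a i..b i}" "\<And>i. i \<in> {1..n} \<Longrightarrow> a i < b i"
    by metis
  define h where "h p = a (fst p) + snd p * (b (fst p) - a (fst p))" for p :: "nat \<times> real"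
  have hC: "h (i, t) \<in> C i" if "i \<in> {1..n}" "t \<in> {0..1}" for i t
  proof -
    have "t * (b i - a i) \<le> 1 * (b i - a i)" "0 \<le> t * (b i - a i)"
      using that ab(2)[OF that(1)] by (auto intro!: mult_right_mono simp del: mult_1)
    with ab(1)[OF that(1)] show ?thesis by (auto simp: h_def)
  qed
  have "homeomorphic_map (intervals_top n) (top_of_set S) h"
  proof (rule continuous_imp_homeomorphic_map)
    have "h p \<in> S" if "p \<in> {1..n} \<times> {0..1}" for p
      using that hC in_components_subset[OF Ccomp] by (cases p) blast
    then show "continuous_map (intervals_top n) (top_of_set S) h"
      unfolding intervals_top_eq
      by (auto simp: h_def[abs_def] intro!: continuous_intros continuous_on_fst_nat)
    show "inj_on h (topspace (intervals_top n))"
    proof (rule inj_onI)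
      fix p q assume pq: "p \<in> topspace (intervals_top n)" "q \<in> topspace (intervals_top n)" "h p = h q"
      obtain i s j t where eq: "p = (i, s)" "q = (j, t)" by (cases p, cases q)
      have i: "i \<in> {1..n}" "s \<in> {0..1}" and j: "j \<in> {1..n}" "t \<in> {0..1}" using pq eq by auto
      have "C i \<inter> C j \<noteq> {}" using hC[OF i] hC[OF j] pq(3) eq by auto
      then have "C i = C j" using components_nonoverlap[OF Ccomp[OF i(1)] Ccomp[OF j(1)]] by blast
      then have "i = j" using bij_betw_imp_inj_on[OF C] i j by (auto simp: n_def dest: inj_onD)
      then show "p = q" using pq(3) ab(2)[OF i(1)] by (simp add: eq h_def)
    qed
    show "h ` topspace (intervals_top n) = topspace (top_of_set S)"
    proof (intro subset_antisym subsetI)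
      fix s assume "s \<in> topspace (top_of_set S)"
      then have "s \<in> \<Union> (components S)" by simp
      then obtain i where i: "i \<in> {1..n}" "s \<in> C i"
        using bij_betw_imp_surj_on[OF C] by (metis UnionE image_iff n_def)
      define t where "t = (s - a i) / (b i - a i)"
      have "s \<in> {a i..b i}" "a i < b i" using ab i by auto
      then have "t \<in> {0..1}" "h (i, t) = s" by (auto simp: t_def h_def field_simps)
      then show "s \<in> h ` topspace (intervals_top n)"
        using i(1) by (intro image_eqI[of _ _ "(i, t)"]) auto
    next
      fix s assume "s \<in> h ` topspace (intervals_top n)"
      then show "s \<in> topspace (top_of_set S)"
        using hC in_components_subset[OF Ccomp] by fastforce
    qed
  qed (simp_all add: Hausdorff_space_top_of_set)
  then show ?thesis by (rule that)
qed

text \<open>The bonding map from stage n + k to stage n of an inverse sequence. The recursion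
  attaches a new stage at the far end; \<open>descend_Suc\<close> splits off the map at the near
  end.\<close>

primrec descend :: "(nat \<Rightarrow> 'b \<Rightarrow> 'b) \<Rightarrow> nat \<Rightarrow> nat \<Rightarrow> 'b \<Rightarrow> 'b" where
  "descend F n 0 s = s"
| "descend F n (Suc k) s = descend F n k (F (n + k) s)"

lemma descend_Suc: "descend F n (Suc k) s = F n (descend F (Suc n) k s)"
  by (induction k arbitrary: s) auto

lemma descend_lipschitz:
  fixes F :: "nat \<Rightarrow> real \<Rightarrow> real"
  assumes "\<And>n s t. \<bar>F n s - F n t\<bar> \<le> \<bar>s - t\<bar>"
  shows "\<bar>descend F n k s - descend F n k t\<bar> \<le> \<bar>s - t\<bar>"
proof (induction k arbitrary: s t)
  case (Suc k)
  have "\<bar>descend F n k (F (n + k) s) - descend F n k (F (n + k) t)\<bar> \<le> \<bar>F (n + k) s - F (n + k) t\<bar>"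
    by (rule Suc.IH)
  also have "\<dots> \<le> \<bar>s - t\<bar>" by (rule assms)
  finally show ?case by simp
qed simp

lemma descend_in:
  assumes "\<And>i p. p \<in> S (Suc i) \<Longrightarrow> F i p \<in> S i" "p \<in> S (n + k)"
  shows "descend F n k p \<in> S n"
  using assms(2)
proof (induction k arbitrary: p)
  case (Suc k)
  then show ?case using assms(1)[of p "n + k"] by simp
qed simp

lemma descend_compatible: "(\<And>n. F n (z (Suc n)) = z n) \<Longrightarrow> descend F n k (z (n + k)) = z n"
  by (induction k) auto

lemma halving_bound:
  fixes \<eta> :: "nat \<Rightarrow> real"
  assumes "\<And>n. \<eta> (Suc n) \<le> \<eta> n / 2"
  shows "\<eta> (n + k) \<le> \<eta> n * (1/2)^k"
proof (induction k)
  case (Suc k)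
  with assms[of "n + k"] show ?case by simp
qed simp

text \<open>Push \<open>P (n + k)\<close> down to stage n. As descending is 1-Lipschitz, going from
  k to k + 1 changes the result by at most \<open>\<eta> (n + k)\<close>, which is at most
  \<open>\<eta> n * (1/2)^k\<close>. The sequence is uniformly Cauchy with total change at most
  \<open>2 * \<eta> n\<close>, and its limit inherits the exact relation between stages by
  continuity of \<open>F n\<close>.\<close>

lemma exact_inverse_system:
  fixes X :: "'a metric" and P :: "nat \<Rightarrow> 'a \<Rightarrow> real"
  assumes P: "\<And>n. continuous_map (mtopology_of X) euclideanreal (P n)"
    and \<eta>: "\<And>n. \<eta> n > 0" "\<And>n. \<eta> (Suc n) \<le> \<eta> n / 2"
    and F: "\<And>n s t. \<bar>F n s - F n t\<bar> \<le> \<bar>s - t\<bar>"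
    and FP: "\<And>n x. x \<in> mspace X \<Longrightarrow> \<bar>F n (P (Suc n) x) - P n x\<bar> \<le> \<eta> n"
  obtains q where "\<And>n. continuous_map (mtopology_of X) euclideanreal (q n)"
    and "\<And>n x. x \<in> mspace X \<Longrightarrow> \<bar>q n x - P n x\<bar> \<le> 2 * \<eta> n"
    and "\<And>n x. x \<in> mspace X \<Longrightarrow> F n (q (Suc n) x) = q n x"
proof -
  define G where "G n k x = descend F n k (P (n + k) x)" for n k x
  have G_step: "\<bar>G n (Suc k) x - G n k x\<bar> \<le> \<eta> n * (1/2)^k" if x: "x \<in> mspace X" for n k x
  proof -
    have "\<bar>G n (Suc k) x - G n k x\<bar> \<le> \<bar>F (n + k) (P (Suc (n + k)) x) - P (n + k) x\<bar>"
      unfolding G_def using descend_lipschitz[of F n k, OF F] by simp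
    also have "\<dots> \<le> \<eta> (n + k)" by (rule FP[OF x])
    also have "\<dots> \<le> \<eta> n * (1/2)^k" by (rule halving_bound) (rule \<eta>(2))
    finally show ?thesis .
  qed
  \<comment> \<open>The right-hand side is the closed form of the geometric sum of the j step
    bounds, which lets the induction on j close.\<close>
  have G_diff: "\<bar>G n (k + j) x - G n k x\<bar> \<le> \<eta> n * 2 * ((1/2)^k - (1/2)^(k+j))" if x: "x \<in> mspace X" for n k j x
  proof (induction j)
    case (Suc j)
    have "\<bar>G n (k + Suc j) x - G n k x\<bar> \<le> \<bar>G n (Suc (k + j)) x - G n (k + j) x\<bar> + \<bar>G n (k + j) x - G n k x\<bar>"
      by simp
    also have "\<dots> \<le> \<eta> n * (1/2)^(k + j) + \<eta> n * 2 * ((1/2)^k - (1/2)^(k+j))"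
      using G_step[OF x] Suc by (intro add_mono) auto
    also have "\<dots> = \<eta> n * 2 * ((1/2)^k - (1/2)^(k + Suc j))" by (simp add: field_simps)
    finally show ?case .
  qed simp
  have G_diff': "\<bar>G n (k + j) x - G n k x\<bar> \<le> \<eta> n * 2 * (1/2)^k" if x: "x \<in> mspace X" for n k j x
  proof -
    have "\<eta> n * 2 * ((1/2)^k - (1/2)^(k+j)) \<le> \<eta> n * 2 * (1/2)^k"
      using \<eta>(1)[of n] by (intro mult_left_mono) auto
    with G_diff[OF x, of n k j] show ?thesis by linarith
  qed
  have "\<exists>l. uniform_limit (mspace X) (G n) l sequentially" for n
  proof -
    have "uniformly_Cauchy_on (mspace X) (G n)"
    proof (rule uniformly_Cauchy_onI')
      fix e :: real assume e: "e > 0"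
      have "(\<lambda>k. \<eta> n * 2 * (1/2)^k) \<longlonglongrightarrow> \<eta> n * 2 * 0"
        by (intro tendsto_intros LIMSEQ_power_zero) simp
      then have "\<forall>\<^sub>F k in sequentially. \<eta> n * 2 * (1/2)^k < e" using e by (intro order_tendstoD) auto
      then obtain K where K: "\<And>k. k \<ge> K \<Longrightarrow> \<eta> n * 2 * (1/2)^k < e" by (auto simp: eventually_sequentially)
      have "dist (G n m x) (G n k x) < e" if "x \<in> mspace X" "m \<ge> K" "k > m" for x m k
        using G_diff'[OF that(1), of n m "k - m"] K[OF that(2)] that(3) by (simp add: dist_real_def)
      then show "\<exists>M. \<forall>x\<in>mspace X. \<forall>m\<ge>M. \<forall>k>m. dist (G n m x) (G n k x) < e" by blast
    qed
    then show ?thesis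
      using Cauchy_uniformly_convergent unfolding uniformly_convergent_on_def by blast
  qed
  then obtain q where q: "\<And>n. uniform_limit (mspace X) (G n) (q n) sequentially" by metis
  have q_lim: "(\<lambda>k. G n k x) \<longlonglongrightarrow> q n x" if "x \<in> mspace X" for n x
    by (rule tendsto_uniform_limitI[OF q that])
  show ?thesis
  proof (rule that[of q])
    have F_cont: "continuous_on UNIV (F n)" for n
      by (rule lipschitz_on_continuous_on[of 1]) (auto intro!: lipschitz_onI simp: dist_real_def F)
    show "continuous_map (mtopology_of X) euclideanreal (q n)" for n
    proof -
      have descend_cont: "continuous_on UNIV (descend F n k)" for k
        by (rule lipschitz_on_continuous_on[of 1])
          (auto intro!: lipschitz_onI descend_lipschitz simp: dist_real_def F)
      have "continuous_map (mtopology_of X) euclideanreal (G n k)" for k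
        using continuous_map_compose[OF P, of euclideanreal "descend F n k"] descend_cont
        by (simp add: G_def[abs_def] o_def)
      moreover have "\<forall>\<^sub>F k in sequentially. \<forall>x\<in>mspace X. dist (G n k x) (q n x) < e" if "e > 0" for e
        using uniform_limitD[OF q that] .
      ultimately have "continuous_map (mtopology_of X) Met_TC.mtopology (q n)"
        by (intro Met_TC.continuous_map_uniform_limit[where F = sequentially and f = "G n"]) auto
      then show ?thesis by simp
    qed
    show "\<bar>q n x - P n x\<bar> \<le> 2 * \<eta> n" if x: "x \<in> mspace X" for n x
    proof (rule LIMSEQ_le_const2)
      show "(\<lambda>k. \<bar>G n k x - P n x\<bar>) \<longlonglongrightarrow> \<bar>q n x - P n x\<bar>"
        by (intro tendsto_intros q_lim x)
      show "\<exists>N. \<forall>k\<ge>N. \<bar>G n k x - P n x\<bar> \<le> 2 * \<eta> n"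
        using G_diff'[OF x, of n 0] by (auto simp: G_def mult.commute)
    qed
    show "F n (q (Suc n) x) = q n x" if x: "x \<in> mspace X" for n x
    proof (rule LIMSEQ_unique)
      show "(\<lambda>k. G n (Suc k) x) \<longlonglongrightarrow> q n x" using q_lim[OF x] by (rule LIMSEQ_Suc)
      have "G n (Suc k) x = F n (G (Suc n) k x)" for k
        by (simp only: G_def descend_Suc add_Suc_right add_Suc)
      moreover have "(\<lambda>k. F n (G (Suc n) k x)) \<longlonglongrightarrow> F n (q (Suc n) x)"
        by (rule continuous_on_tendsto_compose[OF F_cont q_lim[OF x]]) auto
      ultimately show "(\<lambda>k. G n (Suc k) x) \<longlonglongrightarrow> F n (q (Suc n) x)" by simp
    qed
  qed
qed

text \<open>The thickened sets \<open>S n\<close> contain points that do not come from X, but no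
  thread does: a thread is within \<open>6 * \<eta> n\<close> of a common point of X at every stage,
  and descending from ever later stages turns this closeness into equality.\<close>

lemma inverse_limit_if_real_embeddable:
  fixes X :: "'a metric"
  assumes X: "compact_space (mtopology_of X)"
    and emb: "\<And>e. e > 0 \<Longrightarrow> \<exists>f. real_embeddable_up_to X e f"
  shows "inverse_limit_of_intervals (mtopology_of X)"
proof -
  obtain P \<eta> F where P: "\<And>n. continuous_map (mtopology_of X) euclideanreal (P n)"
    and \<eta>: "\<And>n. \<eta> n > 0" "\<And>n. \<eta> (Suc n) \<le> \<eta> n / 2"
    and sep: "\<And>n x y. \<lbrakk>x \<in> mspace X; y \<in> mspace X; \<bar>P n x - P n y\<bar> < 6 * \<eta> n\<rbrakk> \<Longrightarrow> mdist X x y < (1/2)^n"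
    and F: "\<And>n s t. \<bar>F n s - F n t\<bar> \<le> \<bar>s - t\<bar>"
    and FP: "\<And>n x. x \<in> mspace X \<Longrightarrow> \<bar>F n (P (Suc n) x) - P n x\<bar> \<le> \<eta> n"
    using approximate_inverse_system[OF X emb] by blast
  obtain q where cq: "\<And>n. continuous_map (mtopology_of X) euclideanreal (q n)"
    and qP: "\<And>n x. x \<in> mspace X \<Longrightarrow> \<bar>q n x - P n x\<bar> \<le> 2 * \<eta> n"
    and Fq: "\<And>n x. x \<in> mspace X \<Longrightarrow> F n (q (Suc n) x) = q n x"
    using exact_inverse_system[of X P \<eta> F, OF P \<eta> F FP] by blast
  txt \<open>\<open>F n\<close> maps \<open>S (Suc n)\<close> into \<open>S n\<close> because \<open>4 \<eta> (Suc n) + \<eta> n \<le> 3 \<eta> n\<close>.\<close>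
  define S where "S n = {s. \<exists>x\<in>mspace X. \<bar>s - P n x\<bar> \<le> 4 * \<eta> n}" for n
  have S_compact: "compact (S n)" for n
  proof -
    have "compact (P n ` mspace X)"
      using image_compactin[OF X[unfolded compact_space_def] P[of n]] by simp
    then have "compact {s + t |s t. s \<in> P n ` mspace X \<and> t \<in> {- 4 * \<eta> n..4 * \<eta> n}}"
      by (intro compact_sums) auto
    moreover have "S n = {s + t |s t. s \<in> P n ` mspace X \<and> t \<in> {- 4 * \<eta> n..4 * \<eta> n}}"
    proof (intro subset_antisym subsetI)
      fix s assume "s \<in> S n"
      then obtain x where x: "x \<in> mspace X" "\<bar>s - P n x\<bar> \<le> 4 * \<eta> n" by (auto simp: S_def)
      then have "s = P n x + (s - P n x)" "s - P n x \<in> {- 4 * \<eta> n..4 * \<eta> n}" by auto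
      with x(1) show "s \<in> {s + t |s t. s \<in> P n ` mspace X \<and> t \<in> {- 4 * \<eta> n..4 * \<eta> n}}" by blast
    next
      fix s assume "s \<in> {s + t |s t. s \<in> P n ` mspace X \<and> t \<in> {- 4 * \<eta> n..4 * \<eta> n}}"
      then obtain x t where "x \<in> mspace X" "s = P n x + t" "\<bar>t\<bar> \<le> 4 * \<eta> n" by (auto simp: abs_le_iff)
      then show "s \<in> S n" unfolding S_def by force
    qed
    ultimately show ?thesis by simp
  qed
  have "\<exists>N h. homeomorphic_map (intervals_top N) (top_of_set (S n)) h" for n
  proof (rule homeomorphic_intervals_top[OF S_compact])
    show "0 < 4 * \<eta> n" using \<eta>(1) by simp
    fix s assume "s \<in> S n"
    then obtain x where x: "x \<in> mspace X" "\<bar>s - P n x\<bar> \<le> 4 * \<eta> n" by (auto simp: S_def)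
    have "\<bar>t - P n x\<bar> \<le> 4 * \<eta> n" if "t \<in> {P n x - 4 * \<eta> n..P n x + 4 * \<eta> n}" for t
      using that by (auto simp: abs_le_iff)
    then have "{P n x - 4 * \<eta> n..P n x + 4 * \<eta> n} \<subseteq> S n" using x(1) unfolding S_def by blast
    moreover have "s \<in> {P n x - 4 * \<eta> n..P n x + 4 * \<eta> n}" using x(2) by (auto simp: abs_le_iff)
    ultimately show "\<exists>c. s \<in> {c - 4 * \<eta> n..c + 4 * \<eta> n} \<and> {c - 4 * \<eta> n..c + 4 * \<eta> n} \<subseteq> S n" by blast
  qed blast
  then obtain N h g where hg: "\<And>n. homeomorphic_maps (intervals_top (N n)) (top_of_set (S n)) (h n) (g n)"
    unfolding homeomorphic_map_maps by metis
  have ch: "continuous_map (intervals_top (N n)) (top_of_set (S n)) (h n)"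
    and cg: "continuous_map (top_of_set (S n)) (intervals_top (N n)) (g n)"
    and gh: "\<And>p. p \<in> topspace (intervals_top (N n)) \<Longrightarrow> g n (h n p) = p"
    and hg': "\<And>s. s \<in> S n \<Longrightarrow> h n (g n s) = s" for n
    using hg[of n] by (auto simp: homeomorphic_maps_def simp del: topspace_intervals_top)
  have FS: "F n s \<in> S n" if s: "s \<in> S (Suc n)" for n s
  proof -
    obtain x where x: "x \<in> mspace X" "\<bar>s - P (Suc n) x\<bar> \<le> 4 * \<eta> (Suc n)"
      using s unfolding S_def by blast
    have "\<bar>F n s - P n x\<bar> \<le> 4 * \<eta> n"
      using F[of n s "P (Suc n) x"] FP[OF x(1), of n] x(2) \<eta>(1)[of n] \<eta>(2)[of n] by linarith
    with x(1) show ?thesis by (auto simp: S_def)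
  qed
  have qS: "q n x \<in> S n" if "x \<in> mspace X" for n x
  proof -
    have "\<bar>q n x - P n x\<bar> \<le> 4 * \<eta> n" using qP[OF that, of n] \<eta>(1)[of n] by linarith
    with that show ?thesis unfolding S_def by blast
  qed
  define f where "f n = g n \<circ> (F n \<circ> h (Suc n))" for n
  have cf: "continuous_map (intervals_top (N (Suc n))) (intervals_top (N n)) (f n)" for n
    unfolding f_def
  proof (intro continuous_map_compose[OF _ cg] continuous_map_compose[OF ch])
    have "continuous_on (S (Suc n)) (F n)"
      by (rule lipschitz_on_continuous_on[of 1]) (auto intro!: lipschitz_onI simp: dist_real_def F)
    then show "continuous_map (top_of_set (S (Suc n))) (top_of_set (S n)) (F n)"
      using FS by auto
  qed
  let ?L = "inverse_limit (\<lambda>n. intervals_top (N n)) f"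
  have top: "topspace ?L = {z. (\<forall>n. z n \<in> topspace (intervals_top (N n))) \<and> (\<forall>n. f n (z (Suc n)) = z n)}"
    by (auto simp: inverse_limit_def simp del: topspace_intervals_top)
  have gS: "g n s \<in> topspace (intervals_top (N n))" if "s \<in> S n" for n s
    using continuous_map_image_subset_topspace[OF cg] that by (auto simp: image_subset_iff simp del: topspace_intervals_top)
  have hS: "h n p \<in> S n" if "p \<in> topspace (intervals_top (N n))" for n p
    using continuous_map_image_subset_topspace[OF ch] that by (auto simp: image_subset_iff simp del: topspace_intervals_top)
  define \<Phi> where "\<Phi> x n = g n (q n x)" for x n
  have \<Phi>: "\<Phi> x \<in> topspace ?L" if x: "x \<in> mspace X" for x
    using x by (auto simp: top \<Phi>_def f_def hg' qS Fq gS simp del: topspace_intervals_top)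
  have "homeomorphic_map (mtopology_of X) ?L \<Phi>"
  proof (rule continuous_imp_homeomorphic_map[OF _ X])
    have c: "continuous_map (mtopology_of X) (intervals_top (N n)) (\<lambda>x. \<Phi> x n)" for n
    proof -
      have "continuous_map (mtopology_of X) (top_of_set (S n)) (q n)"
        using cq qS by (auto simp: continuous_map_in_subtopology)
      from continuous_map_compose[OF this cg] show ?thesis by (simp add: o_def \<Phi>_def)
    qed
    then show "continuous_map (mtopology_of X) ?L \<Phi>"
      unfolding inverse_limit_def continuous_map_in_subtopology continuous_map_componentwise_UNIV
      using \<Phi> by (auto simp: top)
    show "Hausdorff_space ?L"
      unfolding inverse_limit_def
      by (intro Hausdorff_space_subtopology) (simp add: Hausdorff_space_product_topology)
    show "inj_on \<Phi> (topspace (mtopology_of X))"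
    proof (rule inj_onI)
      fix x y assume "x \<in> topspace (mtopology_of X)" "y \<in> topspace (mtopology_of X)" and eq: "\<Phi> x = \<Phi> y"
      then have xy: "x \<in> mspace X" "y \<in> mspace X" by auto
      \<comment> \<open>Equal threads have equal \<open>q n\<close>, so the values of
        \<open>P n\<close> differ by at most twice the correction, \<open>4 * \<eta> n\<close>,
        which is below the separation threshold.\<close>
      have "mdist X x y < (1/2)^n" for n
      proof (rule sep[OF xy])
        have "q n x = q n y" using fun_cong[OF eq, of n] hg' qS xy by (metis \<Phi>_def)
        then show "\<bar>P n x - P n y\<bar> < 6 * \<eta> n"
          using qP[OF xy(1), of n] qP[OF xy(2), of n] \<eta>(1)[of n] by linarith
      qed
      then have "mdist X x y \<le> 0"
        using LIMSEQ_le_const[OF LIMSEQ_power_zero[of "1/2::real"], of "mdist X x y"]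
        by (force intro: less_imp_le)
      then show "x = y"
        using Metric_space.nonneg[OF Metric_space_mspace_mdist, of X x y] mdist_eq_0_iff[OF xy] by simp
    qed
    show "\<Phi> ` topspace (mtopology_of X) = topspace ?L"
    proof (intro subset_antisym subsetI)
      fix z assume "z \<in> topspace ?L"
      then have z: "\<And>n. z n \<in> topspace (intervals_top (N n))" "\<And>n. f n (z (Suc n)) = z n"
        by (auto simp: top simp del: topspace_intervals_top)
      define w where "w n = h n (z n)" for n
      have wS: "w n \<in> S n" for n unfolding w_def by (rule hS[OF z(1)])
      have Fw: "F n (w (Suc n)) = w n" for n
        using z(2)[of n] hg'[of "F n (w (Suc n))" n] FS[OF wS[of "Suc n"]] by (simp add: w_def f_def)
      \<comment> \<open>The thread value \<open>w n\<close> is within \<open>4 * \<eta> n\<close> of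
        some value P n x, and q n x is within \<open>2 * \<eta> n\<close> of P n x, so 6 guarantees
        non-emptiness. The sets decrease because \<open>F n\<close> is 1-Lipschitz and
        \<open>6 * \<eta> (Suc n)\<close> is at most \<open>3 * \<eta> n\<close>.\<close>
      define K where "K n = {x \<in> topspace (mtopology_of X). q n x \<in> {w n - 6 * \<eta> n..w n + 6 * \<eta> n}}" for n
      have "(\<Inter>n. K n) \<noteq> {}"
      proof (rule compact_space_imp_nest[OF X])
        show "closedin (mtopology_of X) (K n)" for n
          unfolding K_def by (rule closedin_continuous_map_preimage[OF cq]) simp
        show "K n \<noteq> {}" for n
        proof -
          obtain x where x: "x \<in> mspace X" "\<bar>w n - P n x\<bar> \<le> 4 * \<eta> n" using wS[of n] by (auto simp: S_def)
          have "q n x \<in> {w n - 6 * \<eta> n..w n + 6 * \<eta> n}"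
            using x(2) qP[OF x(1), of n] unfolding atLeastAtMost_iff by linarith
          with x(1) show ?thesis by (auto simp: K_def)
        qed
        show "decseq K"
        proof (rule decseq_SucI, rule subsetI)
          fix n x assume "x \<in> K (Suc n)"
          then have x: "x \<in> mspace X" "\<bar>q (Suc n) x - w (Suc n)\<bar> \<le> 6 * \<eta> (Suc n)"
            by (auto simp: K_def abs_le_iff)
          have "\<bar>q n x - w n\<bar> \<le> 6 * \<eta> n"
            using F[of n "q (Suc n) x" "w (Suc n)"] x(2) Fq[OF x(1)] Fw \<eta>(1)[of n] \<eta>(2)[of n]
            by simp
          then have "q n x \<in> {w n - 6 * \<eta> n..w n + 6 * \<eta> n}" unfolding atLeastAtMost_iff by linarith
          with x(1) show "x \<in> K n" by (simp add: K_def)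
        qed
      qed
      then obtain x where x: "\<And>n. x \<in> K n" by blast
      then have xX: "x \<in> mspace X" by (auto simp: K_def)
      have close: "\<bar>q n x - w n\<bar> \<le> 6 * \<eta> n" for n using x[of n] by (auto simp: K_def abs_le_iff)
      \<comment> \<open>Both sides are images of stage n + k under a 1-Lipschitz map, so their
        distance is at most \<open>6 * \<eta> (n + k)\<close> for every k.\<close>
      have "q n x = w n" for n
      proof -
        have "\<bar>q n x - w n\<bar> \<le> 6 * (\<eta> n * (1/2)^k)" for k
        proof -
          have "\<bar>descend F n k (q (n + k) x) - descend F n k (w (n + k))\<bar> \<le> \<bar>q (n + k) x - w (n + k)\<bar>"
            by (rule descend_lipschitz) (rule F)
          also have "\<dots> \<le> 6 * \<eta> (n + k)" by (rule close)
          also have "\<dots> \<le> 6 * (\<eta> n * (1/2)^k)" using halving_bound[of \<eta> n k] \<eta>(2) by simp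
          finally show ?thesis
            using descend_compatible[of F "\<lambda>n. q n x" n k] descend_compatible[of F w n k] Fq[OF xX] Fw by simp
        qed
        moreover have "(\<lambda>k. 6 * (\<eta> n * (1/2)^k)) \<longlonglongrightarrow> 6 * (\<eta> n * 0)"
          by (intro tendsto_intros LIMSEQ_power_zero) simp
        ultimately have "\<bar>q n x - w n\<bar> \<le> 6 * (\<eta> n * 0)" by (intro LIMSEQ_le_const) blast+
        then show ?thesis by simp
      qed
      then have "\<Phi> x = z" using gh[OF z(1)] by (auto simp: \<Phi>_def w_def)
      with xX show "z \<in> \<Phi> ` topspace (mtopology_of X)" by auto
    qed (use \<Phi> in auto)
  qed
  then have "mtopology_of X homeomorphic_space ?L" by (rule homeomorphic_map_imp_homeomorphic_space)
  with cf show ?thesis unfolding inverse_limit_of_intervals_def by blast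
qed

section \<open>Algebras of continuous functions\<close>

text \<open>An isomorphic copy along a map of types. The inverse is taken on \<open>UNIV\<close> so
  that it undoes \<Phi> on every element, inside the carrier or not; this is why the lemmas assume
  \<open>inj \<Phi>\<close>.\<close>

definition transport :: "('a \<Rightarrow> 'b) \<Rightarrow> 'a cstar \<Rightarrow> 'b cstar" where
  "transport \<Phi> A = \<lparr>
     carrier = \<Phi> ` carrier A,
     mult = \<lambda>x y. \<Phi> (inv_into UNIV \<Phi> x \<otimes>\<^bsub>A\<^esub> inv_into UNIV \<Phi> y),
     one = \<Phi> \<one>\<^bsub>A\<^esub>,
     zero = \<Phi> \<zero>\<^bsub>A\<^esub>,
     add = \<lambda>x y. \<Phi> (inv_into UNIV \<Phi> x \<oplus>\<^bsub>A\<^esub> inv_into UNIV \<Phi> y),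
     smult = \<lambda>c x. \<Phi> (c \<odot>\<^bsub>A\<^esub> inv_into UNIV \<Phi> x),
     star = \<lambda>x. \<Phi> (star A (inv_into UNIV \<Phi> x)),
     nrm = \<lambda>x. nrm A (inv_into UNIV \<Phi> x) \<rparr>"

lemma transport_simps:
  assumes inj: "inj \<Phi>"
  shows
  "carrier (transport \<Phi> A) = \<Phi> ` carrier A"
  "\<zero>\<^bsub>transport \<Phi> A\<^esub> = \<Phi> \<zero>\<^bsub>A\<^esub>"
  "\<Phi> a \<otimes>\<^bsub>transport \<Phi> A\<^esub> \<Phi> b = \<Phi> (a \<otimes>\<^bsub>A\<^esub> b)"
  "\<Phi> a \<oplus>\<^bsub>transport \<Phi> A\<^esub> \<Phi> b = \<Phi> (a \<oplus>\<^bsub>A\<^esub> b)"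
  "c \<odot>\<^bsub>transport \<Phi> A\<^esub> \<Phi> a = \<Phi> (c \<odot>\<^bsub>A\<^esub> a)"
  "star (transport \<Phi> A) (\<Phi> a) = \<Phi> (star A a)"
  "nrm (transport \<Phi> A) (\<Phi> a) = nrm A a"
  using inj by (simp_all add: transport_def)

lemma abelian_group_transport:
  assumes inj: "inj \<Phi>" and "abelian_group A"
  shows "abelian_group (transport \<Phi> A)"
proof -
  note simps = transport_simps[OF inj]
  interpret abelian_group A by fact
  show ?thesis
  proof (rule abelian_groupI)
    fix x assume "x \<in> carrier (transport \<Phi> A)"
    then obtain a where a: "a \<in> carrier A" "x = \<Phi> a" by (auto simp: simps)
    have "\<Phi> (\<ominus>\<^bsub>A\<^esub> a) \<oplus>\<^bsub>transport \<Phi> A\<^esub> x = \<zero>\<^bsub>transport \<Phi> A\<^esub>"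
      using a by (simp add: simps l_neg)
    moreover have "\<Phi> (\<ominus>\<^bsub>A\<^esub> a) \<in> carrier (transport \<Phi> A)" using a by (auto simp: simps)
    ultimately show "\<exists>y\<in>carrier (transport \<Phi> A). y \<oplus>\<^bsub>transport \<Phi> A\<^esub> x = \<zero>\<^bsub>transport \<Phi> A\<^esub>" by blast
  qed (auto simp: simps a_ac)
qed

lemma transport_minus:
  assumes inj: "inj \<Phi>" and "abelian_group A" "a \<in> carrier A" "b \<in> carrier A"
  shows "\<Phi> a \<ominus>\<^bsub>transport \<Phi> A\<^esub> \<Phi> b = \<Phi> (a \<ominus>\<^bsub>A\<^esub> b)"
proof -
  note simps = transport_simps[OF inj]
  interpret A: abelian_group A by fact
  interpret T: abelian_group "transport \<Phi> A" by (rule abelian_group_transport) fact+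
  have "\<ominus>\<^bsub>transport \<Phi> A\<^esub> \<Phi> b = \<Phi> (\<ominus>\<^bsub>A\<^esub> b)"
    using assms(3,4) by (intro T.minus_equality) (auto simp: simps A.l_neg)
  then show ?thesis by (simp add: a_minus_def simps)
qed

lemma transport_finsum:
  assumes inj: "inj \<Phi>" and "abelian_group A" "finite S" "\<And>i. i \<in> S \<Longrightarrow> g i \<in> carrier A"
  shows "(\<Oplus>\<^bsub>transport \<Phi> A\<^esub>i\<in>S. \<Phi> (g i)) = \<Phi> (\<Oplus>\<^bsub>A\<^esub>i\<in>S. g i)"
proof -
  note simps = transport_simps[OF inj]
  interpret A: abelian_group A by fact
  interpret T: abelian_group "transport \<Phi> A" by (rule abelian_group_transport) fact+
  show ?thesis
    using assms(3,4)
  proof (induction S)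
    case (insert i S)
    then have "(\<Oplus>\<^bsub>transport \<Phi> A\<^esub>j\<in>insert i S. \<Phi> (g j)) = \<Phi> (g i) \<oplus>\<^bsub>transport \<Phi> A\<^esub> (\<Oplus>\<^bsub>transport \<Phi> A\<^esub>j\<in>S. \<Phi> (g j))"
      by (intro T.finsum_insert) (auto simp: simps)
    also have "\<dots> = \<Phi> (g i \<oplus>\<^bsub>A\<^esub> (\<Oplus>\<^bsub>A\<^esub>j\<in>S. g j))" using insert by (simp add: simps)
    also have "g i \<oplus>\<^bsub>A\<^esub> (\<Oplus>\<^bsub>A\<^esub>j\<in>S. g j) = (\<Oplus>\<^bsub>A\<^esub>j\<in>insert i S. g j)"
      using insert by (intro A.finsum_insert[symmetric]) auto
    finally show ?case .
  qed (simp add: simps)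
qed

lemma cstar_algebra_transport:
  assumes inj: "inj \<Phi>" and "cstar_algebra A"
  shows "cstar_algebra (transport \<Phi> A)"
proof -
  note simps = transport_simps[OF inj]
  interpret A: cstar_algebra A by fact
  have ab: "abelian_group A" by (rule A.abelian_group_axioms)
  show ?thesis
  proof (intro cstar_algebra.intro cstar_algebra_axioms.intro)
    show "abelian_group (transport \<Phi> A)" by (rule abelian_group_transport[OF inj ab])
  next
    fix s :: "nat \<Rightarrow> 'b"
    assume s: "\<And>n. s n \<in> carrier (transport \<Phi> A)"
      and Cau: "\<forall>e>0. \<exists>N. \<forall>m\<ge>N. \<forall>n\<ge>N. nrm (transport \<Phi> A) (s m \<ominus>\<^bsub>transport \<Phi> A\<^esub> s n) < e"
    obtain r where r: "\<And>n. r n \<in> carrier A" "\<And>n. s n = \<Phi> (r n)"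
      using s unfolding simps image_iff by metis
    have d: "nrm (transport \<Phi> A) (\<Phi> a \<ominus>\<^bsub>transport \<Phi> A\<^esub> \<Phi> b) = nrm A (a \<ominus>\<^bsub>A\<^esub> b)"
      if "a \<in> carrier A" "b \<in> carrier A" for a b
      using that by (simp add: transport_minus[OF inj ab] simps)
    from Cau have "\<forall>e>0. \<exists>N. \<forall>m\<ge>N. \<forall>n\<ge>N. nrm A (r m \<ominus>\<^bsub>A\<^esub> r n) < e"
      by (simp add: r d)
    then obtain l where "l \<in> carrier A" "(\<lambda>n. nrm A (r n \<ominus>\<^bsub>A\<^esub> l)) \<longlonglongrightarrow> 0"
      using A.complete[of r] r(1) by blast
    then show "\<exists>l\<in>carrier (transport \<Phi> A). (\<lambda>n. nrm (transport \<Phi> A) (s n \<ominus>\<^bsub>transport \<Phi> A\<^esub> l)) \<longlonglongrightarrow> 0"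
      by (intro bexI[of _ "\<Phi> l"]) (simp_all add: r d simps)
  qed (auto simp: simps A.smult_closed A.smult_l_distr A.smult_r_distr A.smult_assoc A.smult_one
      A.mult_closed A.mult_assoc A.l_distr A.r_distr A.smult_mult_l A.smult_mult_r A.star_closed A.star_star
      A.star_add A.star_smult A.star_mult A.nrm_nonneg A.nrm_eq_0 A.nrm_triangle A.nrm_smult A.nrm_mult
      A.cstar_identity inj_eq[OF inj])
qed

section \<open>C[0,1] tensored with a finite-dimensional commutative algebra\<close>

lemma C_alg_simps:
  "f \<in> carrier (C_alg K) \<longleftrightarrow> f \<in> extensional (topspace K) \<and> continuous_map K euclidean f"
  "\<zero>\<^bsub>C_alg K\<^esub> = (\<lambda>x\<in>topspace K. 0)"
  "f \<otimes>\<^bsub>C_alg K\<^esub> g = (\<lambda>x\<in>topspace K. f x * g x)"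
  "f \<oplus>\<^bsub>C_alg K\<^esub> g = (\<lambda>x\<in>topspace K. f x + g x)"
  "c \<odot>\<^bsub>C_alg K\<^esub> f = (\<lambda>x\<in>topspace K. c * f x)"
  "star (C_alg K) f = (\<lambda>x\<in>topspace K. cnj (f x))"
  by (simp_all add: C_alg_def)

lemma restrict_in_C_alg: "continuous_map K euclidean f \<Longrightarrow> restrict f (topspace K) \<in> carrier (C_alg K)"
  by (auto simp: C_alg_simps intro: continuous_map_eq)

lemma C_alg_finsum:
  assumes "finite S" "\<And>i. i \<in> S \<Longrightarrow> f i \<in> carrier (C_alg K)"
  shows "(\<Oplus>\<^bsub>C_alg K\<^esub>i\<in>S. f i) = (\<lambda>x\<in>topspace K. \<Sum>i\<in>S. f i x)"
proof -
  interpret abelian_group "C_alg K" by (rule abelian_group_C_alg)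
  show ?thesis
    using assms
  proof (induction S)
    case (insert i S)
    then have "(\<Oplus>\<^bsub>C_alg K\<^esub>j\<in>insert i S. f j) = f i \<oplus>\<^bsub>C_alg K\<^esub> (\<Oplus>\<^bsub>C_alg K\<^esub>j\<in>S. f j)"
      by (intro finsum_insert) auto
    with insert show ?case by (auto simp: C_alg_simps)
  qed (simp add: C_alg_simps)
qed

text \<open>This is \<complex>^m with pointwise operations; its coordinates label the m copies of
  [0,1].\<close>

abbreviation finite_C_alg :: "nat \<Rightarrow> (nat \<Rightarrow> complex) cstar" where
  "finite_C_alg m \<equiv> C_alg (discrete_topology {1..m})"

lemma finite_dimensional_finite_C_alg: "finite_dimensional (finite_C_alg m)"
proof -
  define \<delta> :: "nat \<Rightarrow> nat \<Rightarrow> complex" where "\<delta> j = (\<lambda>i\<in>{1..m}. if i = j then 1 else 0)" for j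
  have \<delta>: "\<delta> j \<in> carrier (finite_C_alg m)" for j by (simp add: \<delta>_def C_alg_simps)
  have inj: "inj_on \<delta> {1..m}"
  proof (rule inj_onI)
    fix i j assume "i \<in> {1..m}" "\<delta> i = \<delta> j"
    then have "\<delta> i i = \<delta> j i" by simp
    with \<open>i \<in> {1..m}\<close> show "i = j" by (auto simp: \<delta>_def split: if_splits)
  qed
  \<comment> \<open>In \<open>finite_dimensional\<close> a coefficient is a function of the spanning
    vector itself, not of an index. The sum of x j * s j equals x i when s is the indicator of i, so
    the index need not be recovered.\<close>
  have "x = (\<Oplus>\<^bsub>finite_C_alg m\<^esub>s\<in>\<delta> ` {1..m}. (\<Sum>j\<in>{1..m}. x j * s j) \<odot>\<^bsub>finite_C_alg m\<^esub> s)"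
    if x: "x \<in> carrier (finite_C_alg m)" for x
  proof (rule extensionalityI)
    have closed: "c \<odot>\<^bsub>finite_C_alg m\<^esub> \<delta> i \<in> carrier (finite_C_alg m)" for c i by (simp add: C_alg_simps)
    show "x \<in> extensional {1..m}" using x by (simp add: C_alg_simps)
    show "(\<Oplus>\<^bsub>finite_C_alg m\<^esub>s\<in>\<delta> ` {1..m}. (\<Sum>j\<in>{1..m}. x j * s j) \<odot>\<^bsub>finite_C_alg m\<^esub> s) \<in> extensional {1..m}"
      using closed by (subst C_alg_finsum) auto
    fix k assume k: "k \<in> {1..m}"
    have "(\<Oplus>\<^bsub>finite_C_alg m\<^esub>s\<in>\<delta> ` {1..m}. (\<Sum>j\<in>{1..m}. x j * s j) \<odot>\<^bsub>finite_C_alg m\<^esub> s) k =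
        (\<Sum>s\<in>\<delta> ` {1..m}. ((\<Sum>j\<in>{1..m}. x j * s j) \<odot>\<^bsub>finite_C_alg m\<^esub> s) k)"
      using closed k by (subst C_alg_finsum) auto
    also have "\<dots> = (\<Sum>s\<in>\<delta> ` {1..m}. (\<Sum>j\<in>{1..m}. x j * s j) * s k)"
      using k by (simp add: C_alg_simps)
    also have "\<dots> = (\<Sum>i\<in>{1..m}. (\<Sum>j\<in>{1..m}. x j * \<delta> i j) * \<delta> i k)"
      by (subst sum.reindex[OF inj]) simp
    also have "\<dots> = (\<Sum>i\<in>{1..m}. if i = k then (\<Sum>j\<in>{1..m}. x j * \<delta> i j) else 0)"
      using k by (intro sum.cong) (auto simp: \<delta>_def)
    also have "\<dots> = (\<Sum>j\<in>{1..m}. x j * \<delta> k j)" using k by simp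
    also have "\<dots> = (\<Sum>j\<in>{1..m}. if j = k then x j else 0)"
      by (intro sum.cong) (auto simp: \<delta>_def)
    also have "\<dots> = x k" using k by simp
    finally show "x k = (\<Oplus>\<^bsub>finite_C_alg m\<^esub>s\<in>\<delta> ` {1..m}. (\<Sum>j\<in>{1..m}. x j * s j) \<odot>\<^bsub>finite_C_alg m\<^esub> s) k" ..
  qed
  then show ?thesis
    unfolding finite_dimensional_def using \<delta>
    by (intro exI[of _ "\<delta> ` {1..m}"] conjI ballI exI[of _ "\<lambda>s. \<Sum>j\<in>{1..m}. x j * s j" for x]) auto
qed

text \<open>\<^const>\<open>AI_algebra\<close> takes its building blocks on carriers of type \<^typ>\<open>real \<Rightarrow> nat \<Rightarrow> complex\<close>,
  whereas the points of \<^const>\<open>intervals_top\<close> are pairs \<open>(i, t)\<close>.\<close>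

definition swap_curry :: "(nat \<times> real \<Rightarrow> complex) \<Rightarrow> real \<Rightarrow> nat \<Rightarrow> complex" where
  "swap_curry g t i = g (i, t)"

lemma inj_swap_curry: "inj swap_curry"
  by (rule injI) (metis ext surj_pair swap_curry_def)

definition intervals_alg :: "nat \<Rightarrow> (real \<Rightarrow> nat \<Rightarrow> complex) cstar" where
  "intervals_alg m = transport swap_curry (C_alg (intervals_top m))"

text \<open>The elementary tensor of a and b when C[0,1] \<otimes> \<complex>^m is realised as the
  functions on m copies of [0,1].\<close>

definition ptensor :: "nat \<Rightarrow> (real \<Rightarrow> complex) \<Rightarrow> (nat \<Rightarrow> complex) \<Rightarrow> nat \<times> real \<Rightarrow> complex" where
  "ptensor m a b = (\<lambda>p\<in>{1..m} \<times> {0..1}. a (snd p) * b (fst p))"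

lemma cstar_algebra_intervals_alg: "cstar_algebra (intervals_alg m)"
  unfolding intervals_alg_def
  by (intro cstar_algebra_transport inj_swap_curry cstar_algebra_C_alg) simp

lemmas intervals_alg_simps = transport_simps[OF inj_swap_curry, of "C_alg (intervals_top m)" for m, folded intervals_alg_def]

lemma ptensor_in_C_alg:
  assumes "a \<in> carrier (C_alg (top_of_set {0..1}))"
  shows "ptensor m a b \<in> carrier (C_alg (intervals_top m))"
proof -
  have "continuous_on {0..1} a" using assms by (simp add: C_alg_simps)
  then have "continuous_on ({1..m} \<times> {0..1}) (\<lambda>p. a (snd p))"
    by (rule continuous_on_compose2) (auto intro: continuous_intros)
  then have "continuous_map (intervals_top m) euclidean (\<lambda>p. a (snd p) * b (fst p))"
    unfolding intervals_top_eq by (auto intro!: continuous_intros continuous_on_fst_nat)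
  then show ?thesis unfolding ptensor_def using restrict_in_C_alg by fastforce
qed

text \<open>For injectivity, fixing t turns a vanishing sum of tensors into a linear relation
  between the v i with coefficients u i t. Density holds exactly: g is the sum of the m tensors of
  its restriction to a copy with the indicator of that copy.\<close>

lemma cstar_tensor_intervals_alg:
  "cstar_tensor (C_alg (top_of_set {0..1})) (finite_C_alg m) (intervals_alg m)
     (\<lambda>a b. swap_curry (ptensor m a b))"
proof -
  let ?I = "C_alg (top_of_set {0..1::real})" and ?B = "finite_C_alg m" and ?Y = "C_alg (intervals_top m)"
  have sum: "(\<Oplus>\<^bsub>intervals_alg m\<^esub>i\<in>S. swap_curry (ptensor m (u i) (v i))) =
      swap_curry (\<lambda>p\<in>{1..m} \<times> {0..1}. \<Sum>i\<in>S. u i (snd p) * v i (fst p))"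
    if "finite S" "\<And>i. i \<in> S \<Longrightarrow> u i \<in> carrier ?I" for S :: "nat set" and u v
  proof -
    have "(\<Oplus>\<^bsub>intervals_alg m\<^esub>i\<in>S. swap_curry (ptensor m (u i) (v i))) = swap_curry (\<Oplus>\<^bsub>?Y\<^esub>i\<in>S. ptensor m (u i) (v i))"
      unfolding intervals_alg_def
      by (rule transport_finsum[OF inj_swap_curry abelian_group_C_alg]) (use that ptensor_in_C_alg in auto)
    also have "(\<Oplus>\<^bsub>?Y\<^esub>i\<in>S. ptensor m (u i) (v i)) = (\<lambda>p\<in>{1..m} \<times> {0..1}. \<Sum>i\<in>S. u i (snd p) * v i (fst p))"
      by (subst C_alg_finsum) (use that ptensor_in_C_alg in \<open>auto simp: ptensor_def intro!: restrict_ext\<close>)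
    finally show ?thesis .
  qed
  show ?thesis
  proof (rule cstar_tensor.intro)
    show "cstar_algebra (intervals_alg m)" by (rule cstar_algebra_intervals_alg)
  next
    fix n :: nat and u v
    assume u: "\<forall>i<n. u i \<in> carrier ?I" and v: "\<forall>i<n. v i \<in> carrier ?B" and indep: "lin_indep ?B n v"
      and zero: "(\<Oplus>\<^bsub>intervals_alg m\<^esub>i\<in>{..<n}. swap_curry (ptensor m (u i) (v i))) = \<zero>\<^bsub>intervals_alg m\<^esub>"
    have "swap_curry (\<lambda>p\<in>{1..m} \<times> {0..1}. \<Sum>i<n. u i (snd p) * v i (fst p)) =
        (\<Oplus>\<^bsub>intervals_alg m\<^esub>i\<in>{..<n}. swap_curry (ptensor m (u i) (v i)))"
      by (rule sum[symmetric]) (use u in auto)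
    also have "\<dots> = swap_curry (\<lambda>p\<in>{1..m} \<times> {0..1}. 0)"
      unfolding zero by (simp add: intervals_alg_simps C_alg_simps)
    finally have eq: "(\<lambda>p\<in>{1..m} \<times> {0..1}. \<Sum>i<n. u i (snd p) * v i (fst p)) = (\<lambda>p\<in>{1..m} \<times> {0..1::real}. 0)"
      by (rule injD[OF inj_swap_curry])
    have "u i t = 0" if t: "t \<in> {0..1}" and i: "i < n" for i t
    proof -
      have "(\<Oplus>\<^bsub>?B\<^esub>i\<in>{..<n}. u i t \<odot>\<^bsub>?B\<^esub> v i) = (\<lambda>j\<in>{1..m}. \<Sum>i<n. u i t * v i j)"
        by (subst C_alg_finsum) (use v in \<open>auto simp: C_alg_simps intro!: restrict_ext\<close>)
      also have "\<dots> = \<zero>\<^bsub>?B\<^esub>"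
      proof -
        have "(\<Sum>i<n. u i t * v i j) = 0" if "j \<in> {1..m}" for j
          using fun_cong[OF eq, of "(j, t)"] t that by simp
        then show ?thesis by (auto simp: C_alg_simps)
      qed
      finally show ?thesis using indep i unfolding lin_indep_def by (elim allE[of _ "\<lambda>i. u i t"]) blast
    qed
    then show "\<forall>i<n. u i = \<zero>\<^bsub>?I\<^esub>"
      using u by (auto simp: C_alg_simps fun_eq_iff extensional_def)
  next
    fix t and e :: real assume t: "t \<in> carrier (intervals_alg m)" and e: "0 < e"
    obtain g where g: "g \<in> carrier ?Y" "t = swap_curry g" using t by (auto simp: intervals_alg_simps)
    \<comment> \<open>Summands are numbered from 0 and copies from 1, so summand i belongs to copy
      Suc i.\<close>
    define u where "u i = (\<lambda>s\<in>{0..1}. if i < m then g (Suc i, s) else 0)" for i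
    define v :: "nat \<Rightarrow> nat \<Rightarrow> complex" where "v i = (\<lambda>j\<in>{1..m}. if j = Suc i then 1 else 0)" for i
    have gc: "continuous_on ({1..m} \<times> {0..1}) g" using g(1) by (simp add: C_alg_simps intervals_top_eq)
    have "continuous_on {0..1} (\<lambda>s. g (Suc i, s))" if "i < m" for i
      by (rule continuous_on_compose2[OF gc]) (use that in \<open>auto intro!: continuous_intros\<close>)
    then have u: "u i \<in> carrier ?I" for i
      using restrict_in_C_alg[of "top_of_set {0..1}" "\<lambda>s. if i < m then g (Suc i, s) else 0"]
      by (cases "i < m") (auto simp: u_def)
    have v: "v i \<in> carrier ?B" for i by (simp add: v_def C_alg_simps)
    have "(\<Oplus>\<^bsub>intervals_alg m\<^esub>i\<in>{..<m}. swap_curry (ptensor m (u i) (v i))) =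
        swap_curry (\<lambda>p\<in>{1..m} \<times> {0..1}. \<Sum>i<m. u i (snd p) * v i (fst p))"
      by (rule sum) (use u in auto)
    also have "(\<lambda>p\<in>{1..m} \<times> {0..1}. \<Sum>i<m. u i (snd p) * v i (fst p)) = g"
    proof (rule extensionalityI)
      show "g \<in> extensional ({1..m} \<times> {0..1})" using g(1) by (simp add: C_alg_simps)
      fix p :: "nat \<times> real" assume p: "p \<in> {1..m} \<times> {0..1}"
      obtain j s where js: "p = (Suc j, s)" "j < m" "s \<in> {0..1}"
        using p by (cases p; cases "fst p") auto
      have "(\<Sum>i<m. u i (snd p) * v i (fst p)) = (\<Sum>i<m. if i = j then g (Suc i, s) else 0)"
        using js by (intro sum.cong) (auto simp: u_def v_def)
      also have "\<dots> = g p" using js by simp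
      finally show "(\<lambda>p\<in>{1..m} \<times> {0..1}. \<Sum>i<m. u i (snd p) * v i (fst p)) p = g p" using p by simp
    qed simp
    finally have "(\<Oplus>\<^bsub>intervals_alg m\<^esub>i\<in>{..<m}. swap_curry (ptensor m (u i) (v i))) = t" using g by simp
    moreover interpret T: cstar_algebra "intervals_alg m" by (rule cstar_algebra_intervals_alg)
    have "nrm (intervals_alg m) (t \<ominus>\<^bsub>intervals_alg m\<^esub> t) < e"
      using t e T.nrm_eq_0[OF T.zero_closed] by (simp add: a_minus_def T.r_neg)
    ultimately show "\<exists>(n::nat) u v. (\<forall>i<n. u i \<in> carrier ?I) \<and> (\<forall>i<n. v i \<in> carrier ?B) \<and>
        nrm (intervals_alg m) (t \<ominus>\<^bsub>intervals_alg m\<^esub>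
          (\<Oplus>\<^bsub>intervals_alg m\<^esub>i\<in>{..<n}. swap_curry (ptensor m (u i) (v i)))) < e"
      using u v by (intro exI[of _ m] exI[of _ u] exI[of _ v]) auto
  next
    fix a b assume "a \<in> carrier ?I"
    then show "swap_curry (ptensor m a b) \<in> carrier (intervals_alg m)"
      unfolding intervals_alg_simps by (intro imageI ptensor_in_C_alg)
  qed (auto simp: intervals_alg_simps C_alg_simps ptensor_def inj_eq[OF inj_swap_curry]
      algebra_simps intro!: restrict_ext)
qed

text \<open>This is what compactness offers in place of surjective projections. The set
  \<open>K k\<close> consists of the points of the product that pass through \<open>C\<close> and
  are threads up to stage n + k; these sets are closed, nested and non-empty, and a common point is
  a full thread.\<close>

lemma inverse_limit_point_near:
  assumes Y: "\<And>i. compact_space (Y i)" "\<And>i. Hausdorff_space (Y i)"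
    and f: "\<And>i. continuous_map (Y (Suc i)) (Y i) (f i)"
    and C: "closedin (Y n) C"
    and hit: "\<And>k. \<exists>p\<in>topspace (Y (n + k)). descend f n k p \<in> C"
  obtains z where "\<And>i. z i \<in> topspace (Y i)" "\<And>i. f i (z (Suc i)) = z i" "z n \<in> C"
proof -
  let ?P = "product_topology Y UNIV"
  have fY: "f i p \<in> topspace (Y i)" if "p \<in> topspace (Y (Suc i))" for i p
    using continuous_map_image_subset_topspace[OF f] that by blast
  have descendY: "descend f i k p \<in> topspace (Y i)" if "p \<in> topspace (Y (i + k))" for i k p
    by (rule descend_in[of "\<lambda>i. topspace (Y i)", OF fY that])
  have "\<exists>p. p \<in> topspace (Y i)" for i
  proof -
    obtain p where "p \<in> topspace (Y (n + i))" using hit by blast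
    then have "descend f i n p \<in> topspace (Y i)" by (intro descendY) (simp add: add.commute)
    then show ?thesis ..
  qed
  then obtain w where w: "\<And>i. w i \<in> topspace (Y i)" by metis
  define K where "K k = {z \<in> topspace ?P. z n \<in> C} \<inter> {z \<in> topspace ?P. \<forall>i<n+k. f i (z (Suc i)) = z i}" for k
  have "(\<Inter>k. K k) \<noteq> {}"
  proof (rule compact_space_imp_nest)
    show "compact_space ?P" using Y by (simp add: compact_space_product_topology)
    have cl: "closedin ?P {z \<in> topspace ?P. f i (z (Suc i)) = z i}" for i
    proof (rule closedin_continuous_maps_eq[OF Y(2)])
      show "continuous_map ?P (Y i) (\<lambda>z. f i (z (Suc i)))"
        using continuous_map_compose[OF continuous_map_product_projection[of "Suc i" UNIV Y] f[of i]]
        by (simp add: o_def)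
    qed (simp add: continuous_map_product_projection)
    have "closedin ?P {z \<in> topspace ?P. \<forall>i<m. f i (z (Suc i)) = z i}" for m
    proof (induction m)
      case (Suc m)
      have "{z \<in> topspace ?P. \<forall>i<Suc m. f i (z (Suc i)) = z i} =
          {z \<in> topspace ?P. \<forall>i<m. f i (z (Suc i)) = z i} \<inter> {z \<in> topspace ?P. f m (z (Suc m)) = z m}"
        by (auto simp: less_Suc_eq)
      then show ?case using closedin_Int[OF Suc cl[of m]] by simp
    qed (use closedin_topspace[of ?P] in simp)
    moreover have "closedin ?P {z \<in> topspace ?P. z n \<in> C}"
      using closedin_continuous_map_preimage[OF continuous_map_product_projection[of n UNIV Y] C] by simp
    ultimately show "closedin ?P (K k)" for k unfolding K_def by (intro closedin_Int)
    show "decseq K" unfolding K_def by (rule decseq_SucI) auto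
    show "K k \<noteq> {}" for k
    proof -
      obtain p where p: "p \<in> topspace (Y (n + k))" "descend f n k p \<in> C" using hit by blast
      \<comment> \<open>Up to stage n + k the coordinates are the images of p; beyond it nothing is
        required yet, and arbitrary points \<open>w\<close> fill the product.\<close>
      define z where "z i = (if i \<le> n + k then descend f i (n + k - i) p else w i)" for i
      have "z i \<in> topspace (Y i)" for i using p(1) w by (auto simp: z_def intro!: descendY)
      moreover have "f i (z (Suc i)) = z i" if "i < n + k" for i
      proof -
        have "n + k - i = Suc (n + k - Suc i)" using that by simp
        then have "descend f i (n + k - i) p = f i (descend f (Suc i) (n + k - Suc i) p)"
          by (simp only: descend_Suc)
        with that show ?thesis by (simp add: z_def)
      qed
      moreover have "z n \<in> C" using p(2) by (simp add: z_def)
      ultimately have "z \<in> K k" by (auto simp: K_def)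
      then show ?thesis by blast
    qed
  qed
  then obtain z where z: "\<And>k. z \<in> K k" by blast
  show ?thesis
  proof (rule that[of z])
    show "z i \<in> topspace (Y i)" for i using z[of 0] by (auto simp: K_def)
    show "z n \<in> C" using z[of 0] by (auto simp: K_def)
    show "f i (z (Suc i)) = z i" for i using z[of "Suc i"] by (simp add: K_def)
  qed
qed

text \<open>The tolerance d is a modulus of uniform continuity of y, so it does not depend on p.
  Real and imaginary parts factor separately through p by \<open>lipschitz_factor\<close>, each with
  error e/2.\<close>

lemma complex_factor:
  fixes X :: "'a metric" and y :: "'a \<Rightarrow> complex"
  assumes X: "compact_space (mtopology_of X)"
    and y: "continuous_map (mtopology_of X) euclidean y" and e: "e > 0"
  obtains d where "d > 0" "\<And>p. real_embeddable_up_to X d p \<Longrightarrow>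
    \<exists>F. continuous_on UNIV F \<and> (\<forall>x\<in>mspace X. cmod (F (p x) - y x) \<le> e)"
proof -
  have cR: "continuous_map (mtopology_of X) euclideanreal (\<lambda>x. Re (y x))"
    and cI: "continuous_map (mtopology_of X) euclideanreal (\<lambda>x. Im (y x))"
    using continuous_map_compose[OF y, of euclideanreal Re] continuous_map_compose[OF y, of euclideanreal Im]
    by (simp_all add: o_def continuous_on_Re continuous_on_Im)
  obtain d1 where d1: "d1 > 0"
    "\<And>x z. \<lbrakk>x \<in> mspace X; z \<in> mspace X; mdist X x z < d1\<rbrakk> \<Longrightarrow> \<bar>Re (y x) - Re (y z)\<bar> < e/2"
    using compact_space_uniformly_continuous[OF X cR, of "e/2"] e by auto
  obtain d2 where d2: "d2 > 0"
    "\<And>x z. \<lbrakk>x \<in> mspace X; z \<in> mspace X; mdist X x z < d2\<rbrakk> \<Longrightarrow> \<bar>Im (y x) - Im (y z)\<bar> < e/2"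
    using compact_space_uniformly_continuous[OF X cI, of "e/2"] e by auto
  obtain M1 where M1: "\<And>x. x \<in> mspace X \<Longrightarrow> \<bar>Re (y x)\<bar> < M1"
    using compact_space_real_bounded[OF X cR] by auto
  obtain M2 where M2: "\<And>x. x \<in> mspace X \<Longrightarrow> \<bar>Im (y x)\<bar> < M2"
    using compact_space_real_bounded[OF X cI] by auto
  show ?thesis
  proof (rule that[of "min d1 d2"])
    fix p assume p: "real_embeddable_up_to X (min d1 d2) p"
    obtain d where d: "d > 0" "\<And>x z. \<lbrakk>x \<in> mspace X; z \<in> mspace X; \<bar>p x - p z\<bar> < d\<rbrakk> \<Longrightarrow> mdist X x z < min d1 d2"
      using small_fibres_uniform[OF X p] by blast
    \<comment> \<open>One scale serves both parts; the 0 keeps it nonnegative whatever the signs of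
      M1 and M2.\<close>
    define K where "K = max 0 (max (2 * M1 / d) (2 * M2 / d))"
    obtain F where F: "\<And>s t. \<bar>F s - F t\<bar> \<le> \<bar>s - t\<bar>" "\<And>x. x \<in> mspace X \<Longrightarrow> \<bar>F (K * p x) - Re (y x)\<bar> \<le> e/2"
    proof (rule lipschitz_factor[of d "e/2" "mspace X" "\<lambda>x. Re (y x)" M1 p K])
      show "\<bar>Re (y x) - Re (y z)\<bar> \<le> e/2" if "x \<in> mspace X" "z \<in> mspace X" "\<bar>p x - p z\<bar> < d" for x z
        using d1(2)[of x z] d(2)[of x z] that by simp
    qed (use d(1) e in \<open>auto simp: K_def intro: less_imp_le[OF M1]\<close>)
    obtain G where G: "\<And>s t. \<bar>G s - G t\<bar> \<le> \<bar>s - t\<bar>" "\<And>x. x \<in> mspace X \<Longrightarrow> \<bar>G (K * p x) - Im (y x)\<bar> \<le> e/2"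
    proof (rule lipschitz_factor[of d "e/2" "mspace X" "\<lambda>x. Im (y x)" M2 p K])
      show "\<bar>Im (y x) - Im (y z)\<bar> \<le> e/2" if "x \<in> mspace X" "z \<in> mspace X" "\<bar>p x - p z\<bar> < d" for x z
        using d2(2)[of x z] d(2)[of x z] that by simp
    qed (use d(1) e in \<open>auto simp: K_def intro: less_imp_le[OF M2]\<close>)
    have "continuous_on UNIV F" "continuous_on UNIV G"
      by (rule lipschitz_on_continuous_on[of 1]; auto intro!: lipschitz_onI simp: dist_real_def F G)+
    then have "continuous_on UNIV (\<lambda>s. F (K * s))" "continuous_on UNIV (\<lambda>s. G (K * s))"
      by (auto elim!: continuous_on_compose2 intro!: continuous_intros)
    then have "continuous_on UNIV (\<lambda>s. Complex (F (K * s)) (G (K * s)))"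
      by (intro continuous_intros)
    moreover have "cmod (Complex (F (K * p x)) (G (K * p x)) - y x) \<le> e" if x: "x \<in> mspace X" for x
      using cmod_le[of "Complex (F (K * p x)) (G (K * p x)) - y x"] F(2)[OF x] G(2)[OF x] by simp
    ultimately show "\<exists>F. continuous_on UNIV F \<and> (\<forall>x\<in>mspace X. cmod (F (p x) - y x) \<le> e)" by blast
  qed (use d1 d2 in simp)
qed

text \<open>The dual system: the algebras are C(Y i), the connecting maps are composition with f i
  and the maps to the limit are composition with p i. The substance lies in the norm formula,
  because p i may miss part of Y i, and in density.\<close>

lemma AI_algebra_if_inverse_limit:
  fixes X :: "'a metric"
  assumes X: "compact_space (mtopology_of X)"
    and lim: "inverse_limit_of_intervals (mtopology_of X)"
  shows "AI_algebra (C_alg (mtopology_of X))"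
proof -
  let ?X = "mtopology_of X" and ?inv = "inv_into UNIV swap_curry"
  obtain N f where f: "\<And>i. continuous_map (intervals_top (N (Suc i))) (intervals_top (N i)) (f i)"
    and hom: "?X homeomorphic_space inverse_limit (\<lambda>i. intervals_top (N i)) f"
    using lim unfolding inverse_limit_of_intervals_def by blast
  define Y where "Y i = intervals_top (N i)" for i
  have f: "continuous_map (Y (Suc i)) (Y i) (f i)" for i using f by (simp add: Y_def)
  obtain p where p: "\<And>i. continuous_map ?X (Y i) (p i)"
    and fp: "\<And>i x. x \<in> mspace X \<Longrightarrow> f i (p (Suc i) x) = p i x"
    and inj: "\<And>x y. \<lbrakk>x \<in> mspace X; y \<in> mspace X; \<And>i. p i x = p i y\<rbrakk> \<Longrightarrow> x = y"
    and surj: "\<And>z. \<lbrakk>\<And>i. z i \<in> topspace (Y i); \<And>i. f i (z (Suc i)) = z i\<rbrakk> \<Longrightarrow> \<exists>x\<in>mspace X. \<forall>i. p i x = z i"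
    using homeomorphic_inverse_limit_projections[OF hom, folded Y_def] by (metis topspace_mtopology_of)
  have fY: "f i t \<in> topspace (Y i)" if "t \<in> topspace (Y (Suc i))" for i t
    using continuous_map_image_subset_topspace[OF f] that by blast
  have pY: "p i x \<in> topspace (Y i)" if "x \<in> mspace X" for i x
    using continuous_map_image_subset_topspace[OF p] that by auto
  have descendY: "descend f i k t \<in> topspace (Y i)" if "t \<in> topspace (Y (i + k))" for i k t
    by (rule descend_in[of "\<lambda>i. topspace (Y i)", OF fY that])
  define T where "T i = intervals_alg (N i)" for i
  have T_def': "T i = transport swap_curry (C_alg (Y i))" for i by (simp add: T_def intervals_alg_def Y_def)
  note T_simps = transport_simps[OF inj_swap_curry, of "C_alg (Y i)" for i, folded T_def']
  define \<phi> where "\<phi> i t = swap_curry (\<lambda>s\<in>topspace (Y (Suc i)). ?inv t (f i s))" for i t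
  define \<mu> where "\<mu> i t = (\<lambda>x\<in>mspace X. ?inv t (p i x))" for i t
  have \<phi>: "\<phi> i (swap_curry g) = swap_curry (\<lambda>s\<in>topspace (Y (Suc i)). g (f i s))" for i g
    by (simp add: \<phi>_def inj_swap_curry)
  have \<mu>: "\<mu> i (swap_curry g) = (\<lambda>x\<in>mspace X. g (p i x))" for i g
    by (simp add: \<mu>_def inj_swap_curry)
  have \<phi>_closed: "(\<lambda>s\<in>topspace (Y (Suc i)). g (f i s)) \<in> carrier (C_alg (Y (Suc i)))"
    if "g \<in> carrier (C_alg (Y i))" for g i
    using that continuous_map_compose[OF f[of i], where X'' = euclidean and g = g]
      restrict_in_C_alg[of "Y (Suc i)" "\<lambda>s. g (f i s)"]
    by (simp add: C_alg_simps(1) o_def)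
  have \<mu>_closed: "(\<lambda>x\<in>mspace X. g (p i x)) \<in> carrier (C_alg ?X)" if "g \<in> carrier (C_alg (Y i))" for g i
    using that continuous_map_compose[OF p[of i], where X'' = euclidean and g = g] restrict_in_C_alg[of ?X "\<lambda>x. g (p i x)"]
    by (simp add: C_alg_simps(1) o_def)
  have conn: "connecting \<phi> n k (swap_curry g) = swap_curry (\<lambda>s\<in>topspace (Y (n + k)). g (descend f n k s))"
    if "g \<in> carrier (C_alg (Y n))" for g n k
  proof (induction k)
    case 0
    have "(\<lambda>s\<in>topspace (Y n). g s) = g" using that by (simp add: C_alg_simps(1) extensional_restrict)
    then show ?case by simp
  next
    case (Suc k)
    then show ?case by (auto simp: \<phi> fY intro!: arg_cong[where f = swap_curry] restrict_ext)
  qed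
  have Xalg: "cstar_algebra (C_alg ?X)" by (rule cstar_algebra_C_alg[OF X])
  have Tcstar: "cstar_algebra (T i)" for i unfolding T_def by (rule cstar_algebra_intervals_alg)
  have limit: "cstar_inductive_limit T \<phi> (C_alg ?X) \<mu>"
  proof (rule cstar_inductive_limit.intro)
    show "cstar_algebra (T n)" for n by (rule Tcstar)
    show "star_hom (T n) (T (Suc n)) (\<phi> n)" for n
      unfolding star_hom_def
      by (auto simp: T_simps \<phi> C_alg_simps(2-) fY intro!: \<phi>_closed arg_cong[where f = swap_curry] restrict_ext imageI)
    show "star_hom (T n) (C_alg ?X) (\<mu> n)" for n
      unfolding star_hom_def
      by (auto simp: T_simps \<mu> C_alg_simps(2-) pY intro!: \<mu>_closed restrict_ext)
    show "cstar_algebra (C_alg ?X)" by (rule Xalg)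
    show "\<mu> (Suc n) (\<phi> n x) = \<mu> n x" if "x \<in> carrier (T n)" for n x
      using that by (auto simp: T_simps \<mu> \<phi> pY fp intro!: restrict_ext)
  next
    fix n t assume "t \<in> carrier (T n)"
    then obtain g where g: "g \<in> carrier (C_alg (Y n))" "t = swap_curry g" by (auto simp: T_simps)
    let ?B = "nrm (C_alg ?X) (\<lambda>x\<in>mspace X. g (p n x))"
    let ?g = "\<lambda>k. \<lambda>s\<in>topspace (Y (n + k)). g (descend f n k s)"
    have nrm_conn: "nrm (T (n + k)) (connecting \<phi> n k t) = nrm (C_alg (Y (n + k))) (?g k)" for k
      by (simp add: g conn T_simps)
    have g_closed: "?g k \<in> carrier (C_alg (Y (n + k)))" for k
    proof -
      have "continuous_map (Y (n + k)) (Y n) (descend f n k)"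
      proof (induction k)
        case (Suc k)
        then show ?case using continuous_map_compose[OF f Suc] by (simp add: o_def)
      qed simp
      from continuous_map_compose[OF this, of euclidean g] show ?thesis
        using g(1) restrict_in_C_alg[of "Y (n + k)" "\<lambda>s. g (descend f n k s)"] by (simp add: C_alg_simps(1) o_def)
    qed
    have B: "cmod (g (p n x)) \<le> ?B" if "x \<in> mspace X" for x
      using cmod_le_nrm_C_alg[OF X \<mu>_closed[OF g(1)], of x] that by simp
    have B0: "0 \<le> ?B" using cstar_algebra.nrm_nonneg[OF Xalg \<mu>_closed[OF g(1)]] .
    have lower: "?B \<le> nrm (C_alg (Y (n + k))) (?g k)" for k
    proof (rule nrm_C_alg_le)
      have comp: "compact_space (Y (n + k))" by (simp add: Y_def)
      show "0 \<le> nrm (C_alg (Y (n + k))) (?g k)"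
        using cstar_algebra.nrm_nonneg[OF cstar_algebra_C_alg[OF comp] g_closed] .
      fix x assume "x \<in> topspace ?X"
      then have x: "x \<in> mspace X" by simp
      have "p n x = descend f n k (p (n + k) x)"
        using descend_compatible[of f "\<lambda>i. p i x" n k] fp[OF x] by simp
      then show "cmod ((\<lambda>x\<in>mspace X. g (p n x)) x) \<le> nrm (C_alg (Y (n + k))) (?g k)"
        using cmod_le_nrm_C_alg[OF comp g_closed, of "p (n + k) x"] pY[OF x] x by simp
    qed
    \<comment> \<open>If the norm stayed above ?B + e/2 at all later stages, each stage would have a
      point sent by the bonding maps into the closed set where \<bar>g\<bar> \<ge> ?B + e/2. A
      thread through that set is a point of X at which g after \<open>p n\<close> exceeds its own
      norm ?B.\<close>
    have upper: "\<forall>\<^sub>F k in sequentially. nrm (C_alg (Y (n + k))) (?g k) < ?B + e" if e: "e > 0" for e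
    proof -
      have "\<exists>k. \<forall>s\<in>topspace (Y (n + k)). cmod (g (descend f n k s)) \<le> ?B + e/2"
      proof (rule ccontr)
        assume no: "\<nexists>k. \<forall>s\<in>topspace (Y (n + k)). cmod (g (descend f n k s)) \<le> ?B + e/2"
        let ?C = "{s \<in> topspace (Y n). cmod (g s) \<in> {?B + e/2..}}"
        have "continuous_map (Y n) euclideanreal (\<lambda>s. cmod (g s))"
          using g(1) by (auto simp: C_alg_simps(1) intro: continuous_map_norm)
        then have C: "closedin (Y n) ?C" by (rule closedin_continuous_map_preimage) simp
        have hit: "\<exists>s\<in>topspace (Y (n + k)). descend f n k s \<in> ?C" for k
        proof -
          obtain s where "s \<in> topspace (Y (n + k))" "\<not> cmod (g (descend f n k s)) \<le> ?B + e/2"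
            using no by blast
          then show ?thesis using descendY[of s n k] by (intro bexI[of _ s]) auto
        qed
        obtain z where z: "\<And>i. z i \<in> topspace (Y i)" "\<And>i. f i (z (Suc i)) = z i" "z n \<in> ?C"
          by (rule inverse_limit_point_near[of Y f n ?C, OF _ _ f C hit]) (auto simp: Y_def)
        obtain x where x: "x \<in> mspace X" "\<And>i. p i x = z i" using surj[OF z(1,2)] by blast
        have "?B + e/2 \<le> cmod (g (p n x))" using z(3) x(2) by simp
        with B[OF x(1)] e show False by linarith
      qed
      then obtain k where k: "\<And>s. s \<in> topspace (Y (n + k)) \<Longrightarrow> cmod (g (descend f n k s)) \<le> ?B + e/2" by blast
      \<comment> \<open>A bound reached at stage n + k persists, since the bonding map from any
        later stage to n passes through n + k.\<close>
      have "nrm (C_alg (Y (n + j))) (?g j) < ?B + e" if "j \<ge> k" for j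
      proof -
        have split: "descend f n (k + i) s = descend f n k (descend f (n + k) i s)" for i s
          by (induction i arbitrary: s) (auto simp: add.assoc)
        have "nrm (C_alg (Y (n + j))) (?g j) \<le> ?B + e/2"
        proof (rule nrm_C_alg_le)
          fix s assume s: "s \<in> topspace (Y (n + j))"
          have "descend f (n + k) (j - k) s \<in> topspace (Y (n + k))"
            using s that by (intro descendY) simp
          then have "cmod (g (descend f n k (descend f (n + k) (j - k) s))) \<le> ?B + e/2" by (rule k)
          then show "cmod (?g j s) \<le> ?B + e/2" using s split[of "j - k" s] that by simp
        qed (use B0 e in simp)
        with e show ?thesis by linarith
      qed
      then show ?thesis by (auto simp: eventually_sequentially)
    qed
    have "(\<lambda>k. nrm (C_alg (Y (n + k))) (?g k)) \<longlonglongrightarrow> ?B"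
    proof (rule order_tendstoI)
      fix a assume "a < ?B"
      then show "\<forall>\<^sub>F k in sequentially. a < nrm (C_alg (Y (n + k))) (?g k)"
        using lower by (intro always_eventually allI) (rule less_le_trans)
    next
      fix a assume "?B < a"
      then show "\<forall>\<^sub>F k in sequentially. nrm (C_alg (Y (n + k))) (?g k) < a"
        using upper[of "a - ?B"] by simp
    qed
    then show "(\<lambda>k. nrm (T (n + k)) (connecting \<phi> n k t)) \<longlonglongrightarrow> nrm (C_alg ?X) (\<mu> n t)"
      unfolding nrm_conn by (simp add: g \<mu>)
  next
    fix y and e :: real assume y: "y \<in> carrier (C_alg ?X)" and e: "0 < e"
    have cy: "continuous_map ?X euclidean y" using y by (simp add: C_alg_simps)
    \<comment> \<open>The tolerance d comes from y alone; some coordinate p n has fibres finer than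
      d, so y is within e/2 of a continuous function of the code of p n.\<close>
    obtain d where d: "d > 0" "\<And>p. real_embeddable_up_to X d p \<Longrightarrow>
        \<exists>F. continuous_on UNIV F \<and> (\<forall>x\<in>mspace X. cmod (F (p x) - y x) \<le> e/2)"
      using complex_factor[OF X cy, of "e/2"] e by auto
    obtain n where "real_embeddable_up_to X d (interval_code \<circ> p n)"
      using projection_real_embeddable[of X d N p f, OF X d(1) p[unfolded Y_def] fp inj] by blast
    then obtain F where F: "continuous_on UNIV F" "\<And>x. x \<in> mspace X \<Longrightarrow> cmod (F (interval_code (p n x)) - y x) \<le> e/2"
      using d(2) by fastforce
    define g where "g = (\<lambda>s\<in>topspace (Y n). F (interval_code s))"
    have "continuous_map (Y n) euclidean (F \<circ> interval_code)"
      unfolding Y_def using F(1) by (intro continuous_map_compose[OF continuous_interval_code]) simp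
    then have g: "g \<in> carrier (C_alg (Y n))" unfolding g_def using restrict_in_C_alg by (simp add: o_def)
    have "nrm (C_alg ?X) (y \<ominus>\<^bsub>C_alg ?X\<^esub> \<mu> n (swap_curry g)) \<le> e/2"
      unfolding \<mu> C_alg_minus[OF abelian_group_C_alg y \<mu>_closed[OF g]]
      by (rule nrm_C_alg_le) (use e F(2) pY in \<open>auto simp: g_def norm_minus_commute\<close>)
    with e g show "\<exists>n. \<exists>x\<in>carrier (T n). nrm (C_alg ?X) (y \<ominus>\<^bsub>C_alg ?X\<^esub> \<mu> n x) < e"
      by (intro exI[of _ n] bexI[of _ "swap_curry g"]) (auto simp: T_simps)
  qed
  have "star_isomorphic (C_alg ?X) (C_alg ?X)"
    unfolding star_isomorphic_def star_hom_def by (intro exI[of _ "\<lambda>x. x"]) (auto simp: bij_betw_def)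
  moreover have "cstar_algebra (finite_C_alg (N n)) \<and> finite_dimensional (finite_C_alg (N n)) \<and>
      cstar_tensor (C_alg (top_of_set {0..1})) (finite_C_alg (N n)) (T n)
        (\<lambda>a b. swap_curry (ptensor (N n) a b))" for n
    unfolding T_def
    by (intro conjI cstar_algebra_C_alg finite_dimensional_finite_C_alg cstar_tensor_intervals_alg)
      (simp add: compact_space_discrete_topology)
  ultimately show ?thesis
    unfolding AI_algebra_def using Xalg limit
    by (intro conjI exI[of _ "\<lambda>n. finite_C_alg (N n)"] exI[of _ T]
        exI[of _ "\<lambda>n a b. swap_curry (ptensor (N n) a b)"] exI[of _ \<phi>] exI[of _ "C_alg ?X"] exI[of _ \<mu>]) auto
qed

section \<open>Characters\<close>

text \<open>The zero functional counts as a character: connecting maps may be non-unital, so a point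
  evaluation on the limit can vanish on a whole stage.\<close>

definition character :: "('a, 'm) cstar_scheme \<Rightarrow> ('a \<Rightarrow> complex) \<Rightarrow> bool" where
  "character A \<psi> \<longleftrightarrow>
     (\<forall>x\<in>carrier A. \<forall>y\<in>carrier A. \<psi> (x \<oplus>\<^bsub>A\<^esub> y) = \<psi> x + \<psi> y) \<and>
     (\<forall>c. \<forall>x\<in>carrier A. \<psi> (c \<odot>\<^bsub>A\<^esub> x) = c * \<psi> x) \<and>
     (\<forall>x\<in>carrier A. \<forall>y\<in>carrier A. \<psi> (x \<otimes>\<^bsub>A\<^esub> y) = \<psi> x * \<psi> y)"

lemma characterD:
  assumes "character A \<psi>" "x \<in> carrier A" "y \<in> carrier A"
  shows "\<psi> (x \<oplus>\<^bsub>A\<^esub> y) = \<psi> x + \<psi> y" "\<psi> (c \<odot>\<^bsub>A\<^esub> x) = c * \<psi> x" "\<psi> (x \<otimes>\<^bsub>A\<^esub> y) = \<psi> x * \<psi> y"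
  using assms by (auto simp: character_def)

section \<open>Characters are contractive and take finitely many values in finite dimension\<close>

lemma (in cstar_algebra) zero_smult: "x \<in> carrier A \<Longrightarrow> 0 \<odot> x = \<zero>"
proof -
  assume x: "x \<in> carrier A"
  have u: "0 \<odot> x \<in> carrier A" by (rule smult_closed[OF x])
  have "0 \<odot> x = (0 \<odot> x \<oplus> 0 \<odot> x) \<oplus> \<ominus> (0 \<odot> x)" using u by (simp add: a_assoc r_neg)
  also have "0 \<odot> x \<oplus> 0 \<odot> x = 0 \<odot> x" using smult_l_distr[OF x, of 0 0] by simp
  finally show ?thesis using u by (simp add: r_neg)
qed

lemma (in cstar_algebra) uminus_smult: "x \<in> carrier A \<Longrightarrow> (-1) \<odot> x = \<ominus> x"
proof -
  assume x: "x \<in> carrier A"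
  have "(-1) \<odot> x \<oplus> x = (-1 + 1) \<odot> x" by (subst smult_l_distr) (simp_all add: x smult_one)
  also have "\<dots> = \<zero>" by (simp add: zero_smult x)
  finally show ?thesis using minus_equality[OF _ x smult_closed[OF x]] by simp
qed

lemma (in cstar_algebra) nrm_minus_commute:
  assumes "x \<in> carrier A" "y \<in> carrier A"
  shows "nrm A (x \<ominus> y) = nrm A (y \<ominus> x)"
proof -
  have "x \<ominus> y = (-1) \<odot> (y \<ominus> x)"
    using assms by (simp add: uminus_smult a_minus_def minus_add a_comm)
  then show ?thesis using assms by (simp add: nrm_smult)
qed

text \<open>\<open>Metric_space\<close> demands nonnegativity and symmetry for all arguments, hence
  the value 0 off the carrier. The metric is introduced to apply Banach's fixed point
  theorem.\<close>

lemma (in cstar_algebra) Metric_space_nrm: "Metric_space (carrier A) (\<lambda>x y. if x \<in> carrier A \<and> y \<in> carrier A then nrm A (x \<ominus> y) else 0)"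
proof (unfold_locales, goal_cases)
  case (1 x y) then show ?case by (simp add: nrm_nonneg)
next
  case (2 x y) then show ?case by (simp add: nrm_minus_commute)
next
  case (3 x y)
  have "x = y" if "x \<ominus> y = \<zero>"
    using minus_equality[of x "\<ominus> y"] 3 that by (simp add: a_minus_def)
  then show ?case using 3 by (auto simp: nrm_eq_0 a_minus_def r_neg)
next
  case (4 x y z)
  have "x \<ominus> z = (x \<ominus> y) \<oplus> (y \<ominus> z)"
    using 4 by (simp add: a_minus_def a_assoc[symmetric]) (simp add: a_assoc l_neg)
  with 4 nrm_triangle[of "x \<ominus> y" "y \<ominus> z"] show ?case by simp
qed

lemma (in cstar_algebra) character_zero: "character A \<psi> \<Longrightarrow> \<psi> \<zero> = 0"
  using characterD(1)[of A \<psi> \<zero> \<zero>] by simp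

lemma (in cstar_algebra) character_minus:
  assumes "character A \<psi>" "x \<in> carrier A" "y \<in> carrier A"
  shows "\<psi> (x \<ominus> y) = \<psi> x - \<psi> y"
  using assms characterD(1)[OF assms(1), of x "\<ominus> y"] characterD(2)[OF assms(1), of y y "-1"]
  by (simp add: a_minus_def uminus_smult)

lemma (in cstar_algebra) character_finsum:
  assumes "character A \<psi>" "finite S" "\<And>i. i \<in> S \<Longrightarrow> f i \<in> carrier A"
  shows "\<psi> (\<Oplus>i\<in>S. f i) = (\<Sum>i\<in>S. \<psi> (f i))"
  using assms(2,3)
proof (induction S)
  case (insert i S)
  then have "(\<Oplus>j\<in>insert i S. f j) = f i \<oplus> (\<Oplus>j\<in>S. f j)" by (intro finsum_insert) auto
  with insert show ?case by (simp add: characterD(1)[OF assms(1)])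
qed (simp add: character_zero[OF assms(1)])

text \<open>If \<open>\<psi> x = 1\<close> but \<open>\<parallel>x\<parallel> < 1\<close>, then \<open>s = x + x s\<close> has a solution \<open>s\<close>, and applying \<open>\<psi>\<close> gives \<open>0 = 1\<close>.\<close>

lemma (in cstar_algebra) character_le_nrm:
  assumes \<psi>: "character A \<psi>" and x: "x \<in> carrier A"
  shows "cmod (\<psi> x) \<le> nrm A x"
proof (rule ccontr)
  assume "\<not> cmod (\<psi> x) \<le> nrm A x"
  then have less: "nrm A x < cmod (\<psi> x)" by simp
  then have nz: "\<psi> x \<noteq> 0" using nrm_nonneg[OF x] by auto
  define t where "t = (1 / \<psi> x) \<odot> x"
  have t: "t \<in> carrier A" unfolding t_def using x by (rule smult_closed)
  have \<psi>t: "\<psi> t = 1" unfolding t_def using characterD(2)[OF \<psi> x x] nz by simp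
  have "nrm A t = nrm A x / cmod (\<psi> x)" unfolding t_def by (simp add: nrm_smult[OF x] norm_divide)
  then have t1: "nrm A t < 1" using less nrm_nonneg[OF x] by (simp add: divide_less_eq)
  define d where "d = (\<lambda>x y. if x \<in> carrier A \<and> y \<in> carrier A then nrm A (x \<ominus> y) else 0)"
  interpret M: Metric_space "carrier A" d unfolding d_def by (rule Metric_space_nrm)
  have "M.mcomplete"
    unfolding M.mcomplete_def
  proof (intro allI impI)
    fix s assume "M.MCauchy s"
    then have range: "range s \<subseteq> carrier A"
      and Cau: "\<forall>e>0. \<exists>N. \<forall>m n. N \<le> m \<longrightarrow> N \<le> n \<longrightarrow> d (s m) (s n) < e"
      unfolding M.MCauchy_def by simp_all
    have s: "s n \<in> carrier A" for n using range by (simp add: image_subset_iff)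
    have "\<forall>e>0. \<exists>N. \<forall>m\<ge>N. \<forall>n\<ge>N. nrm A (s m \<ominus> s n) < e" using Cau by (simp add: d_def s)
    from complete[OF s this] obtain l where l: "l \<in> carrier A" "(\<lambda>n. nrm A (s n \<ominus> l)) \<longlonglongrightarrow> 0"
      by (elim bexE)
    then have "limitin M.mtopology s l sequentially"
      unfolding M.limitin_metric_dist_null using s by (simp add: d_def)
    then show "\<exists>l. limitin M.mtopology s l sequentially" ..
  qed
  \<comment> \<open>The contraction constant is \<parallel>t\<parallel> < 1. The fixed point plays
    the role of the geometric series t + t^2 + ..., so no unit and no inverse of 1 - t is
    involved.\<close>
  then obtain s where s: "s \<in> carrier A" "t \<oplus> t \<otimes> s = s"
  proof (rule M.Banach_fixedpoint_thm[of "\<lambda>s. t \<oplus> t \<otimes> s" "nrm A t"])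
    fix a b assume ab: "a \<in> carrier A" "b \<in> carrier A"
    have neg: "t \<otimes> (\<ominus> b) = \<ominus> (t \<otimes> b)"
      using smult_mult_r[OF t ab(2), of "-1"] ab t by (simp add: uminus_smult mult_closed)
    have "(t \<oplus> t \<otimes> a) \<ominus> (t \<oplus> t \<otimes> b) = (t \<oplus> t \<otimes> a) \<oplus> (\<ominus> t \<oplus> \<ominus> (t \<otimes> b))"
      using t ab by (simp add: a_minus_def minus_add mult_closed)
    also have "\<dots> = (t \<oplus> \<ominus> t) \<oplus> (t \<otimes> a \<oplus> \<ominus> (t \<otimes> b))"
      using t ab mult_closed by (simp add: a_ac)
    also have "\<dots> = t \<otimes> (a \<ominus> b)"
      using t ab by (simp add: r_neg mult_closed a_minus_def r_distr neg)
    finally have "nrm A ((t \<oplus> t \<otimes> a) \<ominus> (t \<oplus> t \<otimes> b)) \<le> nrm A t * nrm A (a \<ominus> b)"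
      using nrm_mult[OF t minus_closed[OF ab]] by simp
    then show "d (t \<oplus> t \<otimes> a) (t \<oplus> t \<otimes> b) \<le> nrm A t * d a b"
      using t ab by (simp add: d_def mult_closed)
  qed (use t t1 mult_closed in auto)
  have "\<psi> s = \<psi> t + \<psi> t * \<psi> s"
    using characterD(1)[OF \<psi> t mult_closed[OF t s(1)]] characterD(3)[OF \<psi> t s(1)] s(2) by simp
  with \<psi>t show False by simp
qed

text \<open>Gaussian elimination by induction on the equations: a pivot r with a r j \<noteq> 0
  removes one equation and one unknown, and c' r is then solved from equation j. For j itself the
  reduced coefficients are 0, so equation j holds automatically.\<close>

lemma homogeneous_system_nontrivial:
  fixes a :: "'i \<Rightarrow> 'j \<Rightarrow> 'c::field"
  assumes "finite J" "finite I" "card J < card I"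
  shows "\<exists>c. (\<exists>i\<in>I. c i \<noteq> 0) \<and> (\<forall>j\<in>J. (\<Sum>i\<in>I. c i * a i j) = 0)"
  using assms
proof (induction J arbitrary: I a)
  case empty
  then obtain i where "i \<in> I" by fastforce
  then show ?case by (intro exI[of _ "\<lambda>i. 1"]) auto
next
  case (insert j J)
  show ?case
  proof (cases "\<forall>i\<in>I. a i j = 0")
    case True
    have "card J < card I" using insert by simp
    then obtain c where "\<exists>i\<in>I. c i \<noteq> 0" "\<forall>j\<in>J. (\<Sum>i\<in>I. c i * a i j) = 0"
      using insert.IH[of I a] insert.prems by blast
    then show ?thesis using True by (intro exI[of _ c]) auto
  next
    case False
    then obtain r where r: "r \<in> I" "a r j \<noteq> 0" by blast
    define I' where "I' = I - {r}"
    have I': "finite I'" "card J < card I'" "I = insert r I'" "r \<notin> I'"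
      using insert r by (auto simp: I'_def)
    obtain c where c: "\<exists>i\<in>I'. c i \<noteq> 0" "\<forall>k\<in>J. (\<Sum>i\<in>I'. c i * (a i k - a i j / a r j * a r k)) = 0"
      using insert.IH[of I' "\<lambda>i k. a i k - a i j / a r j * a r k"] I' by blast
    define c' where "c' = c(r := - (\<Sum>i\<in>I'. c i * a i j / a r j))"
    have sum: "(\<Sum>i\<in>I. c' i * a i k) = (\<Sum>i\<in>I'. c i * (a i k - a i j / a r j * a r k))" for k
    proof -
      have "(\<Sum>i\<in>I. c' i * a i k) = c' r * a r k + (\<Sum>i\<in>I'. c' i * a i k)"
        unfolding I'(3) using I' by simp
      also have "(\<Sum>i\<in>I'. c' i * a i k) = (\<Sum>i\<in>I'. c i * a i k)"
        using I'(4) by (intro sum.cong) (auto simp: c'_def)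
      also have "c' r * a r k = - (\<Sum>i\<in>I'. c i * (a i j / a r j * a r k))"
        by (simp add: c'_def sum_distrib_right mult.assoc)
      finally show ?thesis by (simp add: right_diff_distrib sum_subtractf)
    qed
    have "\<exists>i\<in>I. c' i \<noteq> 0" using c(1) I' by (auto simp: c'_def)
    moreover have "(\<Sum>i\<in>I. c' i * a i j) = 0" unfolding sum using r by simp
    ultimately show ?thesis using c(2) sum by (intro exI[of _ c']) auto
  qed
qed

text \<open>The powers of \<open>b\<close> are linearly dependent, so \<open>\<beta> b\<close> is a root of a polynomial not depending on \<open>\<beta>\<close>.\<close>

lemma finite_character_values:
  assumes F: "cstar_algebra F" and fd: "finite_dimensional F" and b: "b \<in> carrier F"
  shows "finite {\<beta> b |\<beta>. character F \<beta>}"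
proof -
  interpret F: cstar_algebra F by fact
  obtain S where S: "finite S" "S \<subseteq> carrier F"
    "\<And>x. x \<in> carrier F \<Longrightarrow> \<exists>c. x = (\<Oplus>\<^bsub>F\<^esub>s\<in>S. c s \<odot>\<^bsub>F\<^esub> s)"
    using fd unfolding finite_dimensional_def by blast
  \<comment> \<open>\<open>pw i\<close> is the power i + 1 of b, since there is no unit to start
    from; this extra factor is why the value 0 has to be added to the roots. The card S + 1 powers
    used lie in the span of card S vectors.\<close>
  define pw where "pw = rec_nat b (\<lambda>_ y. y \<otimes>\<^bsub>F\<^esub> b)"
  have pw: "pw 0 = b" "pw (Suc i) = pw i \<otimes>\<^bsub>F\<^esub> b" for i by (simp_all add: pw_def)
  have pwF: "pw i \<in> carrier F" for i by (induction i) (auto simp: pw b F.mult_closed)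
  obtain a where a: "\<And>i. pw i = (\<Oplus>\<^bsub>F\<^esub>s\<in>S. a i s \<odot>\<^bsub>F\<^esub> s)" using S(3)[OF pwF] by metis
  obtain c where c: "\<exists>i\<in>{..card S}. c i \<noteq> 0" "\<forall>s\<in>S. (\<Sum>i\<in>{..card S}. c i * a i s) = 0"
    using homogeneous_system_nontrivial[OF S(1), of "{..card S}" a] by auto
  have root: "(\<Sum>i\<le>card S. c i * \<beta> b ^ i) = 0 \<or> \<beta> b = 0" if \<beta>: "character F \<beta>" for \<beta>
  proof -
    have 1: "\<beta> (pw i) = \<beta> b * \<beta> b ^ i" for i
      by (induction i) (auto simp: pw characterD(3)[OF \<beta> pwF b])
    have 2: "\<beta> (pw i) = (\<Sum>s\<in>S. a i s * \<beta> s)" for i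
    proof -
      have "\<beta> (pw i) = (\<Sum>s\<in>S. \<beta> (a i s \<odot>\<^bsub>F\<^esub> s))"
        unfolding a by (rule F.character_finsum[OF \<beta> S(1)]) (use S F.smult_closed in auto)
      also have "\<dots> = (\<Sum>s\<in>S. a i s * \<beta> s)"
        using S(2) by (intro sum.cong) (auto intro: characterD(2)[OF \<beta>])
      finally show ?thesis .
    qed
    have "\<beta> b * (\<Sum>i\<le>card S. c i * \<beta> b ^ i) = (\<Sum>i\<le>card S. c i * \<beta> (pw i))"
      by (simp add: 1 sum_distrib_left mult_ac)
    also have "\<dots> = (\<Sum>i\<le>card S. \<Sum>s\<in>S. c i * a i s * \<beta> s)"
      by (simp add: 2 sum_distrib_left mult.assoc)
    also have "\<dots> = (\<Sum>s\<in>S. \<Sum>i\<le>card S. c i * a i s * \<beta> s)" by (rule sum.swap)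
    also have "\<dots> = (\<Sum>s\<in>S. (\<Sum>i\<le>card S. c i * a i s) * \<beta> s)" by (simp add: sum_distrib_right)
    also have "\<dots> = 0" using c(2) by simp
    finally show ?thesis by auto
  qed
  have "finite {z. (\<Sum>i\<le>card S. c i * z ^ i) = 0}"
    using c(1) by (subst polyfun_finite_roots) auto
  then have "finite (insert 0 {z. (\<Sum>i\<le>card S. c i * z ^ i) = 0})" by simp
  then show ?thesis by (rule rev_finite_subset) (use root in auto)
qed

section \<open>Characters of C[0,1]\<close>

abbreviation unit_interval_alg :: "(real \<Rightarrow> complex) cstar" where
  "unit_interval_alg \<equiv> C_alg (top_of_set {0..1})"

definition "unit_one = (\<lambda>t\<in>{0..1::real}. 1 :: complex)"
definition "unit_id = (\<lambda>t\<in>{0..1::real}. complex_of_real t)"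

lemma unit_in_alg: "unit_one \<in> carrier unit_interval_alg" "unit_id \<in> carrier unit_interval_alg"
proof -
  have "continuous_on {0..1} complex_of_real" by (intro continuous_intros)
  then show "unit_one \<in> carrier unit_interval_alg" "unit_id \<in> carrier unit_interval_alg"
    using restrict_in_C_alg[of "top_of_set {0..1::real}" "\<lambda>t. 1"]
      restrict_in_C_alg[of "top_of_set {0..1::real}" complex_of_real]
    by (simp_all add: unit_one_def unit_id_def)
qed

lemma unit_one_mult:
  assumes "a \<in> carrier unit_interval_alg"
  shows "unit_one \<otimes>\<^bsub>unit_interval_alg\<^esub> a = a" "a \<otimes>\<^bsub>unit_interval_alg\<^esub> unit_one = a"
proof -
  have a: "restrict a {0..1} = a" using assms by (simp add: C_alg_simps extensional_restrict)
  show "unit_one \<otimes>\<^bsub>unit_interval_alg\<^esub> a = a" "a \<otimes>\<^bsub>unit_interval_alg\<^esub> unit_one = a"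
    by (rule trans[OF _ a], auto simp: C_alg_simps unit_one_def intro!: restrict_ext)+
qed

text \<open>A function in the kernel of \<open>\<gamma>\<close> is not invertible, so it has a zero; this applies to
  \<open>\<bar>a - \<gamma> a\<bar>\<^sup>2 + \<bar>id - \<gamma> id\<bar>\<^sup>2\<close>.\<close>

lemma unit_interval_character:
  assumes \<gamma>: "character unit_interval_alg \<gamma>" "\<gamma> unit_one = 1"
  obtains r where "r \<in> {0..1}" "\<gamma> unit_id = of_real r" "\<And>a. a \<in> carrier unit_interval_alg \<Longrightarrow> \<gamma> a = a r"
proof -
  let ?U = unit_interval_alg
  have key: "\<exists>r\<in>{0..1}. \<gamma> unit_id = of_real r \<and> \<gamma> a = a r" if a: "a \<in> carrier ?U" for a
  proof -
    have ca: "continuous_on {0..1} a" using a by (simp add: C_alg_simps)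
    define a1 where "a1 = (\<lambda>t\<in>{0..1}. a t - \<gamma> a)"
    define i1 where "i1 = (\<lambda>t\<in>{0..1}. complex_of_real t - \<gamma> unit_id)"
    have mem: "restrict f {0..1} \<in> carrier ?U" if "continuous_on {0..1} f" for f
      using restrict_in_C_alg[of "top_of_set {0..1::real}" f] that by simp
    have kernel: "\<gamma> (\<lambda>t\<in>{0..1}. g t - \<gamma> g) = 0" if g: "g \<in> carrier ?U" for g
    proof -
      have "(\<lambda>t\<in>{0..1}. g t - \<gamma> g) = g \<oplus>\<^bsub>?U\<^esub> ((- \<gamma> g) \<odot>\<^bsub>?U\<^esub> unit_one)"
        by (auto simp: C_alg_simps unit_one_def)
      moreover have "(- \<gamma> g) \<odot>\<^bsub>?U\<^esub> unit_one \<in> carrier ?U"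
        using mem[of "\<lambda>t. - \<gamma> g"] by (simp add: C_alg_simps unit_one_def cong: restrict_cong)
      ultimately show ?thesis
        using characterD(1)[OF \<gamma>(1) g] characterD(2)[OF \<gamma>(1) unit_in_alg(1) unit_in_alg(1)] \<gamma>(2) by simp
    qed
    have a1: "a1 \<in> carrier ?U" unfolding a1_def by (intro mem continuous_intros ca)
    have \<gamma>a1: "\<gamma> a1 = 0" unfolding a1_def by (rule kernel[OF a])
    have i1_eq: "i1 = (\<lambda>t\<in>{0..1}. unit_id t - \<gamma> unit_id)" by (auto simp: i1_def unit_id_def)
    have i1: "i1 \<in> carrier ?U" unfolding i1_def by (intro mem continuous_intros)
    have \<gamma>i1: "\<gamma> i1 = 0" unfolding i1_eq by (rule kernel[OF unit_in_alg(2)])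
    have star: "(\<lambda>t\<in>{0..1}. cnj (f t)) \<in> carrier ?U" if "f \<in> carrier ?U" for f
      using that mem[of "\<lambda>t. cnj (f t)"] by (auto simp: C_alg_simps intro!: continuous_intros)
    define g where "g = ((\<lambda>t\<in>{0..1}. cnj (a1 t)) \<otimes>\<^bsub>?U\<^esub> a1) \<oplus>\<^bsub>?U\<^esub> ((\<lambda>t\<in>{0..1}. cnj (i1 t)) \<otimes>\<^bsub>?U\<^esub> i1)"
    have mult: "f \<otimes>\<^bsub>?U\<^esub> f' \<in> carrier ?U" if "f \<in> carrier ?U" "f' \<in> carrier ?U" for f f'
      using that mem[of "\<lambda>t. f t * f' t"] by (auto simp: C_alg_simps intro!: continuous_intros)
    have add: "f \<oplus>\<^bsub>?U\<^esub> f' \<in> carrier ?U" if "f \<in> carrier ?U" "f' \<in> carrier ?U" for f f'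
      using that mem[of "\<lambda>t. f t + f' t"] by (auto simp: C_alg_simps intro!: continuous_intros)
    have g: "g \<in> carrier ?U" unfolding g_def by (intro add mult star a1 i1)
    have "\<gamma> g = 0"
      unfolding g_def
      using a1 i1 \<gamma>a1 \<gamma>i1 star mult characterD(1)[OF \<gamma>(1)] characterD(3)[OF \<gamma>(1)] by simp
    have gt: "g t = of_real ((cmod (a t - \<gamma> a))\<^sup>2 + (cmod (of_real t - \<gamma> unit_id))\<^sup>2)" if "t \<in> {0..1}" for t
      using that
      by (simp add: g_def a1_def i1_def C_alg_simps complex_norm_square mult.commute del: of_real_power)
    have "\<exists>r\<in>{0..1}. g r = 0"
    proof (rule ccontr)
      assume no: "\<not> (\<exists>r\<in>{0..1}. g r = 0)"
      have "continuous_on {0..1} (\<lambda>t. 1 / g t)"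
        using g no by (auto simp: C_alg_simps intro!: continuous_intros)
      then have inv: "(\<lambda>t\<in>{0..1}. 1 / g t) \<in> carrier ?U" by (rule mem)
      have "g \<otimes>\<^bsub>?U\<^esub> (\<lambda>t\<in>{0..1}. 1 / g t) = unit_one"
        using no by (auto simp: C_alg_simps unit_one_def)
      with characterD(3)[OF \<gamma>(1) g inv] \<open>\<gamma> g = 0\<close> \<gamma>(2) show False by simp
    qed
    then obtain r where r: "r \<in> {0..1}" "g r = 0" by blast
    then have "(cmod (a r - \<gamma> a))\<^sup>2 + (cmod (of_real r - \<gamma> unit_id))\<^sup>2 = 0"
      using gt[OF r(1)] of_real_eq_0_iff by metis
    then have "a r - \<gamma> a = 0" "of_real r - \<gamma> unit_id = 0"
      by (simp_all add: sum_power2_eq_zero_iff)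
    with r(1) show ?thesis by (intro bexI[of _ r]) auto
  qed
  \<comment> \<open>\<open>key\<close> yields a point for each a separately, but its value is pinned
    down by \<gamma> \<open>unit_id\<close>. Hence the point obtained here serves for all a.\<close>
  obtain r where r: "r \<in> {0..1}" "\<gamma> unit_id = of_real r" using key[OF unit_in_alg(1)] by blast
  show ?thesis
  proof (rule that[OF r])
    fix a assume "a \<in> carrier ?U"
    from key[OF this] r(2) show "\<gamma> a = a r" by auto
  qed
qed

section \<open>Characters of C[0,1] \<otimes> F\<close>

lemma tensor_character_mult:
  assumes tensor: "cstar_tensor unit_interval_alg F T \<tau>" and \<psi>: "character T \<psi>"
    and "a \<in> carrier unit_interval_alg" "a' \<in> carrier unit_interval_alg" "b \<in> carrier F" "b' \<in> carrier F"
  shows "\<psi> (\<tau> (a \<otimes>\<^bsub>unit_interval_alg\<^esub> a') (b \<otimes>\<^bsub>F\<^esub> b')) = \<psi> (\<tau> a b) * \<psi> (\<tau> a' b')"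
proof -
  interpret cstar_tensor unit_interval_alg F T \<tau> by fact
  show ?thesis
    using assms(3-) by (subst mult[symmetric]) (auto intro!: characterD(3)[OF \<psi>] closed)
qed

lemma tensor_character_right:
  assumes tensor: "cstar_tensor unit_interval_alg F T \<tau>" and \<psi>: "character T \<psi>"
  shows "character F (\<lambda>b. \<psi> (\<tau> unit_one b))"
proof -
  interpret cstar_tensor unit_interval_alg F T \<tau> by fact
  note one = unit_in_alg(1)
  show ?thesis
    unfolding character_def
  proof (intro conjI ballI allI)
    fix x y assume xy: "x \<in> carrier F" "y \<in> carrier F"
    show "\<psi> (\<tau> unit_one (x \<oplus>\<^bsub>F\<^esub> y)) = \<psi> (\<tau> unit_one x) + \<psi> (\<tau> unit_one y)"
      using xy one by (simp add: add_right characterD(1)[OF \<psi>] closed)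
    show "\<psi> (\<tau> unit_one (x \<otimes>\<^bsub>F\<^esub> y)) = \<psi> (\<tau> unit_one x) * \<psi> (\<tau> unit_one y)"
      using tensor_character_mult[OF tensor \<psi> one one xy] by (simp add: unit_one_mult[OF one])
  next
    fix c x assume x: "x \<in> carrier F"
    show "\<psi> (\<tau> unit_one (c \<odot>\<^bsub>F\<^esub> x)) = c * \<psi> (\<tau> unit_one x)"
      using x one closed[OF one x] by (simp add: smult_right characterD(2)[OF \<psi>])
  qed
qed

text \<open>The element e stands in for a unit of F. Multiplying 1 \<otimes> e by a \<otimes> b, and
  a \<otimes> e by 1 \<otimes> b, gives the same tensor a \<otimes> eb, so \<psi> splits into the
  unital character \<gamma> of C[0,1] and the restriction to 1 \<otimes> F. The quotient formula for
  r later gives its continuity in \<psi>.\<close>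

lemma tensor_character_nonzero:
  assumes tensor: "cstar_tensor unit_interval_alg F T \<tau>" and F: "cstar_algebra F" and \<psi>: "character T \<psi>"
    and e: "e \<in> carrier F" "\<psi> (\<tau> unit_one e) \<noteq> 0"
  obtains r where "r \<in> {0..1}" "\<psi> (\<tau> unit_id e) / \<psi> (\<tau> unit_one e) = of_real r"
    "\<And>a b. \<lbrakk>a \<in> carrier unit_interval_alg; b \<in> carrier F\<rbrakk> \<Longrightarrow> \<psi> (\<tau> a b) = a r * \<psi> (\<tau> unit_one b)"
proof -
  interpret cstar_tensor unit_interval_alg F T \<tau> by fact
  let ?U = unit_interval_alg
  note one = unit_in_alg(1)
  note mlt = tensor_character_mult[OF tensor \<psi>]
  interpret U: cstar_algebra ?U by (rule cstar_algebra_C_alg) (simp add: compact_space_subtopology)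
  define \<gamma> where "\<gamma> a = \<psi> (\<tau> a e) / \<psi> (\<tau> unit_one e)" for a
  have swap: "\<psi> (\<tau> a b) * \<psi> (\<tau> unit_one e) = \<psi> (\<tau> a e) * \<psi> (\<tau> unit_one b)"
    if "a \<in> carrier ?U" "b \<in> carrier F" for a b
  proof -
    have "\<psi> (\<tau> unit_one e) * \<psi> (\<tau> a b) = \<psi> (\<tau> a (e \<otimes>\<^bsub>F\<^esub> b))"
      using mlt[OF one that(1) e(1) that(2)] by (simp add: unit_one_mult[OF that(1)])
    also have "\<dots> = \<psi> (\<tau> a e) * \<psi> (\<tau> unit_one b)"
      using mlt[OF that(1) one e(1) that(2)] by (simp add: unit_one_mult[OF that(1)])
    finally show ?thesis by (simp add: mult.commute)
  qed
  have \<gamma>: "character ?U \<gamma>"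
    unfolding character_def
  proof (intro conjI ballI allI)
    fix x y assume xy: "x \<in> carrier ?U" "y \<in> carrier ?U"
    show "\<gamma> (x \<oplus>\<^bsub>?U\<^esub> y) = \<gamma> x + \<gamma> y"
      using xy e by (simp add: \<gamma>_def add_left characterD(1)[OF \<psi>] closed add_divide_distrib)
    have "\<psi> (\<tau> x e) * \<psi> (\<tau> y e) = \<psi> (\<tau> (x \<otimes>\<^bsub>?U\<^esub> y) (e \<otimes>\<^bsub>F\<^esub> e))"
      by (rule mlt[OF xy e(1) e(1), symmetric])
    also have "\<dots> = \<psi> (\<tau> (x \<otimes>\<^bsub>?U\<^esub> y) e) * \<psi> (\<tau> unit_one e)"
      using mlt[OF U.mult_closed[OF xy] one e(1) e(1)] by (simp add: unit_one_mult U.mult_closed xy)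
    finally show "\<gamma> (x \<otimes>\<^bsub>?U\<^esub> y) = \<gamma> x * \<gamma> y" using e(2) by (simp add: \<gamma>_def)
  next
    fix c x assume x: "x \<in> carrier ?U"
    show "\<gamma> (c \<odot>\<^bsub>?U\<^esub> x) = c * \<gamma> x"
      using x e closed[OF x e(1)] by (simp add: \<gamma>_def smult_left characterD(2)[OF \<psi>])
  qed
  have "\<gamma> unit_one = 1" using e(2) by (simp add: \<gamma>_def)
  then obtain r where r: "r \<in> {0..1}" "\<gamma> unit_id = of_real r" "\<And>a. a \<in> carrier ?U \<Longrightarrow> \<gamma> a = a r"
    using unit_interval_character[OF \<gamma>] by blast
  show ?thesis
  proof (rule that[OF r(1)])
    show "\<psi> (\<tau> unit_id e) / \<psi> (\<tau> unit_one e) = of_real r" using r(2) by (simp add: \<gamma>_def)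
    fix a b assume ab: "a \<in> carrier ?U" "b \<in> carrier F"
    show "\<psi> (\<tau> a b) = a r * \<psi> (\<tau> unit_one b)"
      using swap[OF ab] r(3)[OF ab(1)] e(2) by (simp add: \<gamma>_def field_simps)
  qed
qed

text \<open>The square of a \<otimes> b is (a^2 \<otimes> b)(1 \<otimes> b), so the square of
  \<psi>(a \<otimes> b) vanishes.\<close>

lemma tensor_character_zero:
  assumes tensor: "cstar_tensor unit_interval_alg F T \<tau>" and \<psi>: "character T \<psi>"
    and zero: "\<And>b. b \<in> carrier F \<Longrightarrow> \<psi> (\<tau> unit_one b) = 0"
    and ab: "a \<in> carrier unit_interval_alg" "b \<in> carrier F"
  shows "\<psi> (\<tau> a b) = 0"
proof -
  let ?U = unit_interval_alg
  interpret U: cstar_algebra ?U by (rule cstar_algebra_C_alg) (simp add: compact_space_subtopology)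
  note mlt = tensor_character_mult[OF tensor \<psi>]
  have "\<psi> (\<tau> a b) * \<psi> (\<tau> a b) = \<psi> (\<tau> (a \<otimes>\<^bsub>?U\<^esub> a) (b \<otimes>\<^bsub>F\<^esub> b))"
    by (rule mlt[OF ab(1) ab(1) ab(2) ab(2), symmetric])
  also have "\<dots> = \<psi> (\<tau> (a \<otimes>\<^bsub>?U\<^esub> a) b) * \<psi> (\<tau> unit_one b)"
    using mlt[OF U.mult_closed[OF ab(1) ab(1)] unit_in_alg(1) ab(2) ab(2)]
    by (simp add: unit_one_mult U.mult_closed ab)
  finally show ?thesis using zero[OF ab(2)] by simp
qed

text \<open>Characters are contractive by \<open>character_le_nrm\<close>, and sums of elementary
  tensors are dense.\<close>

lemma tensor_character_eqI:
  assumes tensor: "cstar_tensor A F T \<tau>"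
    and \<psi>: "character T \<psi>" "character T \<psi>'"
    and eq: "\<And>a b. \<lbrakk>a \<in> carrier A; b \<in> carrier F\<rbrakk> \<Longrightarrow> \<psi> (\<tau> a b) = \<psi>' (\<tau> a b)"
    and t: "t \<in> carrier T"
  shows "\<psi> t = \<psi>' t"
proof (rule ccontr)
  assume "\<psi> t \<noteq> \<psi>' t"
  interpret cstar_tensor A F T \<tau> by fact
  interpret T: cstar_algebra T by (rule cstar)
  define e where "e = cmod (\<psi> t - \<psi>' t) / 2"
  have e: "e > 0" using \<open>\<psi> t \<noteq> \<psi>' t\<close> by (simp add: e_def)
  obtain n :: nat and u v where uv: "\<forall>i<n. u i \<in> carrier A" "\<forall>i<n. v i \<in> carrier F"
    and near: "nrm T (t \<ominus>\<^bsub>T\<^esub> (\<Oplus>\<^bsub>T\<^esub>i\<in>{..<n}. \<tau> (u i) (v i))) < e"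
    using dense[OF t e] by blast
  define s where "s = (\<Oplus>\<^bsub>T\<^esub>i\<in>{..<n}. \<tau> (u i) (v i))"
  have s: "s \<in> carrier T" unfolding s_def using uv closed by (intro T.finsum_closed) auto
  have "\<psi> s = \<psi>' s"
    unfolding s_def using uv closed eq
    by (subst (1 2) T.character_finsum) (auto intro!: \<psi> sum.cong)
  moreover have "cmod (\<psi> t - \<psi> s) < e" "cmod (\<psi>' t - \<psi>' s) < e"
    using T.character_le_nrm[OF \<psi>(1) T.minus_closed[OF t s]] T.character_le_nrm[OF \<psi>(2) T.minus_closed[OF t s]]
      near[folded s_def]
    by (simp_all add: T.character_minus[OF \<psi>(1) t s] T.character_minus[OF \<psi>(2) t s])
  ultimately have "cmod (\<psi> t - \<psi>' t) < e + e"
    using norm_triangle_ineq4[of "\<psi> t - \<psi> s" "\<psi>' t - \<psi>' s"] by simp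
  then show False by (simp add: e_def)
qed

text \<open>The pasting lemma for a finite closed partition into the level sets of w: the preimage
  of a closed set is a finite union of closed sets.\<close>

lemma continuous_map_glue_finite:
  assumes fin: "finite (w ` topspace X)"
    and closed: "\<And>k. closedin X {x \<in> topspace X. w x = k}"
    and cont: "\<And>k. continuous_map X Y (g k)"
  shows "continuous_map X Y (\<lambda>x. g (w x) x)"
  unfolding continuous_map_closedin
proof (intro conjI allI impI)
  show "(\<lambda>x. g (w x) x) \<in> topspace X \<rightarrow> topspace Y"
    using continuous_map_image_subset_topspace[OF cont] by blast
  fix C assume C: "closedin Y C"
  have "{x \<in> topspace X. g (w x) x \<in> C} =
      (\<Union>k\<in>w ` topspace X. {x \<in> topspace X. w x = k} \<inter> {x \<in> topspace X. g k x \<in> C})" by auto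
  moreover have "closedin X (\<Union>k\<in>w ` topspace X. {x \<in> topspace X. w x = k} \<inter> {x \<in> topspace X. g k x \<in> C})"
    by (intro closedin_Union finite_imageI[OF fin])
      (auto intro!: closedin_Int closed closedin_continuous_map_preimage[OF cont C])
  ultimately show "closedin X {x \<in> topspace X. g (w x) x \<in> C}" by simp
qed

text \<open>\<open>w x\<close> records the restriction of \<psi> x to 1 \<otimes> F on a spanning
  set. It takes finitely many values and has closed fibres, and on each fibre the remaining freedom
  is the point of [0,1] from \<open>tensor_character_nonzero\<close>. The class number and that
  point are merged into one real by \<open>interval_code\<close>.\<close>

lemma tensor_characters_real_parameter:
  fixes X :: "'a topology" and T :: "'t cstar" and F :: "'b cstar"
  assumes tensor: "cstar_tensor unit_interval_alg F T \<tau>"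
    and F: "cstar_algebra F" and fd: "finite_dimensional F"
    and \<psi>: "\<And>x. x \<in> topspace X \<Longrightarrow> character T (\<psi> x)"
    and cont: "\<And>t. t \<in> carrier T \<Longrightarrow> continuous_map X euclidean (\<lambda>x. \<psi> x t)"
  obtains f where "continuous_map X euclideanreal f"
    and "\<And>x y t. \<lbrakk>x \<in> topspace X; y \<in> topspace X; f x = f y; t \<in> carrier T\<rbrakk> \<Longrightarrow> \<psi> x t = \<psi> y t"
proof -
  interpret cstar_tensor unit_interval_alg F T \<tau> by fact
  interpret F: cstar_algebra F by fact
  let ?U = unit_interval_alg
  obtain S where S: "finite S" "S \<subseteq> carrier F"
    "\<And>x. x \<in> carrier F \<Longrightarrow> \<exists>c. x = (\<Oplus>\<^bsub>F\<^esub>s\<in>S. c s \<odot>\<^bsub>F\<^esub> s)"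
    using fd unfolding finite_dimensional_def by blast
  define w where "w x = (\<lambda>s\<in>S. \<psi> x (\<tau> unit_one s))" for x
  have one: "\<tau> unit_one s \<in> carrier T" if "s \<in> carrier F" for s
    by (rule closed[OF unit_in_alg(1) that])
  have right: "character F (\<lambda>b. \<psi> x (\<tau> unit_one b))" if "x \<in> topspace X" for x
    by (rule tensor_character_right[OF tensor \<psi>[OF that]])
  have w_eq: "\<psi> x (\<tau> unit_one b) = \<psi> y (\<tau> unit_one b)"
    if x: "x \<in> topspace X" and y: "y \<in> topspace X" and w: "w x = w y" and b: "b \<in> carrier F" for x y b
  proof -
    obtain c where c: "b = (\<Oplus>\<^bsub>F\<^esub>s\<in>S. c s \<odot>\<^bsub>F\<^esub> s)" using S(3)[OF b] by blast
    have expand: "\<psi> z (\<tau> unit_one b) = (\<Sum>s\<in>S. c s * \<psi> z (\<tau> unit_one s))" if z: "z \<in> topspace X" for z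
    proof -
      have "\<psi> z (\<tau> unit_one b) = (\<Sum>s\<in>S. \<psi> z (\<tau> unit_one (c s \<odot>\<^bsub>F\<^esub> s)))"
        unfolding c by (rule F.character_finsum[OF right[OF z] S(1)]) (use S(2) F.smult_closed in auto)
      also have "\<dots> = (\<Sum>s\<in>S. c s * \<psi> z (\<tau> unit_one s))"
        using S(2) by (intro sum.cong) (auto intro: characterD(2)[OF right[OF z]])
      finally show ?thesis .
    qed
    have "\<psi> x (\<tau> unit_one s) = \<psi> y (\<tau> unit_one s)" if "s \<in> S" for s
      using fun_cong[OF w, of s] that by (simp add: w_def)
    then show ?thesis by (simp add: expand[OF x] expand[OF y])
  qed
  have fin: "finite (w ` topspace X)"
  proof (rule finite_subset)
    show "w ` topspace X \<subseteq> PiE S (\<lambda>s. {\<beta> s |\<beta>. character F \<beta>})"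
      using right by (auto simp: w_def)
    show "finite (PiE S (\<lambda>s. {\<beta> s |\<beta>. character F \<beta>}))"
      using S finite_character_values[OF F fd] by (intro finite_PiE) auto
  qed
  have fibre: "closedin X {x \<in> topspace X. w x = k}" for k
  proof (cases "k \<in> extensional S")
    case True
    have "{x \<in> topspace X. w x = k} =
        (\<Inter>s\<in>S. {x \<in> topspace X. \<psi> x (\<tau> unit_one s) \<in> {k s}}) \<inter> topspace X"
      using True by (auto simp: w_def fun_eq_iff extensional_def restrict_def)
    moreover have "closedin X {x \<in> topspace X. \<psi> x (\<tau> unit_one s) \<in> {k s}}" if "s \<in> S" for s
      by (rule closedin_continuous_map_preimage[OF cont[OF one]]) (use that S(2) in auto)
    then have "closedin X ((\<Inter>s\<in>S. {x \<in> topspace X. \<psi> x (\<tau> unit_one s) \<in> {k s}}) \<inter> topspace X)"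
      by (cases "S = {}") (auto intro!: closedin_Int closedin_INT)
    ultimately show ?thesis by simp
  next
    case False
    then have empty: "{x \<in> topspace X. w x = k} = {}" by (auto simp: w_def)
    show ?thesis unfolding empty by (rule closedin_empty)
  qed
  obtain code :: "_ \<Rightarrow> nat" where code: "inj_on code (w ` topspace X)"
    using finite_imp_inj_to_nat_seg[OF fin] by blast
  \<comment> \<open>The choice depends on the class k only. So \<open>h k\<close> has a constant
    denominator and is continuous on all of X, as gluing requires, although it is the sought
    parameter only where w x = k. The value 0 serves the class of the zero character.\<close>
  define e where "e k = (SOME s. s \<in> S \<and> k s \<noteq> 0)" for k :: "'b \<Rightarrow> complex"
  have e: "e k \<in> S \<and> k (e k) \<noteq> 0" if "\<exists>s\<in>S. k s \<noteq> 0" for k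
    unfolding e_def by (rule someI_ex) (use that in blast)
  define h where "h k x = (if \<exists>s\<in>S. k s \<noteq> 0 then Re (\<psi> x (\<tau> unit_id (e k)) / k (e k)) else 0)" for k x
  define f where "f x = interval_code (code (w x), h (w x) x)" for x
  have param: "h (w x) x \<in> {0..1} \<and> (\<forall>a\<in>carrier ?U. \<forall>b\<in>carrier F.
      \<psi> x (\<tau> a b) = a (h (w x) x) * \<psi> x (\<tau> unit_one b))" if x: "x \<in> topspace X" for x
  proof (cases "\<exists>s\<in>S. w x s \<noteq> 0")
    case True
    have eS: "e (w x) \<in> S" "w x (e (w x)) \<noteq> 0" using e[OF True] by auto
    then have we: "w x (e (w x)) = \<psi> x (\<tau> unit_one (e (w x)))" by (simp add: w_def)
    obtain r where r: "r \<in> {0..1}" "\<psi> x (\<tau> unit_id (e (w x))) / \<psi> x (\<tau> unit_one (e (w x))) = of_real r"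
      "\<And>a b. \<lbrakk>a \<in> carrier ?U; b \<in> carrier F\<rbrakk> \<Longrightarrow> \<psi> x (\<tau> a b) = a r * \<psi> x (\<tau> unit_one b)"
      using tensor_character_nonzero[OF tensor F \<psi>[OF x], of "e (w x)"] eS S(2) unfolding we by blast
    have "h (w x) x = r" using True r(2) by (simp add: h_def we)
    with r(1,3) show ?thesis by blast
  next
    case False
    then have h0: "h (w x) x = 0" by (auto simp: h_def)
    have w0: "\<psi> x (\<tau> unit_one s) = 0" if "s \<in> S" for s using False that by (auto simp: w_def)
    have zero: "\<psi> x (\<tau> unit_one b) = 0" if b: "b \<in> carrier F" for b
    proof -
      obtain c where c: "b = (\<Oplus>\<^bsub>F\<^esub>s\<in>S. c s \<odot>\<^bsub>F\<^esub> s)" using S(3)[OF b] by blast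
      have "\<psi> x (\<tau> unit_one b) = (\<Sum>s\<in>S. \<psi> x (\<tau> unit_one (c s \<odot>\<^bsub>F\<^esub> s)))"
        unfolding c by (rule F.character_finsum[OF right[OF x] S(1)]) (use S(2) F.smult_closed in auto)
      also have "\<dots> = 0"
        using S(2) w0 characterD(2)[OF right[OF x]] by (intro sum.neutral) auto
      finally show ?thesis .
    qed
    show ?thesis using h0 zero tensor_character_zero[OF tensor \<psi>[OF x] zero] by simp
  qed
  show ?thesis
  proof (rule that[of f])
    have "continuous_map X euclideanreal (h k)" for k
    proof (cases "\<exists>s\<in>S. k s \<noteq> 0")
      case True
      then have "\<tau> unit_id (e k) \<in> carrier T" using e[OF True] S(2) by (intro closed unit_in_alg) auto
      then have "continuous_map X euclidean (\<lambda>x. \<psi> x (\<tau> unit_id (e k)))" by (rule cont)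
      then have "continuous_map X euclideanreal ((\<lambda>z. Re (z / k (e k))) \<circ> (\<lambda>x. \<psi> x (\<tau> unit_id (e k))))"
        by (rule continuous_map_compose) (use e[OF True] in \<open>auto intro!: continuous_intros\<close>)
      with True show ?thesis by (simp add: h_def[abs_def] o_def)
    qed (simp add: h_def[abs_def])
    then have "continuous_map X euclideanreal (\<lambda>x. interval_code (code k, h k x))" for k
      unfolding interval_code_def by (auto intro!: continuous_map_add)
    then show "continuous_map X euclideanreal f"
      unfolding f_def by (rule continuous_map_glue_finite[OF fin fibre])
    fix x y t assume xy: "x \<in> topspace X" "y \<in> topspace X" and fxy: "f x = f y" and t: "t \<in> carrier T"
    have "(code (w x), h (w x) x) = (code (w y), h (w y) y)"
      by (rule inj_onD[OF interval_code_inj[of UNIV] fxy[unfolded f_def]]) (use param xy in auto)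
    then have "code (w x) = code (w y)" and hxy: "h (w x) x = h (w y) y" by simp_all
    then have wxy: "w x = w y" using inj_onD[OF code] xy by blast
    show "\<psi> x t = \<psi> y t"
    proof (rule tensor_character_eqI[OF tensor \<psi>[OF xy(1)] \<psi>[OF xy(2)] _ t])
      fix a b assume ab: "a \<in> carrier ?U" "b \<in> carrier F"
      have "\<psi> x (\<tau> a b) = a (h (w x) x) * \<psi> x (\<tau> unit_one b)" using param[OF xy(1)] ab by blast
      also have "\<dots> = a (h (w y) y) * \<psi> y (\<tau> unit_one b)" using w_eq[OF xy wxy ab(2)] hxy by simp
      also have "\<dots> = \<psi> y (\<tau> a b)" using param[OF xy(2)] ab by simp
      finally show "\<psi> x (\<tau> a b) = \<psi> y (\<tau> a b)" .
    qed
  qed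
qed

text \<open>Through the isomorphism, evaluation at x becomes a character \<psi> n x of every stage.
  Agreement of the stage-n characters of two points is a closed relation, decreasing in n by
  compatibility of the \<mu> n, with the diagonal as intersection by density. So a single stage
  suffices for e, and its characters have a real parameter.\<close>

lemma real_embeddable_if_AI_algebra:
  fixes X :: "'a metric"
  assumes X: "compact_space (mtopology_of X)" and AI: "AI_algebra (C_alg (mtopology_of X))" and e: "e > 0"
  shows "\<exists>f. real_embeddable_up_to X e f"
proof -
  let ?X = "mtopology_of X" and ?XX = "prod_topology (mtopology_of X) (mtopology_of X)"
  let ?C = "C_alg ?X"
  obtain F :: "nat \<Rightarrow> (nat \<Rightarrow> complex) cstar" and T :: "nat \<Rightarrow> (real \<Rightarrow> nat \<Rightarrow> complex) cstar"
    and \<tau> \<phi> and L :: "('a \<Rightarrow> complex) cstar" and \<mu> h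
    where F: "\<And>n. cstar_algebra (F n)" "\<And>n. finite_dimensional (F n)"
      and tensor: "\<And>n. cstar_tensor unit_interval_alg (F n) (T n) (\<tau> n)"
      and limit: "cstar_inductive_limit T \<phi> L \<mu>"
      and h: "star_hom ?C L h" "bij_betw h (carrier ?C) (carrier L)"
    using AI unfolding AI_algebra_def star_isomorphic_def by blast
  interpret lim: cstar_inductive_limit T \<phi> L \<mu> by fact
  interpret L: cstar_algebra L by (rule lim.cstar_L)
  define k where "k = inv_into (carrier ?C) h"
  have kC: "k y \<in> carrier ?C" and hk: "h (k y) = y" if "y \<in> carrier L" for y
    using h(2) that unfolding k_def bij_betw_def by (auto intro: inv_into_into simp: f_inv_into_f)
  have kh: "k (h g) = g" if "g \<in> carrier ?C" for g
    using h(2) that unfolding k_def by (simp add: bij_betw_inv_into_left)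
  interpret C: cstar_algebra ?C by (rule cstar_algebra_C_alg[OF X])
  have k_add: "k (x \<oplus>\<^bsub>L\<^esub> y) = k x \<oplus>\<^bsub>?C\<^esub> k y" and k_mult: "k (x \<otimes>\<^bsub>L\<^esub> y) = k x \<otimes>\<^bsub>?C\<^esub> k y"
    if "x \<in> carrier L" "y \<in> carrier L" for x y
  proof -
    have "h (k x \<oplus>\<^bsub>?C\<^esub> k y) = x \<oplus>\<^bsub>L\<^esub> y" "h (k x \<otimes>\<^bsub>?C\<^esub> k y) = x \<otimes>\<^bsub>L\<^esub> y"
      using h(1) that kC hk by (auto simp: star_hom_def)
    then show "k (x \<oplus>\<^bsub>L\<^esub> y) = k x \<oplus>\<^bsub>?C\<^esub> k y" "k (x \<otimes>\<^bsub>L\<^esub> y) = k x \<otimes>\<^bsub>?C\<^esub> k y"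
      using kh[of "k x \<oplus>\<^bsub>?C\<^esub> k y"] kh[of "k x \<otimes>\<^bsub>?C\<^esub> k y"] kC that C.mult_closed by simp_all
  qed
  have k_smult: "k (c \<odot>\<^bsub>L\<^esub> x) = c \<odot>\<^bsub>?C\<^esub> k x" if "x \<in> carrier L" for c x
  proof -
    have "h (c \<odot>\<^bsub>?C\<^esub> k x) = c \<odot>\<^bsub>L\<^esub> x" using h(1) that kC hk by (auto simp: star_hom_def)
    then show ?thesis using kh[of "c \<odot>\<^bsub>?C\<^esub> k x"] kC[OF that] C.smult_closed by simp
  qed
  have charL: "character L (\<lambda>y. k y x)" if "x \<in> mspace X" for x
    unfolding character_def using that by (auto simp: k_add k_mult k_smult C_alg_simps)
  have \<mu>L: "\<mu> n t \<in> carrier L" if "t \<in> carrier (T n)" for n t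
    using lim.hom_\<mu> that by (auto simp: star_hom_def)
  define \<psi> where "\<psi> n x t = k (\<mu> n t) x" for n x t
  have \<psi>: "character (T n) (\<psi> n x)" if "x \<in> mspace X" for n x
    using charL[OF that] lim.hom_\<mu>[of n] \<mu>L unfolding character_def star_hom_def \<psi>_def by simp
  have cont: "continuous_map ?X euclidean (\<lambda>x. \<psi> n x t)" if "t \<in> carrier (T n)" for n t
    using kC[OF \<mu>L[OF that]] by (simp add: \<psi>_def C_alg_simps)
  define R where "R n = {q \<in> topspace ?XX. \<forall>t\<in>carrier (T n). \<psi> n (fst q) t = \<psi> n (snd q) t}" for n
  obtain n where n: "\<And>x y. (x, y) \<in> R n \<Longrightarrow> mdist X x y < e"
  proof (rule compact_relations_small[OF X, of R e])
    fix n
    interpret Tn: cstar_algebra "T n" by (rule lim.cstar_A)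
    have "closedin ?XX {q \<in> topspace ?XX. \<psi> n (fst q) t = \<psi> n (snd q) t}" if "t \<in> carrier (T n)" for t
      using continuous_map_compose[OF continuous_map_fst cont[OF that]]
        continuous_map_compose[OF continuous_map_snd cont[OF that]]
      by (intro closedin_continuous_maps_eq[of euclidean]) (auto simp: o_def)
    then have "closedin ?XX (\<Inter>t\<in>carrier (T n). {q \<in> topspace ?XX. \<psi> n (fst q) t = \<psi> n (snd q) t})"
      using Tn.zero_closed by (intro closedin_INT) auto
    moreover have "R n = (\<Inter>t\<in>carrier (T n). {q \<in> topspace ?XX. \<psi> n (fst q) t = \<psi> n (snd q) t})"
      unfolding R_def using Tn.zero_closed by blast
    ultimately show "closedin ?XX (R n)" by simp
    show "R (Suc n) \<subseteq> R n"
    proof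
      fix q assume q: "q \<in> R (Suc n)"
      have "\<psi> n x t = \<psi> (Suc n) x (\<phi> n t)" if "t \<in> carrier (T n)" for x t
        using lim.compatible[OF that] by (simp add: \<psi>_def)
      moreover have "\<phi> n t \<in> carrier (T (Suc n))" if "t \<in> carrier (T n)" for t
        using lim.hom_\<phi>[of n] that by (auto simp: star_hom_def)
      ultimately show "q \<in> R n" using q by (simp add: R_def)
    qed
  next
    fix x y assume xy: "\<And>n. (x, y) \<in> R n"
    then have xX: "x \<in> mspace X" "y \<in> mspace X" by (auto simp: R_def)
    have "x = y"
    proof (rule ccontr)
      assume "x \<noteq> y"
      define d where "d = mdist X x y"
      have d: "d > 0"
        using mdist_eq_0_iff[OF xX] \<open>x \<noteq> y\<close> Metric_space.nonneg[OF Metric_space_mspace_mdist, of X x y]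
        by (simp add: d_def less_le)
      \<comment> \<open>The distance to x takes the values 0 at x and d at y; a stage element within
        d / 2 of it cannot have equal values at both.\<close>
      define g where "g = (\<lambda>z\<in>mspace X. complex_of_real (mdist X x z))"
      have "continuous_map ?X euclideanreal (\<lambda>z. mdist X x z)"
        using xX by (intro continuous_map_mdist) auto
      then have "continuous_map ?X euclidean (complex_of_real \<circ> (\<lambda>z. mdist X x z))"
        by (rule continuous_map_compose) (auto intro: continuous_intros)
      then have g: "g \<in> carrier ?C"
        unfolding g_def using restrict_in_C_alg[of ?X] by (simp add: o_def)
      have hg: "h g \<in> carrier L" using h(1) g by (auto simp: star_hom_def)
      obtain n t where t: "t \<in> carrier (T n)" "nrm L (h g \<ominus>\<^bsub>L\<^esub> \<mu> n t) < d / 2"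
        using lim.dense[OF hg, of "d / 2"] d by auto
      \<comment> \<open>Smallness in the norm of \<open>L\<close> passes to the value at z because
        evaluation at z is a character of \<open>L\<close>.\<close>
      have near: "cmod (g z - \<psi> n z t) < d / 2" if z: "z \<in> mspace X" for z
      proof -
        have "g z - \<psi> n z t = k (h g \<ominus>\<^bsub>L\<^esub> \<mu> n t) z"
          using L.character_minus[OF charL[OF z] hg \<mu>L[OF t(1)]] by (simp add: kh[OF g] \<psi>_def)
        with L.character_le_nrm[OF charL[OF z] L.minus_closed[OF hg \<mu>L[OF t(1)]]] t(2)
        show ?thesis by simp
      qed
      have "\<psi> n x t = \<psi> n y t" using xy[of n] t(1) by (simp add: R_def)
      then have "cmod (g x - g y) < d / 2 + d / 2"
        using near[OF xX(1)] near[OF xX(2)] norm_triangle_ineq4[of "g x - \<psi> n x t" "g y - \<psi> n y t"] by simp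
      moreover have "g x = 0" using xX mdist_eq_0_iff[OF xX(1) xX(1)] by (simp add: g_def)
      moreover have "cmod (g y) = d" using xX d by (simp add: g_def d_def)
      ultimately show False by (simp add: norm_minus_commute)
    qed
    then have "mdist X x y = 0" using mdist_eq_0_iff[OF xX] by simp
    with e show "mdist X x y < e" by simp
  qed blast
  obtain f where f: "continuous_map ?X euclideanreal f"
    "\<And>x y t. \<lbrakk>x \<in> topspace ?X; y \<in> topspace ?X; f x = f y; t \<in> carrier (T n)\<rbrakk> \<Longrightarrow> \<psi> n x t = \<psi> n y t"
    using tensor_characters_real_parameter[OF tensor[of n] F(1,2)[of n], of ?X "\<psi> n"] \<psi> cont by auto
  have "real_embeddable_up_to X e f"
    unfolding real_embeddable_up_to_def
  proof (intro conjI ballI impI f(1))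
    fix x y assume xy: "x \<in> mspace X" "y \<in> mspace X" "f x = f y"
    then have "(x, y) \<in> R n" using f(2)[of x y] by (simp add: R_def)
    then show "mdist X x y < e" by (rule n)
  qed
  then show ?thesis by blast
qed

theorem theorem1:
  fixes X :: "'a metric"
  assumes "compact_space (mtopology_of X)"
  shows "(almost_chainable X \<longleftrightarrow> generalized_arc_like X) \<and>
         (generalized_arc_like X \<longleftrightarrow> inverse_limit_of_intervals (mtopology_of X)) \<and>
         (inverse_limit_of_intervals (mtopology_of X) \<longleftrightarrow> AI_algebra (C_alg (mtopology_of X)))"
proof -
  let ?P = "\<forall>e>0. \<exists>f. real_embeddable_up_to X e f"
  note X = assms
  have "almost_chainable X \<longleftrightarrow> ?P"
    using almost_chainable_if_real_embeddable[OF X] real_embeddable_if_almost_chainable[OF X] by metis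
  moreover have "generalized_arc_like X \<longleftrightarrow> ?P"
    using generalized_arc_like_if_real_embeddable[OF X] real_embeddable_if_generalized_arc_like[OF X] by metis
  moreover have "inverse_limit_of_intervals (mtopology_of X) \<longleftrightarrow> ?P"
    using inverse_limit_if_real_embeddable[OF X] real_embeddable_if_inverse_limit[OF X] by metis
  moreover have "AI_algebra (C_alg (mtopology_of X)) \<longleftrightarrow> ?P"
    using AI_algebra_if_inverse_limit[OF X] inverse_limit_if_real_embeddable[OF X]
      real_embeddable_if_AI_algebra[OF X] by metis
  ultimately show ?thesis by blast
qed

end
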